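(* Let $W$ be a finite Coxeter group of type $A_n$ ($n\ge 2$), $B_n$ ($n\ge 2$) or $I_2(m)$ ($m\ge 3$), let $c=c_-c_+$ be a bipartite Coxeter element, and let $o$ be the following $W$-orbit: in type $A_n$, $o=\{e_1,\dots,e_{n+1}\}$; in type $B_n$, $o=\{\pm e_1,\dots,\pm e_n\}$; in type $I_2(m)$, $o$ is an orbit consisting of the vertices of a regular $m$-gon. Then a parabolic subgroup $W'$ of $W$ is noncrossing (with respect to $c$) if and only if the convex hulls of the blocks of its Coxeter-plane diagram (the projection to the Coxeter plane $P$ of the partition of $o$ into $W'$-orbits) are pairwise disjoint.
   Context: Setting. $(W,S)$ is a finite irreducible Coxeter system of rank $n$, represented as a real reflection group on a Euclidean space $V$ so that only the origin is fixed by $W$ (so $\dim V=n$). $T$ is the set of reflections of $W$. For each $s\in S$ let $\alpha_s$ be the unit simple root normal to the reflecting hyperplane $H_s$, with $\langle\alpha_s,\alpha_{s'}\rangle\le 0$ for $s\ne s'$. Type $A_n$ is the symmetric group $S_{n+1}$ permuting coordinates of $\mathbb{R}^{n+1}$ modulo the line spanned by $(1,\dots,1)$ (equivalently, project orthogonally to the hyperplane where coordinates sum to zero); type $B_n$ is the group of signed permutations acting on $\mathbb{R}^n$; type $I_2(m)$ is the dihedral group of order $2m$ acting on $\mathbb{R}^2$. Bipartite Coxeter element. $S=S_+\sqcup S_-$ is a bipartition of the Coxeter diagram (elements within each part commute pairwise), $c_\pm=\prod_{s\in S_\pm}s$, $c=c_-c_+$, and $h$ is the order of $c$ (the Coxeter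 number). Parabolic subgroups. A parabolic subgroup of $W$ is a conjugate of a subgroup generated by a subset of $S$. A reduced $T$-word for $w\in W$ is a shortest expression of $w$ as a product of elements of $T$. The absolute order: $u\le v$ iff some reduced $T$-word for $u$ is a prefix of some reduced $T$-word for $v$. For $x\in[1,c]$ with reduced $T$-word $t_1\cdots t_i$, the group $\langle t_1,\dots,t_i\rangle$ is parabolic; the parabolic subgroups arising this way are called noncrossing (with respect to $c$), all other parabolic subgroups are crossing. Coxeter plane. Let $(c_s)_{s\in S}$ be a positive eigenvector of the Gram matrix $(\langle\alpha_s,\alpha_{s'}\rangle)$ for its smallest eigenvalue, and let $(\omega_s)$ be the basis of $V$ dual to $(\alpha_s)$. The Coxeter plane is $P=\mathrm{span}(\lambda,\mu)$, where $\lambda=\sum_{s\in S_+}c_s\omega_s$ and $\mu=\sum_{s\in S_-}c_s\omega_s$. It is preserved by $\langle c_+,c_-\rangle$, which acts on $P$ as a dihedral reflection group of order $2h$. Coxeter-plane diagram. A parabolic subgroup $W'$ partitions $o$ into $W'$-orbits, called blocks. The Coxeter-plane diagram of $W'$ is the orthogonal projection of this partition to $P$; convex hulls of blocks are the convex hulls in $P$ of the projected blocks. *)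

theory Defs
  imports
    "HOL-Analysis.Analysis"
    "HOL-Algebra.Generated_Groups"
    "HOL-Library.Sublist"
    "HOL-Library.Disjoint_Sets"
begin

section \<open>Reflection groups and simple systems\<close>

text \<open>
  A finite reflection group is given as a set \<open>W\<close> of linear maps of a Euclidean space. The
  space may be larger than the reflection representation \<open>V\<close> (in type A it is \<open>\<real>\<^sup>n\<^sup>+\<^sup>1\<close>): \<open>V\<close> is
  the span of a simple system, and \<open>W\<close> fixes its orthogonal complement pointwise.
\<close>

definition map_group :: "('a \<Rightarrow> 'a) set \<Rightarrow> ('a \<Rightarrow> 'a) monoid" where
  "map_group W = \<lparr>carrier = W, monoid.mult = (\<circ>), one = id\<rparr>"

definition reflect_along :: "'a::euclidean_space \<Rightarrow> 'a \<Rightarrow> 'a" where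
  "reflect_along a x = x - (2 * (x \<bullet> a) / (a \<bullet> a)) *\<^sub>R a"

definition reflections :: "('a::euclidean_space \<Rightarrow> 'a) set \<Rightarrow> ('a \<Rightarrow> 'a) set" where
  "reflections W = {t \<in> W. \<exists>a. a \<noteq> 0 \<and> t = reflect_along a}"

definition unit_roots :: "('a::euclidean_space \<Rightarrow> 'a) set \<Rightarrow> 'a set" where
  "unit_roots W = {a. norm a = 1 \<and> reflect_along a \<in> W}"

text \<open>
  The simple roots index the simple reflections: \<open>S = reflect_along ` \<Delta>\<close>. Nonpositivity of the
  inner products of distinct simple roots is a consequence of this definition.
\<close>

definition simple_system :: "('a::euclidean_space \<Rightarrow> 'a) set \<Rightarrow> 'a set \<Rightarrow> bool" where
  "simple_system W \<Delta> \<longleftrightarrow>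
     \<Delta> \<subseteq> unit_roots W \<and> independent \<Delta> \<and>
     (\<forall>\<beta>\<in>unit_roots W. \<exists>k. \<beta> = (\<Sum>\<alpha>\<in>\<Delta>. k \<alpha> *\<^sub>R \<alpha>) \<and>
        ((\<forall>\<alpha>\<in>\<Delta>. k \<alpha> \<ge> 0) \<or> (\<forall>\<alpha>\<in>\<Delta>. k \<alpha> \<le> 0)))"

section \<open>The three types\<close>

definition coordinate_permutations :: "(real^'n \<Rightarrow> real^'n) set" where
  "coordinate_permutations = {\<lambda>x. \<chi> i. x $ \<pi> i | \<pi>. bij \<pi>}"

definition signed_coordinate_permutations :: "(real^'n \<Rightarrow> real^'n) set" where
  "signed_coordinate_permutations =
     {\<lambda>x. \<chi> i. \<epsilon> i * x $ \<pi> i | \<epsilon> \<pi>. bij \<pi> \<and> range \<epsilon> \<subseteq> {-1, 1}}"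

definition regular_polygon :: "nat \<Rightarrow> 'a::euclidean_space set \<Rightarrow> bool" where
  "regular_polygon m X \<longleftrightarrow>
     (\<exists>u v. u \<noteq> 0 \<and> norm v = norm u \<and> orthogonal u v \<and>
        X = (\<lambda>k. cos (2 * pi * real k / real m) *\<^sub>R u + sin (2 * pi * real k / real m) *\<^sub>R v) ` {..<m})"

text \<open>Used only in dimension two, where it is the symmetry group of a regular polygon centred at 0.\<close>

definition dihedral_group :: "nat \<Rightarrow> ('a::euclidean_space \<Rightarrow> 'a) set \<Rightarrow> bool" where
  "dihedral_group m W \<longleftrightarrow>
     (\<exists>D. regular_polygon m D \<and> W = {f. orthogonal_transformation f \<and> f ` D = D})"

definition orbit_of :: "('a \<Rightarrow> 'a) set \<Rightarrow> 'a \<Rightarrow> 'a set" where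
  "orbit_of H x = (\<lambda>w. w x) ` H"

text \<open>
  In type A the orbit is kept in \<open>\<real>\<^sup>n\<^sup>+\<^sup>1\<close>: projecting \<open>e\<^sub>i\<close> first to the sum-zero hyperplane and
  then to the Coxeter plane inside it is the same as projecting directly to the Coxeter plane.
\<close>

definition type_A :: "nat \<Rightarrow> (real^'n \<Rightarrow> real^'n) set \<Rightarrow> (real^'n) set \<Rightarrow> bool" where
  "type_A n W X \<longleftrightarrow>
     CARD('n) = n + 1 \<and> W = coordinate_permutations \<and> X = range (\<lambda>i. axis i 1)"

definition type_B :: "nat \<Rightarrow> (real^'n \<Rightarrow> real^'n) set \<Rightarrow> (real^'n) set \<Rightarrow> bool" where
  "type_B n W X \<longleftrightarrow>
     CARD('n) = n \<and> W = signed_coordinate_permutations \<and>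
     X = range (\<lambda>i. axis i 1) \<union> range (\<lambda>i. - axis i 1)"

definition type_I2 :: "nat \<Rightarrow> (real^'n \<Rightarrow> real^'n) set \<Rightarrow> (real^'n) set \<Rightarrow> bool" where
  "type_I2 m W X \<longleftrightarrow>
     CARD('n) = 2 \<and> dihedral_group m W \<and> regular_polygon m X \<and> (\<exists>x. X = orbit_of W x)"

section \<open>Bipartite Coxeter elements\<close>

definition word_prod :: "('a \<Rightarrow> 'a) list \<Rightarrow> 'a \<Rightarrow> 'a" where
  "word_prod ts = foldr (\<circ>) ts id"

definition bipartition :: "'a::euclidean_space set \<Rightarrow> 'a set \<Rightarrow> 'a set \<Rightarrow> bool" where
  "bipartition \<Delta> \<Delta>p \<Delta>m \<longleftrightarrow>
     \<Delta> = \<Delta>p \<union> \<Delta>m \<and> \<Delta>p \<inter> \<Delta>m = {} \<and>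
     (\<forall>D\<in>{\<Delta>p, \<Delta>m}. pairwise (\<lambda>\<alpha> \<beta>.
        reflect_along \<alpha> \<circ> reflect_along \<beta> = reflect_along \<beta> \<circ> reflect_along \<alpha>) D)"

text \<open>The factors commute, so the product does not depend on the enumeration.\<close>

definition simple_product :: "'a::euclidean_space set \<Rightarrow> ('a \<Rightarrow> 'a) \<Rightarrow> bool" where
  "simple_product D f \<longleftrightarrow>
     (\<exists>as. distinct as \<and> set as = D \<and> f = word_prod (map reflect_along as))"

definition bipartite_coxeter_element ::
  "'a::euclidean_space set \<Rightarrow> 'a set \<Rightarrow> ('a \<Rightarrow> 'a) \<Rightarrow> bool" where
  "bipartite_coxeter_element \<Delta>p \<Delta>m c \<longleftrightarrow>
     (\<exists>cp cm. simple_product \<Delta>p cp \<and> simple_product \<Delta>m cm \<and> c = cm \<circ> cp)"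

section \<open>Noncrossing parabolic subgroups\<close>

definition parabolic ::
  "('a::euclidean_space \<Rightarrow> 'a) set \<Rightarrow> 'a set \<Rightarrow> ('a \<Rightarrow> 'a) set \<Rightarrow> bool" where
  "parabolic W \<Delta> H \<longleftrightarrow>
     (\<exists>J w. J \<subseteq> \<Delta> \<and> w \<in> W \<and>
        H = (\<lambda>u. w \<circ> u \<circ> inv_into UNIV w) ` generate (map_group W) (reflect_along ` J))"

definition reduced_T_word ::
  "('a::euclidean_space \<Rightarrow> 'a) set \<Rightarrow> ('a \<Rightarrow> 'a) list \<Rightarrow> ('a \<Rightarrow> 'a) \<Rightarrow> bool" where
  "reduced_T_word W ts w \<longleftrightarrow>
     set ts \<subseteq> reflections W \<and> word_prod ts = w \<and>
     (\<forall>us. set us \<subseteq> reflections W \<and> word_prod us = w \<longrightarrow> length ts \<le> length us)"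

definition absolute_le ::
  "('a::euclidean_space \<Rightarrow> 'a) set \<Rightarrow> ('a \<Rightarrow> 'a) \<Rightarrow> ('a \<Rightarrow> 'a) \<Rightarrow> bool" where
  "absolute_le W u v \<longleftrightarrow>
     (\<exists>us vs. reduced_T_word W us u \<and> reduced_T_word W vs v \<and> prefix us vs)"

definition noncrossing ::
  "('a::euclidean_space \<Rightarrow> 'a) set \<Rightarrow> 'a set \<Rightarrow> ('a \<Rightarrow> 'a) \<Rightarrow> ('a \<Rightarrow> 'a) set \<Rightarrow> bool" where
  "noncrossing W \<Delta> c H \<longleftrightarrow>
     parabolic W \<Delta> H \<and>
     (\<exists>x ts. absolute_le W id x \<and> absolute_le W x c \<and> reduced_T_word W ts x \<and>
        H = generate (map_group W) (set ts))"

section \<open>The Coxeter plane and its diagrams\<close>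

text \<open>
  An eigenvector of the Gram matrix of \<open>\<Delta>\<close> is a function on the simple roots; its values
  outside \<open>\<Delta>\<close> are irrelevant.
\<close>

definition gram_eigenvector ::
  "'a::euclidean_space set \<Rightarrow> real \<Rightarrow> ('a \<Rightarrow> real) \<Rightarrow> bool" where
  "gram_eigenvector \<Delta> l k \<longleftrightarrow>
     (\<exists>\<alpha>\<in>\<Delta>. k \<alpha> \<noteq> 0) \<and> (\<forall>\<alpha>\<in>\<Delta>. (\<Sum>\<beta>\<in>\<Delta>. (\<alpha> \<bullet> \<beta>) * k \<beta>) = l * k \<alpha>)"

definition smallest_gram_eigenvalue :: "'a::euclidean_space set \<Rightarrow> real \<Rightarrow> bool" where
  "smallest_gram_eigenvalue \<Delta> l \<longleftrightarrow>
     (\<exists>k. gram_eigenvector \<Delta> l k) \<and> (\<forall>l' k. gram_eigenvector \<Delta> l' k \<longrightarrow> l \<le> l')"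

definition dual_basis :: "'a::euclidean_space set \<Rightarrow> ('a \<Rightarrow> 'a) \<Rightarrow> bool" where
  "dual_basis \<Delta> \<omega> \<longleftrightarrow>
     (\<forall>\<alpha>\<in>\<Delta>. \<omega> \<alpha> \<in> span \<Delta> \<and> (\<forall>\<beta>\<in>\<Delta>. \<omega> \<alpha> \<bullet> \<beta> = (if \<alpha> = \<beta> then 1 else 0)))"

definition coxeter_plane ::
  "'a::euclidean_space set \<Rightarrow> 'a set \<Rightarrow> 'a set \<Rightarrow> 'a set \<Rightarrow> bool" where
  "coxeter_plane \<Delta> \<Delta>p \<Delta>m P \<longleftrightarrow>
     (\<exists>l k \<omega>. smallest_gram_eigenvalue \<Delta> l \<and> gram_eigenvector \<Delta> l k \<and>
        (\<forall>\<alpha>\<in>\<Delta>. k \<alpha> > 0) \<and> dual_basis \<Delta> \<omega> \<and>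
        P = span {\<Sum>\<alpha>\<in>\<Delta>p. k \<alpha> *\<^sub>R \<omega> \<alpha>, \<Sum>\<alpha>\<in>\<Delta>m. k \<alpha> *\<^sub>R \<omega> \<alpha>})"

definition orth_proj :: "'a::euclidean_space set \<Rightarrow> 'a \<Rightarrow> 'a" where
  "orth_proj P x = (THE y. y \<in> P \<and> (\<forall>z\<in>P. orthogonal (x - y) z))"

definition blocks :: "('a \<Rightarrow> 'a) set \<Rightarrow> 'a set \<Rightarrow> 'a set set" where
  "blocks H X = orbit_of H ` X"

text \<open>
  The family is indexed by the blocks themselves, so two distinct blocks with the same
  projection count as meeting.
\<close>

definition block_hulls_disjoint ::
  "'a::euclidean_space set \<Rightarrow> ('a \<Rightarrow> 'a) set \<Rightarrow> 'a set \<Rightarrow> bool" where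
  "block_hulls_disjoint P H X \<longleftrightarrow>
     disjoint_family_on (\<lambda>B. convex hull (orth_proj P ` B)) (blocks H X)"

end

(*
  Types A and B. The orbit X is an orthonormal basis, or an orthonormal basis together with its
  negatives. Sorting X by a functional that is positive on the simple roots gives a chain
  g 0, ..., g (h - 1) whose consecutive differences are the simple roots up to scaling. The positive
  eigenvector of the Gram matrix is then a sine, and the projection of X to the Coxeter plane is
  linearly equivalent to the h-th roots of unity, with c acting as rotation by 2 pi / h. Hence hulls
  of blocks meet iff the blocks cross in the cyclic order given by c.

  Write p, c p, ..., q for an arc and w for the sum of its points except q, so that c w - w = q - p.
  If H is generated by a prefix of a reduced word of c with product x, and p, q lie in one H-orbit,
  then x w - w = q - p as well. So for any other block B, the part of B on which the inner product
  with w equals 1 is x-invariant, hence H-invariant, hence empty or B: no block crosses another.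
  Conversely, if the blocks do not cross, let x map each point to the next point of its block in the
  cyclic order. An arc from p to x p is p plus a union of blocks, so c w - w = x w - w = x p - p, and
  comparing dimensions gives l(x) + l(x^-1 c) = l(c) for the reflection length l.

  Type I_2: the plane is the whole space, every parabolic subgroup has a reduced word that is a
  prefix of a word of c, and the nontrivial blocks lie on parallel chords of a circle.
*)
theory Submission
  imports Defs
begin

subsection \<open>Reflections and reflection words\<close>

text \<open>Reflection length is the dimension of \<open>moved f\<close>, the image of
  \<open>f - 1\<close>. In a reduced word of \<open>c\<close> the roots of a prefix and the roots of
  the rest span subspaces that meet only in 0. Since \<open>q - p\<close> lies in the span of the
  prefix roots, the rest of the word must fix \<open>w\<close>; this is why \<open>x\<close> moves
  \<open>w\<close> exactly as \<open>c\<close> does. The obstacle is type B: an antipodal pair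
  inside an arc cancels in \<open>w\<close>, so \<open>w\<close> no longer indicates the arc. It
  does for arcs with at most half of the points, and one of the two arcs between \<open>p\<close>
  and \<open>q\<close> is that short. The converse meets type B a second time. The letters of a word
  for \<open>x\<close> might generate only a group of type D, so when some block contains antipodes
  the word is made to start with a sign change. One sign change suffices, because two blocks with
  antipodes would cross. No standard simple system is fixed: \<Delta> is arbitrary, and the chain
  and the sine are recovered from \<open>simple_system\<close> and from positivity of the
  eigenvector.\<close>

lemma linear_reflect_along: "linear (reflect_along a)"
  by (rule linearI) (auto simp: reflect_along_def inner_add_left algebra_simps add_divide_distrib)

lemma inner_reflect_along: "reflect_along a x \<bullet> reflect_along a y = x \<bullet> y"
  by (cases "a = 0") (auto simp: reflect_along_def inner_diff inner_commute field_simps)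

lemma orthogonal_reflect_along: "orthogonal_transformation (reflect_along a)"
  by (simp add: orthogonal_transformation_def linear_reflect_along inner_reflect_along)

lemma reflect_along_involution [simp]: "reflect_along a (reflect_along a x) = x"
  by (cases "a = 0") (auto simp: reflect_along_def inner_diff algebra_simps)

lemma reflect_along_comp_self [simp]: "reflect_along a \<circ> reflect_along a = id"
  by (auto simp: fun_eq_iff)

lemma reflect_along_scaleR: "k \<noteq> 0 \<Longrightarrow> reflect_along (k *\<^sub>R a) = reflect_along a"
  by (auto simp: fun_eq_iff reflect_along_def)

lemma reflect_along_self [simp]: "reflect_along a a = - a"
  by (cases "a = 0") (auto simp: reflect_along_def scaleR_2)

lemma reflect_along_orthogonal: "x \<bullet> a = 0 \<Longrightarrow> reflect_along a x = x"
  by (simp add: reflect_along_def)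

lemma reflect_along_swap:
  assumes "norm p = norm q"
  shows "reflect_along (p - q) p = q"
proof -
  have "p \<bullet> p = q \<bullet> q" using assms by (simp add: norm_eq_sqrt_inner)
  then have "2 * (p \<bullet> (p - q)) = (p - q) \<bullet> (p - q)"
    by (simp add: inner_diff inner_commute algebra_simps)
  then show ?thesis
    by (cases "p = q") (auto simp: reflect_along_def)
qed

lemma reflect_along_swap':
  assumes "norm p = norm q"
  shows "reflect_along (p - q) q = p"
  using reflect_along_swap[OF assms] by (metis reflect_along_involution)

lemma reflect_along_conj:
  assumes "orthogonal_transformation w"
  shows "w (reflect_along a x) = reflect_along (w a) (w x)"
proof -
  have "linear w" and [simp]: "\<And>u v. w u \<bullet> w v = u \<bullet> v"
    using assms by (auto simp: orthogonal_transformation_def)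
  then show ?thesis by (simp add: reflect_along_def linear_diff linear_scale)
qed

lemma reflect_along_minus_commute: "reflect_along (p - q) = reflect_along (q - p)"
  using reflect_along_scaleR[of "-1" "q - p"] by simp

lemma reflect_along_neq_id:
  assumes "a \<noteq> 0"
  shows "reflect_along a \<noteq> id"
proof
  assume "reflect_along a = id"
  then have "- a = a" using reflect_along_self[of a] by simp
  then have "2 *\<^sub>R a = 0" by (metis scaleR_2 add.right_inverse)
  then show False using assms by simp
qed

lemma word_prod_Nil [simp]: "word_prod [] = id"
  by (simp add: word_prod_def)

lemma word_prod_Cons [simp]: "word_prod (t # ts) = t \<circ> word_prod ts"
  by (simp add: word_prod_def)

lemma word_prod_append [simp]: "word_prod (us @ vs) = word_prod us \<circ> word_prod vs"
  by (induction us) (auto simp: comp_assoc)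

subsection \<open>The moved space\<close>

text \<open>The image of \<open>f - 1\<close>. For orthogonal \<open>f\<close> it is the orthogonal
  complement of the fixed space, and in the groups below its dimension is the reflection
  length.\<close>

definition moved :: "('a::euclidean_space \<Rightarrow> 'a) \<Rightarrow> 'a set" where
  "moved f = range (\<lambda>v. f v - v)"

lemma moved_in [simp]: "f v - v \<in> moved f"
  by (auto simp: moved_def)

lemma subspace_moved: "linear f \<Longrightarrow> subspace (moved f)"
  unfolding moved_def
  using linear_subspace_image[of "\<lambda>v. f v - v" UNIV] linear_compose_sub[of f "\<lambda>v. v"]
  by (simp add: linear_ident)

lemma inner_moved_fixed:
  assumes "orthogonal_transformation f" "f z = z" "u \<in> moved f"
  shows "z \<bullet> u = 0"
proof -
  obtain v where "u = f v - v" using assms(3) by (auto simp: moved_def)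
  moreover have "f z \<bullet> f v = z \<bullet> v" using assms(1) by (simp add: orthogonal_transformation_def)
  ultimately show ?thesis using assms(2) by (simp add: inner_diff)
qed

text \<open>If \<open>z\<close> is orthogonal to \<open>f z - z\<close>, then \<open>f z\<close> has
  the length of \<open>z\<close> and the same inner product with \<open>z\<close> as
  \<open>z\<close> itself, so the two coincide.\<close>

lemma fixed_if_orthogonal_moved:
  assumes "orthogonal_transformation f" "\<And>u. u \<in> moved f \<Longrightarrow> z \<bullet> u = 0"
  shows "f z = z"
proof -
  have "z \<bullet> (f z - z) = 0" using assms(2) by simp
  moreover have "f z \<bullet> f z = z \<bullet> z" using assms(1) by (simp add: orthogonal_transformation_def)
  ultimately have "(f z - z) \<bullet> (f z - z) = 0" by (simp add: inner_diff inner_commute)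
  then show ?thesis by simp
qed

text \<open>Write \<open>a = f v - v\<close>. The reflection along \<open>a\<close> swaps
  \<open>f v\<close> and \<open>v\<close>, so the composite fixes \<open>v\<close>; but
  \<open>v\<close> is not orthogonal to \<open>a\<close>, hence \<open>a\<close> has left the moved
  space.\<close>

lemma moved_reflect_along_comp:
  assumes f: "orthogonal_transformation f" and a: "a \<in> moved f" "a \<noteq> 0"
  shows "moved (reflect_along a \<circ> f) \<subseteq> moved f" (is "moved ?g \<subseteq> _")
    and "dim (moved (reflect_along a \<circ> f)) < dim (moved f)"
proof -
  have lin: "linear f" using f by (simp add: orthogonal_transformation_linear)
  have g: "orthogonal_transformation ?g"
    using f orthogonal_reflect_along by (intro orthogonal_transformation_compose)
  have sub: "subspace (moved f)" using lin by (rule subspace_moved)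
  show s1: "moved ?g \<subseteq> moved f"
  proof
    fix u assume "u \<in> moved ?g"
    then obtain v where "u = ?g v - v" by (auto simp: moved_def)
    then have "u = (f v - v) - (2 * (f v \<bullet> a) / (a \<bullet> a)) *\<^sub>R a"
      by (simp add: reflect_along_def)
    then show "u \<in> moved f"
      using sub a by (metis moved_in subspace_diff subspace_scale)
  qed
  obtain v where v: "a = f v - v" using a by (auto simp: moved_def)
  have nrm: "norm (f v) = norm v" using f by (simp add: orthogonal_transformation_norm)
  have "?g v = v" using reflect_along_swap[OF nrm] by (simp add: v)
  moreover have "v \<bullet> a \<noteq> 0"
  proof
    assume "v \<bullet> a = 0"
    then have "v \<bullet> f v = v \<bullet> v" by (simp add: v inner_diff)
    moreover have "f v \<bullet> f v = v \<bullet> v" using f by (simp add: orthogonal_transformation_def)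
    ultimately have "a \<bullet> a = 0" by (simp add: v inner_diff inner_commute)
    then show False using a by simp
  qed
  ultimately have "a \<notin> moved ?g" using inner_moved_fixed[OF g] by blast
  then have "moved ?g \<subset> moved f" using s1 a by blast
  then show "dim (moved ?g) < dim (moved f)"
    by (metis dim_psubset g orthogonal_transformation_linear span_eq_iff sub subspace_moved)
qed

lemma word_prod_moves:
  assumes "subspace U" "\<And>t. t \<in> set ts \<Longrightarrow> \<exists>a\<in>U. t = reflect_along a"
  shows "word_prod ts v - v \<in> U"
  using assms(2)
proof (induction ts)
  case Nil
  then show ?case using assms(1) by (simp add: subspace_0)
next
  case (Cons t ts)
  let ?x = "word_prod ts v"
  obtain a where a: "a \<in> U" "t = reflect_along a" using Cons.prems[of t] by auto
  have "t ?x - v = (?x - v) - (2 * (?x \<bullet> a) / (a \<bullet> a)) *\<^sub>R a"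
    by (simp add: a reflect_along_def)
  also have "\<dots> \<in> U" using Cons a assms(1) by (auto intro!: subspace_diff subspace_scale)
  finally show ?case by simp
qed

lemma word_prod_fixes:
  assumes "\<And>t. t \<in> set ts \<Longrightarrow> t v = v"
  shows "word_prod ts v = v"
  using assms by (induction ts) auto

text \<open>Each letter displaces only along its own root, so the moved space lies in the span of
  the roots. This is the lower bound for the reflection length.\<close>

lemma dim_moved_word_prod:
  assumes "set ts \<subseteq> range reflect_along"
  shows "dim (moved (word_prod ts)) \<le> length ts"
proof -
  obtain as where as: "ts = map reflect_along as"
    using assms by (metis ex_map_conv rangeE subsetD)
  have "moved (word_prod ts) \<subseteq> span (set as)"
    unfolding moved_def using word_prod_moves[of "span (set as)" ts]
    by (auto simp: as intro: span_base)
  then have "dim (moved (word_prod ts)) \<le> card (set as)" by (simp add: dim_le_card)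
  also have "\<dots> \<le> length ts" by (simp add: as card_length)
  finally show ?thesis .
qed

text \<open>Carter's lemma: a word of length \<open>dim (moved y)\<close>, built greedily.\<close>

lemma reflection_word_exists:
  assumes step: "\<And>y. y \<in> K \<Longrightarrow> y \<noteq> id \<Longrightarrow>
      \<exists>a\<in>moved y. a \<noteq> 0 \<and> reflect_along a \<in> R \<and> reflect_along a \<circ> y \<in> K"
    and orth: "\<And>y. y \<in> K \<Longrightarrow> orthogonal_transformation y"
    and "y \<in> K"
  shows "\<exists>ts. set ts \<subseteq> R \<and> word_prod ts = y \<and> length ts \<le> dim (moved y)"
  using \<open>y \<in> K\<close>
proof (induction "dim (moved y)" arbitrary: y rule: less_induct)
  case less
  show ?case
  proof (cases "y = id")
    case True
    then show ?thesis by (intro exI[of _ "[]"]) auto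
  next
    case False
    obtain a where a: "a \<in> moved y" "a \<noteq> 0" "reflect_along a \<in> R" "reflect_along a \<circ> y \<in> K"
      using step[OF less.prems False] by blast
    have lt: "dim (moved (reflect_along a \<circ> y)) < dim (moved y)"
      using moved_reflect_along_comp(2)[OF orth[OF less.prems] a(1,2)] .
    obtain ts where "set ts \<subseteq> R" "word_prod ts = reflect_along a \<circ> y"
      "length ts \<le> dim (moved (reflect_along a \<circ> y))"
      using less.hyps[OF lt a(4)] by blast
    then show ?thesis using a lt
      by (intro exI[of _ "reflect_along a # ts"]) (auto simp: o_assoc)
  qed
qed

subsection \<open>Generated subgroups\<close>

text \<open>No inverses occur: the generators will be involutions, and then this is the generated
  group. The form allows induction letter by letter.\<close>

definition words :: "('a \<Rightarrow> 'a) set \<Rightarrow> ('a \<Rightarrow> 'a) set" where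
  "words S = {word_prod ts | ts. set ts \<subseteq> S}"

lemma wordsI: "set ts \<subseteq> S \<Longrightarrow> word_prod ts = f \<Longrightarrow> f \<in> words S"
  by (auto simp: words_def)

lemma id_in_words: "id \<in> words S"
  by (rule wordsI[of "[]"]) auto

lemma words_base: "t \<in> S \<Longrightarrow> t \<in> words S"
  by (rule wordsI[of "[t]"]) auto

lemma words_comp: "f \<in> words S \<Longrightarrow> g \<in> words S \<Longrightarrow> f \<circ> g \<in> words S"
  unfolding words_def
  by (clarsimp, metis Un_least set_append word_prod_append)

lemma words_induct [consumes 1, case_names id step]:
  assumes "f \<in> words S" "P id" "\<And>t f. t \<in> S \<Longrightarrow> f \<in> words S \<Longrightarrow> P f \<Longrightarrow> P (t \<circ> f)"
  shows "P f"
proof -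
  obtain ts where ts: "f = word_prod ts" "set ts \<subseteq> S" using assms(1) by (auto simp: words_def)
  have "set ts \<subseteq> S \<Longrightarrow> P (word_prod ts)"
    by (induction ts) (auto intro!: assms(2,3) wordsI simp flip: id_def)
  then show ?thesis using ts by simp
qed

lemma words_least:
  assumes "S \<subseteq> K" "id \<in> K" "\<And>f g. f \<in> K \<Longrightarrow> g \<in> K \<Longrightarrow> f \<circ> g \<in> K"
  shows "words S \<subseteq> K"
proof
  fix f assume "f \<in> words S"
  then show "f \<in> K" by (induction rule: words_induct) (use assms in blast)+
qed

lemma words_subset: "S \<subseteq> words T \<Longrightarrow> words S \<subseteq> words T"
  by (rule words_least) (assumption | rule id_in_words words_comp)+

lemma map_group_simps:
  "carrier (map_group W) = W"
  "x \<otimes>\<^bsub>map_group W\<^esub> y = x \<circ> y"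
  "\<one>\<^bsub>map_group W\<^esub> = id"
  unfolding map_group_def by simp_all

lemma generate_eq_words:
  assumes "Group.group (map_group W)" "S \<subseteq> W" "\<And>s. s \<in> S \<Longrightarrow> s \<circ> s = id"
  shows "generate (map_group W) S = words S"
proof
  interpret group "map_group W" by fact
  have inv: "inv\<^bsub>map_group W\<^esub> s = s" if "s \<in> S" for s
    by (rule inv_equality) (use that assms in \<open>auto simp only: map_group_simps\<close>)
  show "generate (map_group W) S \<subseteq> words S"
  proof
    fix f assume "f \<in> generate (map_group W) S"
    then show "f \<in> words S"
    proof induction
      case one
      show ?case unfolding map_group_simps by (rule id_in_words)
    next
      case (incl h)
      then show ?case by (rule words_base)
    next
      case (inv h)
      then show ?case using words_base by (metis \<open>\<And>s. s \<in> S \<Longrightarrow> inv\<^bsub>map_group W\<^esub> s = s\<close>)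
    next
      case (eng h1 h2)
      then show ?case unfolding map_group_simps by (intro words_comp)
    qed
  qed
  show "words S \<subseteq> generate (map_group W) S"
  proof (rule words_least)
    show "S \<subseteq> generate (map_group W) S" by (auto intro: generate.incl)
    show "id \<in> generate (map_group W) S"
      using generate.one[of "map_group W" S] unfolding map_group_simps .
    show "f \<circ> g \<in> generate (map_group W) S"
      if "f \<in> generate (map_group W) S" "g \<in> generate (map_group W) S" for f g
      using generate.eng[OF that] unfolding map_group_simps .
  qed
qed

subsection \<open>Symmetry groups of spherical sets with all reflections\<close>

text \<open>Closure under the reflections along \<open>p - q\<close> makes \<open>y p - p\<close> a
  root whenever \<open>y\<close> moves \<open>p\<close>, which is the greedy step of Carter's lemma.
  In types A and B the set \<open>Y\<close> is the orbit itself; in type \<open>I_2\<close> it is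
  the polygon that defines the group.\<close>

locale isometry_group =
  fixes W :: "('a::euclidean_space \<Rightarrow> 'a) set" and Y :: "'a set"
  assumes finite_Y: "finite Y" and span_Y: "span Y = UNIV"
    and W_eq: "W = {f. orthogonal_transformation f \<and> f ` Y = Y}"
    and norm_Y: "p \<in> Y \<Longrightarrow> q \<in> Y \<Longrightarrow> norm p = norm q"
    and reflect_diff_in_W: "p \<in> Y \<Longrightarrow> q \<in> Y \<Longrightarrow> p \<noteq> q \<Longrightarrow> reflect_along (p - q) \<in> W"
begin

lemma W_orthogonal: "w \<in> W \<Longrightarrow> orthogonal_transformation w"
  by (simp add: W_eq)

lemma W_linear: "w \<in> W \<Longrightarrow> linear w"
  by (simp add: W_orthogonal orthogonal_transformation_linear)

lemma W_Y: "w \<in> W \<Longrightarrow> p \<in> Y \<Longrightarrow> w p \<in> Y"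
  by (auto simp: W_eq)

lemma id_in_W: "id \<in> W"
  by (simp add: W_eq id_def)

lemma comp_in_W: "f \<in> W \<Longrightarrow> g \<in> W \<Longrightarrow> f \<circ> g \<in> W"
  unfolding W_eq by (auto intro: orthogonal_transformation_compose simp: image_comp [symmetric] simp del: o_apply)

lemma inv_in_W:
  assumes "w \<in> W"
  shows "inv_into UNIV w \<in> W" "inv_into UNIV w \<circ> w = id" "w \<circ> inv_into UNIV w = id"
proof -
  have o: "orthogonal_transformation w" and Y: "w ` Y = Y" using assms by (auto simp: W_eq)
  have b: "bij w" using o orthogonal_transformation_bij by blast
  have "inv_into UNIV w ` w ` Y = Y"
    using b by (meson bij_is_inj image_inv_f_f)
  then have "inv_into UNIV w ` Y = Y" unfolding Y .
  moreover have "orthogonal_transformation (inv_into UNIV w)"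
    using o by (rule orthogonal_transformation_inv)
  ultimately show "inv_into UNIV w \<in> W" by (simp add: W_eq)
  show "inv_into UNIV w \<circ> w = id" using b by (intro inv_o_cancel bij_is_inj)
  show "w \<circ> inv_into UNIV w = id" using b by (metis bij_is_surj surj_iff)
qed

lemma group_W: "Group.group (map_group W)"
proof (rule groupI, unfold map_group_simps)
  show "\<exists>y\<in>W. y \<circ> x = id" if "x \<in> W" for x
    using inv_in_W[OF that] by blast
qed (simp_all only: comp_in_W id_in_W comp_assoc id_comp)

lemma eq_if_eq_on_Y:
  assumes "linear f" "linear g" "\<And>p. p \<in> Y \<Longrightarrow> f p = g p"
  shows "f = g"
proof
  fix x
  show "f x = g x" using linear_eq_on_span[OF assms(1,2), of Y] assms(3) span_Y by auto
qed

lemma inj_on_W: "w \<in> W \<Longrightarrow> inj w"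
  using W_orthogonal orthogonal_transformation_inj by blast

lemma unit_root_diff:
  assumes "p \<in> Y" "q \<in> Y" "p \<noteq> q"
  shows "(p - q) /\<^sub>R norm (p - q) \<in> unit_roots W"
proof -
  have "reflect_along ((p - q) /\<^sub>R norm (p - q)) = reflect_along (p - q)"
    using assms by (intro reflect_along_scaleR) simp
  then show ?thesis using reflect_diff_in_W[OF assms] assms by (simp add: unit_roots_def)
qed

lemma reflections_eq: "reflections W = {reflect_along a | a. a \<noteq> 0 \<and> reflect_along a \<in> W}"
  by (auto simp: reflections_def)

text \<open>The spanning set \<open>Y\<close> contains a point moved by the reflection, and this
  point differs from its image by a multiple of \<open>a\<close>.\<close>

lemma root_parallel_diff:
  assumes "reflect_along a \<in> W" "a \<noteq> 0"
  obtains p q k where "p \<in> Y" "q \<in> Y" "p \<noteq> q" "k \<noteq> 0" "a = k *\<^sub>R (p - q)"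
proof -
  have "\<exists>p\<in>Y. reflect_along a p \<noteq> p"
    using eq_if_eq_on_Y[of "reflect_along a" id] reflect_along_neq_id[OF assms(2)]
    by (auto simp: linear_reflect_along linear_id)
  then obtain p where p: "p \<in> Y" "reflect_along a p \<noteq> p" by blast
  define k where "k = 2 * (p \<bullet> a) / (a \<bullet> a)"
  have *: "p - reflect_along a p = k *\<^sub>R a" by (simp add: reflect_along_def k_def)
  moreover have "k \<noteq> 0" using p * by auto
  ultimately have "a = inverse k *\<^sub>R (p - reflect_along a p)" by simp
  then show ?thesis using that[of p "reflect_along a p" "inverse k"] p W_Y[OF assms(1)] \<open>k \<noteq> 0\<close>
    by auto
qed

lemma word_in_W:
  assumes "set ts \<subseteq> reflections W"
  shows "word_prod ts \<in> W"
  using assms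
proof (induction ts)
  case Nil
  show ?case unfolding word_prod_Nil by (rule id_in_W)
next
  case (Cons t ts)
  then show ?case unfolding word_prod_Cons by (intro comp_in_W) (auto simp: reflections_def)
qed

lemma reflections_range: "reflections W \<subseteq> range reflect_along"
  by (auto simp: reflections_def)

text \<open>Unless \<open>y = id\<close>, some \<open>p\<close> in \<open>Y\<close> is moved, and
  the reflection along \<open>y p - p\<close> shrinks the moved space. With
  \<open>dim_moved_word_prod\<close> this identifies the reflection length with
  \<open>dim (moved y)\<close>.\<close>

lemma W_reflection_word:
  assumes "y \<in> W"
  shows "\<exists>ts. set ts \<subseteq> reflections W \<and> word_prod ts = y \<and> length ts \<le> dim (moved y)"
proof (rule reflection_word_exists[where K = W])
  fix y assume y: "y \<in> W" "y \<noteq> id"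
  then obtain p where p: "p \<in> Y" "y p \<noteq> p"
    using eq_if_eq_on_Y[of y id] W_linear by (auto simp: linear_id)
  have "reflect_along (y p - p) \<in> W"
    using reflect_diff_in_W p y W_Y by blast
  then show "\<exists>a\<in>moved y. a \<noteq> 0 \<and> reflect_along a \<in> reflections W \<and> reflect_along a \<circ> y \<in> W"
    using p y by (intro bexI[of _ "y p - p"]) (auto simp: reflections_eq intro!: comp_in_W)
qed (use assms W_orthogonal in auto)

lemma reduced_T_wordI:
  assumes "set ts \<subseteq> reflections W" "word_prod ts = w" "length ts \<le> dim (moved w)"
  shows "reduced_T_word W ts w"
  unfolding reduced_T_word_def
proof (intro conjI allI impI assms(1,2))
  fix us assume us: "set us \<subseteq> reflections W \<and> word_prod us = w"
  then have "dim (moved (word_prod us)) \<le> length us"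
    using reflections_range by (intro dim_moved_word_prod) blast
  then show "length ts \<le> length us" using us assms(3) by simp
qed

lemma reduced_T_word_length:
  assumes "reduced_T_word W ts w"
  shows "length ts = dim (moved w)"
proof -
  have ts: "set ts \<subseteq> reflections W" "word_prod ts = w" using assms by (auto simp: reduced_T_word_def)
  then have "w \<in> W" using word_in_W by blast
  then have "length ts \<le> dim (moved w)"
    using W_reflection_word[of w] assms order_trans unfolding reduced_T_word_def by blast
  moreover have "dim (moved w) \<le> length ts"
    using dim_moved_word_prod[of ts] ts reflections_range by blast
  ultimately show ?thesis by simp
qed

lemma reduced_T_word_prefix:
  assumes "reduced_T_word W (us @ vs) w"
  shows "reduced_T_word W us (word_prod us)"
  unfolding reduced_T_word_def
proof (intro conjI allI impI)
  show "set us \<subseteq> reflections W" using assms by (auto simp: reduced_T_word_def)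
  fix us' assume us': "set us' \<subseteq> reflections W \<and> word_prod us' = word_prod us"
  have "set (us' @ vs) \<subseteq> reflections W" "word_prod (us' @ vs) = w"
    using assms us' by (auto simp: reduced_T_word_def simp del: o_apply)
  then have "length (us @ vs) \<le> length (us' @ vs)"
    using assms unfolding reduced_T_word_def by blast
  then show "length us \<le> length us'" by simp
qed simp

lemma generate_reflections:
  assumes "set ts \<subseteq> reflections W"
  shows "generate (map_group W) (set ts) = words (set ts)"
  using assms by (intro generate_eq_words group_W) (auto simp: reflections_def)

text \<open>The word generating \<open>H\<close> and the prefix of the word of \<open>c\<close> may
  be different reduced words of the same \<open>x\<close>; having equal length, they can be
  exchanged.\<close>

lemma noncrossing_iff:
  "noncrossing W \<Delta> c H \<longleftrightarrow>
     parabolic W \<Delta> H \<and> (\<exists>ts ws. reduced_T_word W (ts @ ws) c \<and> H = words (set ts))"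
proof (intro iffI conjI; (elim conjE)?)
  assume nc: "noncrossing W \<Delta> c H"
  then show "parabolic W \<Delta> H" by (simp add: noncrossing_def)
  from nc obtain x ts us vs where x: "reduced_T_word W us x" "reduced_T_word W vs c" "prefix us vs"
    "reduced_T_word W ts x" and H: "H = generate (map_group W) (set ts)"
    unfolding noncrossing_def absolute_le_def by blast
  obtain ws where ws: "vs = us @ ws" using x(3) by (auto simp: prefix_def)
  have "length ts = length us" using x(1,4) reduced_T_word_length by metis
  then have "reduced_T_word W (ts @ ws) c"
    using x(1,2,4) unfolding ws reduced_T_word_def by auto
  moreover have "H = words (set ts)"
    using H generate_reflections x(4) by (simp add: reduced_T_word_def)
  ultimately show "\<exists>ts ws. reduced_T_word W (ts @ ws) c \<and> H = words (set ts)" by blast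
next
  assume par: "parabolic W \<Delta> H" and "\<exists>ts ws. reduced_T_word W (ts @ ws) c \<and> H = words (set ts)"
  then obtain ts ws where w: "reduced_T_word W (ts @ ws) c" and H: "H = words (set ts)" by blast
  let ?x = "word_prod ts"
  have x: "reduced_T_word W ts ?x" using w by (rule reduced_T_word_prefix)
  have "reduced_T_word W [] id" by (simp add: reduced_T_word_def)
  then have "absolute_le W id ?x" using x unfolding absolute_le_def by (metis Nil_prefix)
  moreover have "absolute_le W ?x c" using x w unfolding absolute_le_def by (meson prefixI)
  moreover have "H = generate (map_group W) (set ts)"
    using H generate_reflections x by (simp add: reduced_T_word_def)
  ultimately show "noncrossing W \<Delta> c H" using par x unfolding noncrossing_def by blast
qed

lemma finite_W: "finite W"
proof (rule inj_on_finite)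
  show "inj_on (\<lambda>w. restrict w Y) W"
  proof (rule inj_onI)
    fix f g assume "f \<in> W" "g \<in> W" and r: "restrict f Y = restrict g Y"
    moreover have "f p = g p" if "p \<in> Y" for p using r that by (metis restrict_apply')
    ultimately show "f = g" using eq_if_eq_on_Y W_linear by blast
  qed
  show "(\<lambda>w. restrict w Y) ` W \<subseteq> PiE Y (\<lambda>_. Y)" using W_Y by auto
  show "finite (PiE Y (\<lambda>_. Y))" using finite_Y by (simp add: finite_PiE)
qed

lemma parabolicE:
  assumes "simple_system W \<Delta>" "parabolic W \<Delta> H"
  obtains J w where "J \<subseteq> \<Delta>" "w \<in> W" "H = (\<lambda>u. w \<circ> u \<circ> inv_into UNIV w) ` words (reflect_along ` J)"
proof -
  obtain J w where J: "J \<subseteq> \<Delta>" "w \<in> W"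
    and H: "H = (\<lambda>u. w \<circ> u \<circ> inv_into UNIV w) ` generate (map_group W) (reflect_along ` J)"
    using assms(2) unfolding parabolic_def by blast
  have "generate (map_group W) (reflect_along ` J) = words (reflect_along ` J)"
    using J assms(1) by (intro generate_eq_words group_W) (auto simp: simple_system_def unit_roots_def)
  then show ?thesis using that J H by simp
qed

text \<open>Conjugating by \<open>w\<close> replaces each root \<open>a\<close> by
  \<open>w a\<close>, so a parabolic subgroup is again presented by reflections.\<close>

lemma conj_words:
  assumes "w \<in> W"
  shows "(\<lambda>u. w \<circ> u \<circ> inv_into UNIV w) ` words (reflect_along ` J) = words (reflect_along ` w ` J)"
    (is "?l = ?r")
proof -
  have 1: "w \<circ> reflect_along a \<circ> inv_into UNIV w = reflect_along (w a)" for a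
    using reflect_along_conj[OF W_orthogonal[OF assms]] inv_in_W(3)[OF assms]
    by (auto simp: fun_eq_iff)
  have 2: "w \<circ> (f \<circ> g) \<circ> inv_into UNIV w = (w \<circ> f \<circ> inv_into UNIV w) \<circ> (w \<circ> g \<circ> inv_into UNIV w)" for f g
    using inv_in_W(2)[OF assms] by (auto simp: fun_eq_iff)
  show ?thesis
  proof
    show "?l \<subseteq> ?r"
    proof (rule image_subsetI)
      fix f assume "f \<in> words (reflect_along ` J)"
      then show "w \<circ> f \<circ> inv_into UNIV w \<in> ?r"
      proof (induction rule: words_induct)
        case id
        show ?case unfolding comp_id inv_in_W(3)[OF assms] by (rule id_in_words)
      next
        case (step t f)
        have "w \<circ> t \<circ> inv_into UNIV w \<in> ?r" using step(1) 1 by (auto intro!: words_base)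
        then show ?case unfolding 2 using step(3) by (rule words_comp)
      qed
    qed
    show "?r \<subseteq> ?l"
    proof (rule words_least)
      show "reflect_along ` w ` J \<subseteq> ?l"
      proof (clarify)
        fix a assume "a \<in> J"
        then show "reflect_along (w a) \<in> ?l"
          unfolding 1[symmetric] by (intro imageI words_base) auto
      qed
      show "id \<in> ?l"
        using imageI[OF id_in_words, of "\<lambda>u. w \<circ> u \<circ> inv_into UNIV w"]
        unfolding comp_id inv_in_W(3)[OF assms] .
      fix f g assume "f \<in> ?l" "g \<in> ?l"
      then obtain f' g' where "f' \<in> words (reflect_along ` J)" "g' \<in> words (reflect_along ` J)"
        "f = w \<circ> f' \<circ> inv_into UNIV w" "g = w \<circ> g' \<circ> inv_into UNIV w" by blast
      then show "f \<circ> g \<in> ?l" using 2 words_comp by (metis (no_types, lifting) image_eqI)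
    qed
  qed
qed

end

subsection \<open>Convex hulls of points on a circle\<close>

lemma inner_cis: "cis x \<bullet> cis y = cos (y - x)"
  by (simp add: inner_complex_def cos_diff)

text \<open>The expression is twice the signed area of the triangle \<open>cis x\<close>,
  \<open>cis y\<close>, \<open>cis z\<close>, whose vertices are in counterclockwise order. The
  product \<open>4 * sin u * sin v * sin (u + v)\<close> in half angles shows the sign.\<close>

lemma triangle_area_pos:
  fixes x y z :: real
  assumes "x < y" "y < z" "z < x + 2 * pi"
  shows "0 < sin (y - x) + sin (z - y) - sin (z - x)"
proof -
  define u v where "u = (y - x) / 2" and "v = (z - y) / 2"
  have "sin (2 * u) + sin (2 * v) - sin (2 * u + 2 * v)
      = 2 * sin u * cos u * (1 - cos (2 * v)) + 2 * sin v * cos v * (1 - cos (2 * u))"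
    by (simp only: sin_add sin_double) (simp add: algebra_simps)
  also have "\<dots> = 4 * sin u * sin v * sin (u + v)"
  proof -
    have "1 - cos (2 * t) = 2 * (sin t * sin t)" for t :: real
      by (simp add: cos_double_sin power2_eq_square)
    then show ?thesis by (simp only: sin_add) (simp add: algebra_simps)
  qed
  finally have "sin (2 * u) + sin (2 * v) - sin (2 * u + 2 * v) = 4 * sin u * sin v * sin (u + v)" .
  moreover have "y - x = 2 * u" "z - y = 2 * v" "z - x = 2 * u + 2 * v"
    by (simp_all add: u_def v_def field_simps)
  ultimately have "sin (y - x) + sin (z - y) - sin (z - x) = 4 * sin u * sin v * sin (u + v)"
    by (simp only:)
  moreover have "0 < sin u" "0 < sin v" "0 < sin (u + v)"
    by (rule sin_gt_zero; use assms in \<open>simp add: u_def v_def field_simps\<close>)+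
  ultimately show ?thesis by simp
qed

lemma chords_cross:
  assumes "\<alpha> < \<beta>" "\<beta> < \<gamma>" "\<gamma> < \<delta>" "\<delta> < \<alpha> + 2 * pi"
  shows "closed_segment (cis \<alpha>) (cis \<gamma>) \<inter> closed_segment (cis \<beta>) (cis \<delta>) \<noteq> {}"
proof -
  define K where "K x y z = sin (y - x) + sin (z - y) - sin (z - x)" for x y z :: real
  \<comment> \<open>Twice the areas of the triangles left after dropping one of the four points.
    They are the coefficients of the affine dependence of the points, which exhibits one point on
    both chords.\<close>
  define a b c d where "a = K \<beta> \<gamma> \<delta>" and "b = K \<alpha> \<gamma> \<delta>" and "c = K \<alpha> \<beta> \<delta>" and "d = K \<alpha> \<beta> \<gamma>"
  have pos: "0 < a" "0 < b" "0 < c" "0 < d"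
    unfolding a_def b_def c_def d_def K_def by (intro triangle_area_pos; use assms in linarith)+
  have sum: "a + c = b + d"
    by (simp add: a_def b_def c_def d_def K_def)
  have dep: "a *\<^sub>R cis \<alpha> + c *\<^sub>R cis \<gamma> = b *\<^sub>R cis \<beta> + d *\<^sub>R cis \<delta>"
    by (simp add: complex_eq_iff a_def b_def c_def d_def K_def sin_diff algebra_simps)
  define z where "z = inverse (a + c) *\<^sub>R (a *\<^sub>R cis \<alpha> + c *\<^sub>R cis \<gamma>)"
  have "z = (1 - c / (a + c)) *\<^sub>R cis \<alpha> + (c / (a + c)) *\<^sub>R cis \<gamma>"
    using pos by (simp add: z_def scaleR_right_distrib divide_simps)
  then have "z \<in> closed_segment (cis \<alpha>) (cis \<gamma>)"
    unfolding in_segment using pos by (intro exI[of _ "c / (a + c)"]) (simp add: field_simps)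
  moreover have "z = (1 - d / (b + d)) *\<^sub>R cis \<beta> + (d / (b + d)) *\<^sub>R cis \<delta>"
    using pos by (simp add: z_def dep sum scaleR_right_distrib divide_simps)
  then have "z \<in> closed_segment (cis \<beta>) (cis \<delta>)"
    unfolding in_segment using pos by (intro exI[of _ "d / (b + d)"]) (simp add: field_simps)
  ultimately show ?thesis by blast
qed

text \<open>The line perpendicular to \<open>cis \<phi>\<close> at signed distance
  \<open>cos \<rho>\<close> cuts the circle at the ends of the arc that carries
  \<open>A\<close>.\<close>

lemma arcs_separated:
  assumes "0 \<le> \<rho>" "\<rho> \<le> pi"
    and A: "\<And>z. z \<in> A \<Longrightarrow> \<exists>t. z = cis t \<and> \<phi> - \<rho> \<le> t \<and> t \<le> \<phi> + \<rho>"
    and B: "\<And>z. z \<in> B \<Longrightarrow> \<exists>t. z = cis t \<and> \<phi> + \<rho> < t \<and> t < \<phi> - \<rho> + 2 * pi"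
  shows "convex hull A \<inter> convex hull B = {}"
proof -
  have "A \<subseteq> {z. cis \<phi> \<bullet> z \<ge> cos \<rho>}"
  proof
    fix z assume "z \<in> A"
    then obtain t where t: "z = cis t" "\<phi> - \<rho> \<le> t" "t \<le> \<phi> + \<rho>" using A by blast
    have "cos \<rho> \<le> cos \<bar>t - \<phi>\<bar>"
      using t assms by (intro cos_monotone_0_pi_le) auto
    then show "z \<in> {z. cis \<phi> \<bullet> z \<ge> cos \<rho>}" by (simp add: t inner_cis)
  qed
  then have 1: "convex hull A \<subseteq> {z. cis \<phi> \<bullet> z \<ge> cos \<rho>}"
    by (intro hull_minimal convex_halfspace_ge)
  have "B \<subseteq> {z. cis \<phi> \<bullet> z < cos \<rho>}"
  proof
    fix z assume "z \<in> B"
    then obtain t where t: "z = cis t" "\<phi> + \<rho> < t" "t < \<phi> - \<rho> + 2 * pi" using B by blast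
    have "cos (t - \<phi>) < cos \<rho>"
    proof (cases "t - \<phi> \<le> pi")
      case True
      then show ?thesis using t assms by (intro cos_monotone_0_pi) auto
    next
      case False
      have "cos (t - \<phi>) = cos (2 * pi - (t - \<phi>))" by simp
      also have "\<dots> < cos \<rho>" using False t assms by (intro cos_monotone_0_pi) auto
      finally show ?thesis .
    qed
    then show "z \<in> {z. cis \<phi> \<bullet> z < cos \<rho>}" by (simp add: t inner_cis)
  qed
  then have 2: "convex hull B \<subseteq> {z. cis \<phi> \<bullet> z < cos \<rho>}"
    by (intro hull_minimal convex_halfspace_lt)
  show ?thesis using 1 2 by fastforce
qed

subsection \<open>Prefixes of reduced words\<close>

lemma words_inverse:
  assumes "\<And>s. s \<in> S \<Longrightarrow> s \<circ> s = id" "f \<in> words S"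
  shows "\<exists>f'\<in>words S. f' \<circ> f = id \<and> f \<circ> f' = id"
  using assms(2)
proof (induction rule: words_induct)
  case id
  show ?case by (rule bexI[OF _ id_in_words]) auto
next
  case (step t f)
  then obtain f' where f': "f' \<in> words S" "f' \<circ> f = id" "f \<circ> f' = id" by blast
  have tt: "t \<circ> t = id" using assms(1) step(1) by blast
  have "f' \<circ> t \<circ> (t \<circ> f) = id"
    using f'(2) tt by (metis comp_assoc comp_id)
  moreover have "t \<circ> f \<circ> (f' \<circ> t) = id"
    using f'(3) tt by (metis comp_assoc comp_id)
  moreover have "f' \<circ> t \<in> words S" using words_comp[OF f'(1) words_base[OF step(1)]] .
  ultimately show ?case by blast
qed

context isometry_group
begin

text \<open>The moved space of \<open>c\<close> lies in the sum of the moved space of the prefix and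
  the span of the remaining roots, and its dimension is the full number of letters. No dimension may
  be lost, so the prefix moves along all of its roots and the sum is direct.\<close>

lemma reduced_word_roots:
  assumes "reduced_T_word W (ts @ ws) c"
  obtains as bs where "ts = map reflect_along as" "ws = map reflect_along bs"
    "span (set as) \<inter> span (set bs) = {0}" "moved (word_prod ts) = span (set as)"
proof -
  have sub: "set (ts @ ws) \<subseteq> reflections W" and c: "c = word_prod ts \<circ> word_prod ws"
    using assms by (auto simp: reduced_T_word_def simp del: o_apply)
  have "\<exists>as. ts = map reflect_along as" "\<exists>bs. ws = map reflect_along bs"
    using sub by (auto simp: ex_map_conv reflections_def)
  then obtain as bs where as: "ts = map reflect_along as" and bs: "ws = map reflect_along bs"
    by blast
  let ?U = "span (set as)" and ?V = "span (set bs)" and ?x = "word_prod ts" and ?y = "word_prod ws"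
  have ox: "?x \<in> W" using sub by (intro word_in_W) auto
  have mx: "moved ?x \<subseteq> ?U"
    unfolding moved_def using word_prod_moves[of ?U ts] by (auto simp: as intro: span_base)
  have my: "?y v - v \<in> ?V" for v
    using word_prod_moves[of ?V ws] by (auto simp: bs intro: span_base)
  have dU: "dim ?U \<le> length ts" and dV: "dim ?V \<le> length ws"
    using dim_le_card[of ?U "set as"] dim_le_card[of ?V "set bs"] card_length[of as] card_length[of bs]
    by (auto simp: as bs)
  have "dim (moved c) = length ts + length ws" using reduced_T_word_length[OF assms] by simp
  moreover have mc: "moved c \<subseteq> {u + v |u v. u \<in> moved ?x \<and> v \<in> ?V}"
  proof
    fix z assume "z \<in> moved c"
    then obtain v where "z = (?x (?y v) - ?y v) + (?y v - v)" by (auto simp: moved_def c)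
    then show "z \<in> {u + v |u v. u \<in> moved ?x \<and> v \<in> ?V}"
      using my[of v] moved_in[of ?x "?y v"] by blast
  qed
  then have "dim (moved c) \<le> dim {u + v |u v. u \<in> moved ?x \<and> v \<in> ?V}" by (rule dim_subset)
  moreover have sx: "subspace (moved ?x)" using ox W_linear subspace_moved by blast
  have "dim {u + v |u v. u \<in> moved ?x \<and> v \<in> ?V} + dim (moved ?x \<inter> ?V) = dim (moved ?x) + dim ?V"
    by (intro dim_sums_Int sx subspace_span)
  moreover have "dim (moved ?x) \<le> dim ?U" using mx by (rule dim_subset)
  ultimately have eq: "dim (moved ?x) = dim ?U" "dim (moved ?x \<inter> ?V) = 0" using dU dV by linarith+
  have mU: "moved ?x = ?U"
    using eq(1) mx sx by (intro subspace_dim_equal subspace_span) auto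
  have "?U \<inter> ?V = {0}"
    using eq(2) unfolding mU by (metis Int_iff dim_eq_0 span_0 subset_singleton_iff empty_iff)
  then show ?thesis using that as bs mU by blast
qed

lemma words_displacement:
  assumes "f \<in> words (reflect_along ` set as)"
  shows "f v - v \<in> span (set as)"
proof -
  obtain us where us: "f = word_prod us" "set us \<subseteq> reflect_along ` set as"
    using assms by (auto simp: words_def)
  show ?thesis unfolding us(1)
    by (rule word_prod_moves) (use us(2) in \<open>auto intro: span_base\<close>)
qed

text \<open>With \<open>c = x \<circ> y\<close>, the vector \<open>y w - w\<close> is a difference
  of displacements along prefix roots, and it is also a displacement along the remaining roots. The
  two spans meet only in 0, so \<open>y\<close> fixes \<open>w\<close>.\<close>

lemma reduced_prefix_displacement:
  assumes "reduced_T_word W (ts @ ws) c" "f \<in> words (set ts)" "c w - w = f v - v"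
  shows "word_prod ts w - w = f v - v"
proof -
  obtain as bs where as: "ts = map reflect_along as" "ws = map reflect_along bs"
    "span (set as) \<inter> span (set bs) = {0}" "moved (word_prod ts) = span (set as)"
    using reduced_word_roots[OF assms(1)] .
  let ?x = "word_prod ts" and ?y = "word_prod ws"
  have c: "c = ?x \<circ> ?y"
    using assms(1) by (auto simp: reduced_T_word_def simp del: o_apply)
  have u: "f v - v \<in> span (set as)" using assms(2) by (intro words_displacement) (simp add: as)
  have "?x (?y w) - ?y w \<in> span (set as)" unfolding as(4)[symmetric] by simp
  moreover have "?y w - w = (f v - v) - (?x (?y w) - ?y w)"
    using assms(3) unfolding c by (simp add: algebra_simps)
  ultimately have "?y w - w \<in> span (set as)" using u span_diff by metis
  moreover have "?y w - w \<in> span (set bs)"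
    by (rule word_prod_moves) (auto simp: as intro: span_base)
  ultimately have "?y w - w \<in> span (set as) \<inter> span (set bs)" by blast
  then have "?y w = w" unfolding as(3) by simp
  then show ?thesis using assms(3) by (simp add: c)
qed

text \<open>The moved space of the product contains the root of every letter, so a vector fixed by
  the product is orthogonal to these roots and is fixed letter by letter.\<close>

lemma reduced_prefix_fixed:
  assumes "reduced_T_word W (ts @ ws) c" "f \<in> words (set ts)" "word_prod ts z = z"
  shows "f z = z"
proof -
  obtain as bs where as: "ts = map reflect_along as" "ws = map reflect_along bs"
    "span (set as) \<inter> span (set bs) = {0}" "moved (word_prod ts) = span (set as)"
    using reduced_word_roots[OF assms(1)] .
  have "word_prod ts \<in> W" using assms(1) by (intro word_in_W) (auto simp: reduced_T_word_def)
  then have "orthogonal_transformation (word_prod ts)" by (rule W_orthogonal)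
  then have "z \<bullet> a = 0" if "a \<in> set as" for a
    using inner_moved_fixed[where f = "word_prod ts" and z = z] assms(3) that by (simp add: as(4) span_base)
  then have t: "t z = z" if "t \<in> set ts" for t
    using that reflect_along_orthogonal by (auto simp: as)
  obtain us where "f = word_prod us" "set us \<subseteq> set ts" using assms(2) by (auto simp: words_def)
  then show ?thesis using word_prod_fixes[of us z] t by blast
qed

end

subsection \<open>Orthonormal frames, possibly signed\<close>

text \<open>\<open>neg_X\<close> separates the types: no antipodes in type A, antipodes everywhere
  in type B.\<close>

locale signed_frame =
  fixes W :: "('a::euclidean_space \<Rightarrow> 'a) set" and X :: "'a set"
  assumes finite_X: "finite X" and span_X: "span X = UNIV"
    and inner_X: "p \<in> X \<Longrightarrow> q \<in> X \<Longrightarrow> p \<bullet> q = (if p = q then 1 else if p = - q then - 1 else 0)"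
    and neg_X: "(\<forall>p\<in>X. - p \<in> X) \<or> (\<forall>p\<in>X. - p \<notin> X)"
    and W_linear_eq: "W = {f. linear f \<and> f ` X = X}"
begin

lemma norm_X: "p \<in> X \<Longrightarrow> norm p = 1"
  using inner_X[of p p] by (simp add: norm_eq_1)

lemma neg_neq_X [simp]: "p \<in> X \<Longrightarrow> - p \<noteq> p"
  using inner_X[of p p] inner_minus_left[of p p] by force

lemma neg_mem_X: "p \<in> X \<Longrightarrow> - p \<in> X \<Longrightarrow> q \<in> X \<Longrightarrow> - q \<in> X"
  using neg_X by blast

text \<open>Inner products on \<open>X\<close> depend only on whether two points are equal or
  antipodal, and an injective linear map preserves both relations. Linearity in each argument
  extends this to the span.\<close>

lemma orthogonal_if_permutes_X:
  assumes "linear f" "f ` X = X"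
  shows "orthogonal_transformation f"
proof -
  have "range f = UNIV" using linear_span_image[OF assms(1), of X] assms(2) span_X by simp
  then have inj: "inj f" using assms(1) linear_surjective_imp_injective by blast
  have fX: "f p \<in> X" if "p \<in> X" for p using that assms(2) by blast
  have 0: "f p \<bullet> f q = p \<bullet> q" if "p \<in> X" "q \<in> X" for p q
  proof -
    have "f p = f q \<longleftrightarrow> p = q" using inj by (rule inj_eq)
    moreover have "f p = - f q \<longleftrightarrow> p = - q"
      using inj_eq[OF inj, of p "- q"] linear_neg[OF assms(1), of q] by simp
    ultimately show ?thesis using inner_X[OF that] inner_X[OF fX fX, OF that] by simp
  qed
  have 1: "f v \<bullet> f q = v \<bullet> q" if "q \<in> X" for v q
    by (rule linear_eq_on_span[of "\<lambda>v. f v \<bullet> f q" "\<lambda>v. v \<bullet> q" X])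
      (auto simp: 0 that span_X linear_iff inner_add_left linear_add[OF assms(1)] linear_scale[OF assms(1)])
  have "f v \<bullet> f u = v \<bullet> u" for v u
    by (rule linear_eq_on_span[of "\<lambda>u. f v \<bullet> f u" "\<lambda>u. v \<bullet> u" X])
      (auto simp: 1 span_X linear_iff inner_add_right linear_add[OF assms(1)] linear_scale[OF assms(1)])
  then show ?thesis using assms(1) by (simp add: orthogonal_transformation_def)
qed

text \<open>A transposition of \<open>p\<close> and \<open>q\<close> together with the mirrored one
  of \<open>- p\<close> and \<open>- q\<close>; for \<open>q = - p\<close> it is a single sign
  change.\<close>

lemma reflect_diff_X:
  assumes "p \<in> X" "q \<in> X" "p \<noteq> q" "r \<in> X"
  shows "reflect_along (p - q) r =
    (if r = p then q else if r = q then p else if r = - p then - q else if r = - q then - p else r)"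
proof -
  have n: "norm p = norm q" using assms norm_X by simp
  have *: "reflect_along (p - q) (- v) = - reflect_along (p - q) v" for v
    using linear_neg[OF linear_reflect_along] .
  have "r \<bullet> (p - q) = 0" if "r \<noteq> p" "r \<noteq> q" "r \<noteq> - p" "r \<noteq> - q"
    using inner_X[of r p] inner_X[of r q] assms that by (simp add: inner_diff)
  then show ?thesis
    using reflect_along_swap[OF n] reflect_along_swap'[OF n] reflect_along_orthogonal by (auto simp: *)
qed

lemma reflect_diff_permutes_X:
  assumes "p \<in> X" "q \<in> X" "p \<noteq> q"
  shows "reflect_along (p - q) ` X = X"
proof -
  have "reflect_along (p - q) r \<in> X" if "r \<in> X" for r
    using reflect_diff_X[OF assms that] assms that neg_mem_X by auto
  then have "reflect_along (p - q) ` X \<subseteq> X" by blast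
  moreover have "X \<subseteq> reflect_along (p - q) ` X"
  proof
    fix r assume "r \<in> X"
    then have "reflect_along (p - q) (reflect_along (p - q) r) \<in> reflect_along (p - q) ` X"
      using calculation by blast
    then show "r \<in> reflect_along (p - q) ` X" by simp
  qed
  ultimately show ?thesis by blast
qed

sublocale isometry_group W X
proof
  show "W = {f. orthogonal_transformation f \<and> f ` X = X}"
    using orthogonal_if_permutes_X orthogonal_transformation_linear by (auto simp: W_linear_eq)
  show "reflect_along (p - q) \<in> W" if "p \<in> X" "q \<in> X" "p \<noteq> q" for p q
    using reflect_diff_permutes_X[OF that] by (simp add: W_linear_eq linear_reflect_along)
qed (auto simp: finite_X span_X norm_X)

text \<open>An antipodal pair inside \<open>S\<close> contributes nothing, so the sum indicates
  \<open>S\<close> only if \<open>S\<close> contains no such pair.\<close>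

lemma inner_sum_X:
  assumes "S \<subseteq> X" "r \<in> X"
  shows "(\<Sum>p\<in>S. p) \<bullet> r = of_bool (r \<in> S) - of_bool (- r \<in> S)"
proof -
  have fin: "finite S" using assms finite_X finite_subset by blast
  have "(\<Sum>p\<in>S. p) \<bullet> r = (\<Sum>p\<in>S. p \<bullet> r)" by (simp add: inner_sum_left)
  also have "\<dots> = (\<Sum>p\<in>S. of_bool (p = r) - of_bool (p = - r))"
    using assms inner_X by (intro sum.cong) (auto simp: subset_iff)
  also have "\<dots> = of_bool (r \<in> S) - of_bool (- r \<in> S)"
    using fin by (simp add: sum_subtractf of_bool_def)
  finally show ?thesis .
qed

lemma odd_map_extends:
  assumes f: "\<And>p. p \<in> X \<Longrightarrow> f p \<in> X" "inj_on f X"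
    and odd: "\<And>p. p \<in> X \<Longrightarrow> - p \<in> X \<Longrightarrow> f (- p) = - f p"
  obtains x where "x \<in> W" "\<And>p. p \<in> X \<Longrightarrow> x p = f p"
proof -
  \<comment> \<open>With antipodes present every axis is counted twice, by \<open>p\<close> and by
    \<open>- p\<close>, and oddness of \<open>f\<close> makes the two terms equal.\<close>
  define N :: real where "N = (if \<forall>p\<in>X. - p \<in> X then 2 else 1)"
  define x where "x v = inverse N *\<^sub>R (\<Sum>p\<in>X. (v \<bullet> p) *\<^sub>R f p)" for v
  have lin: "linear x"
    by (rule linearI) (simp_all add: x_def inner_add_left scaleR_add_left sum.distrib
        scaleR_add_right scaleR_sum_right algebra_simps)
  have xf: "x r = f r" if r: "r \<in> X" for r
  proof -
    have "(\<Sum>p\<in>X. (r \<bullet> p) *\<^sub>R f p)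
        = (\<Sum>p\<in>X. (if p = r then f p else 0) - (if p = - r then f p else 0))"
    proof (rule sum.cong)
      fix p assume "p \<in> X"
      then have "r \<bullet> p = (if p = r then 1 else if p = - r then - 1 else 0)"
        using inner_X[of p r] r by (simp add: inner_commute)
      moreover have "r \<noteq> - r" using neg_neq_X[OF r] by metis
      ultimately show "(r \<bullet> p) *\<^sub>R f p = (if p = r then f p else 0) - (if p = - r then f p else 0)"
        by auto
    qed simp
    also have "\<dots> = f r - (if - r \<in> X then f (- r) else 0)"
      using finite_X r by (simp add: sum_subtractf)
    also have "\<dots> = N *\<^sub>R f r"
      using neg_mem_X[OF r] odd[OF r] r by (auto simp: N_def scaleR_2)
    finally show ?thesis by (simp add: x_def N_def split: if_splits)
  qed
  have "x ` X = f ` X" using xf by auto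
  also have "f ` X = X" using f finite_X by (meson endo_inj_surj image_subsetI)
  finally have "x \<in> W" using lin by (simp add: W_linear_eq)
  then show ?thesis using that xf by blast
qed

end

subsection \<open>The cyclic order of the orbit\<close>

lemma cis_fraction_inj:
  assumes "k < h" "l < h" "cis (2 * pi * real k / real h) = cis (2 * pi * real l / real h)"
  shows "k = l"
proof -
  have "bij_betw (\<lambda>k. cis (2 * pi * real k / real h)) {..<h} {z. z ^ h = 1}"
    using assms(1) by (intro Complex.bij_betw_roots_unity) simp
  then show ?thesis using assms by (auto simp: bij_betw_def dest: inj_onD)
qed

text \<open>\<open>\<Psi>\<close> stands for the projection to the Coxeter plane in suitable
  coordinates. Only its values on the unit circle and the rotation by \<open>c\<close> enter the
  comparison of crossings with hulls.\<close>

locale coxeter_orbit = signed_frame W X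
    for W :: "('a::euclidean_space \<Rightarrow> 'a) set" and X :: "'a set" +
  fixes c :: "'a \<Rightarrow> 'a" and \<Psi> :: "'a \<Rightarrow> complex" and h :: nat
  assumes c_in_W: "c \<in> W" and h_card: "h = card X" and X_nonempty: "X \<noteq> {}"
    and norm_\<Psi>: "p \<in> X \<Longrightarrow> norm (\<Psi> p) = 1"
    and \<Psi>_c: "p \<in> X \<Longrightarrow> \<Psi> (c p) = cis (2 * pi / h) * \<Psi> p"
begin

lemma h_pos: "0 < h"
  using h_card X_nonempty finite_X by (simp add: card_gt_0_iff)

lemma c_pow_in_W: "(c ^^ k) \<in> W"
  by (induction k) (use c_in_W id_in_W in \<open>auto intro!: comp_in_W simp del: o_apply simp: funpow_0[abs_def] id_def\<close>)

text \<open>Indices are not reduced modulo \<open>h\<close>, so an arc may start anywhere and wrap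
  around.\<close>

definition g :: "nat \<Rightarrow> 'a" where
  "g k = (c ^^ k) (SOME p. p \<in> X)"

lemma g_in_X [simp]: "g k \<in> X"
  using W_Y[OF c_pow_in_W] X_nonempty unfolding g_def by (simp add: some_in_eq)

lemma c_g [simp]: "c (g k) = g (Suc k)"
  by (simp add: g_def)

lemma c_pow_g: "(c ^^ k) (g l) = g (k + l)"
  by (simp add: g_def funpow_add)

definition \<phi> :: real where "\<phi> = Arg (\<Psi> (g 0))"

lemma \<Psi>_g: "\<Psi> (g k) = cis (\<phi> + 2 * pi * real k / real h)"
proof (induction k)
  case 0
  have "\<Psi> (g 0) \<noteq> 0" using norm_\<Psi>[of "g 0"] by auto
  then have "cis (Arg (\<Psi> (g 0))) = sgn (\<Psi> (g 0))" by (rule cis_Arg)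
  also have "\<dots> = \<Psi> (g 0)" using norm_\<Psi>[of "g 0"] by (simp add: sgn_eq)
  finally show ?case by (simp add: \<phi>_def)
next
  case (Suc k)
  have "\<Psi> (g (Suc k)) = cis (2 * pi / h) * \<Psi> (g k)" using \<Psi>_c[of "g k"] by simp
  also have "\<dots> = cis (\<phi> + 2 * pi * real (Suc k) / real h)"
    unfolding Suc.IH cis_mult by (intro arg_cong[where f = cis]) (simp add: add_divide_distrib algebra_simps)
  finally show ?case .
qed

lemma \<Psi>_g_inj:
  assumes "\<Psi> (g k) = \<Psi> (g l)" "k < h" "l < h"
  shows "k = l"
proof (rule cis_fraction_inj)
  have "cis \<phi> * cis (2 * pi * real k / real h) = cis \<phi> * cis (2 * pi * real l / real h)"
    using assms(1) by (simp add: \<Psi>_g cis_mult)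
  then show "cis (2 * pi * real k / real h) = cis (2 * pi * real l / real h)"
    by (metis cis_neq_zero mult_left_cancel)
qed (use assms in auto)

text \<open>The rotation separates the first \<open>h\<close> images under \<open>c\<close>, and
  \<open>X\<close> has no further points because its cardinality is \<open>h\<close>.\<close>

lemma X_eq: "X = g ` {..<h}"
proof -
  have "inj_on g {..<h}" using \<Psi>_g_inj by (auto intro!: inj_onI)
  then have "card (g ` {..<h}) = card X" using h_card by (simp add: card_image)
  then show ?thesis using finite_X by (intro card_subset_eq[symmetric]) auto
qed

text \<open>Every window of \<open>h\<close> consecutive indices will do, which lets the circle be
  cut open at any point.\<close>

lemma X_elim:
  assumes "p \<in> X"
  obtains k where "a \<le> k" "k < a + h" "p = g k"
proof -
  have "g h = g 0"
  proof -
    obtain j where j: "j < h" "g h = g j" using X_eq g_in_X by (metis imageE lessThan_iff)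
    have "cis (\<phi> + 2 * pi * real h / real h) = cis \<phi>" using h_pos by (simp flip: cis_mult)
    then have "\<Psi> (g j) = \<Psi> (g 0)" using \<Psi>_g[of h] \<Psi>_g[of 0] j by simp
    then have "j = 0" using \<Psi>_g_inj[of j 0] j h_pos by simp
    then show ?thesis using j by simp
  qed
  then have per: "g (k + h) = g k" for k using c_pow_g[of k h] c_pow_g[of k 0] by simp
  have "\<exists>k. a \<le> k \<and> k < a + h \<and> p = g k"
  proof (induction a)
    case 0
    then show ?case using assms X_eq by auto
  next
    case (Suc a)
    then obtain k where k: "a \<le> k" "k < a + h" "p = g k" by blast
    show ?case
    proof (cases "k = a")
      case True
      then show ?thesis using k per[of a] h_pos by (intro exI[of _ "a + h"]) auto
    next
      case False
      then show ?thesis using k by (intro exI[of _ k]) auto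
    qed
  qed
  then show ?thesis using that by blast
qed

lemma g_periodic: "g (k + h) = g k"
proof -
  obtain l where l: "Suc k \<le> l" "l < Suc k + h" "g k = g l" using X_elim[OF g_in_X] .
  have "\<Psi> (g k) = \<Psi> (g l)" using l by simp
  have "cis (2 * pi * real (l - k) / real h) = 1"
  proof -
    have "cis (\<phi> + 2 * pi * real k / real h) * cis (2 * pi * real (l - k) / real h)
        = cis (\<phi> + 2 * pi * real l / real h)"
      unfolding cis_mult using l h_pos by (intro arg_cong[where f = cis]) (simp add: field_simps of_nat_diff)
    then have "\<Psi> (g k) * cis (2 * pi * real (l - k) / real h) = \<Psi> (g k)"
      using \<open>\<Psi> (g k) = \<Psi> (g l)\<close> by (simp only: \<Psi>_g)
    then show ?thesis using norm_\<Psi>[of "g k"] by auto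
  qed
  have "l = k + h"
  proof (rule ccontr)
    assume "l \<noteq> k + h"
    then have "l - k < h" using l by linarith
    then have "l - k = 0" using cis_fraction_inj[of "l - k" h 0] h_pos
      \<open>cis (2 * pi * real (l - k) / real h) = 1\<close> by simp
    then show False using l by simp
  qed
  then show ?thesis using l by simp
qed

lemma g_eq_imp:
  assumes "g k = g l" "k \<le> l" "l < k + h"
  shows "k = l"
proof (rule ccontr)
  assume "k \<noteq> l"
  have "g ` {k..<k + h} = X"
  proof
    show "X \<subseteq> g ` {k..<k + h}" using X_elim[of _ k] by (metis atLeastLessThan_iff imageI subsetI)
  qed auto
  then have "card (g ` {k..<k + h}) = card {k..<k + h}" using h_card by simp
  then have "inj_on g {k..<k + h}" by (simp add: eq_card_imp_inj_on)
  then show False using assms \<open>k \<noteq> l\<close> by (auto dest: inj_onD)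
qed

lemma inj_on_g: "b \<le> a + h \<Longrightarrow> inj_on g {a..<b}"
  by (rule linorder_inj_onI) (auto dest: g_eq_imp)

text \<open>\<open>c\<close> commutes with negation, so the index distance \<open>m\<close> to the
  antipode is the same for all points. Going twice returns to the start, and
  \<open>0 < m < h\<close> leaves only \<open>2 * m = h\<close>.\<close>

lemma antipode_shift:
  assumes "- g i \<in> X"
  obtains m where "h = 2 * m" "\<And>k. - g k = g (k + m)"
proof -
  have "- g 0 \<in> X" using assms neg_mem_X g_in_X by blast
  then obtain m where m: "m < 0 + h" "- g 0 = g m" using X_elim[of "- g 0" 0] by blast
  have s: "- g k = g (k + m)" for k
  proof -
    have "- g k = (c ^^ k) (- g 0)"
      using c_pow_g[of k 0] linear_neg[OF W_linear[OF c_pow_in_W]] by simp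
    then show ?thesis by (simp add: m c_pow_g)
  qed
  have "g (m + m) = g 0" using s[of m] m(2) by (metis minus_minus)
  then have "g 0 = g (m + m)" by simp
  have "m \<noteq> 0" using m neg_neq_X[of "g 0"] by (metis g_in_X)
  have "\<not> m + m < h" using g_eq_imp[of 0 "m + m"] \<open>g 0 = g (m + m)\<close> \<open>m \<noteq> 0\<close> by auto
  moreover have "\<not> h < m + m"
  proof
    assume "h < m + m"
    moreover have "g h = g (m + m)" using g_periodic[of 0] \<open>g 0 = g (m + m)\<close> by simp
    ultimately show False using g_eq_imp[of h "m + m"] m by auto
  qed
  ultimately have "h = 2 * m" by simp
  then show ?thesis using that s by blast
qed

section \<open>Crossing blocks and meeting hulls\<close>

definition crossing :: "'a set \<Rightarrow> 'a set \<Rightarrow> bool" where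
  "crossing A B \<longleftrightarrow> (\<exists>a b a' b'. a < b \<and> b < a' \<and> a' < b' \<and> b' < a + h \<and>
     g a \<in> A \<and> g a' \<in> A \<and> g b \<in> B \<and> g b' \<in> B)"

lemma hulls_meet_if_crossing:
  assumes "crossing A B"
  shows "convex hull (\<Psi> ` A) \<inter> convex hull (\<Psi> ` B) \<noteq> {}"
proof -
  obtain a b a' b' where o: "a < b" "b < a'" "a' < b'" "b' < a + h"
    and A: "g a \<in> A" "g a' \<in> A" and B: "g b \<in> B" "g b' \<in> B"
    using assms unfolding crossing_def by blast
  let ?t = "\<lambda>k. \<phi> + 2 * pi * real k / real h"
  have mono: "?t i < ?t j" if "i < j" for i j
    using that h_pos by (simp add: divide_strict_right_mono)
  have "?t b' < ?t (a + h)" using o by (intro mono)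
  also have "?t (a + h) = ?t a + 2 * pi" using h_pos by (simp add: field_simps)
  finally have "closed_segment (cis (?t a)) (cis (?t a')) \<inter> closed_segment (cis (?t b)) (cis (?t b')) \<noteq> {}"
    using o by (intro chords_cross mono)
  moreover have "closed_segment (cis (?t a)) (cis (?t a')) \<subseteq> convex hull (\<Psi> ` A)"
    unfolding segment_convex_hull \<Psi>_g[symmetric] using A by (intro hull_mono) auto
  moreover have "closed_segment (cis (?t b)) (cis (?t b')) \<subseteq> convex hull (\<Psi> ` B)"
    unfolding segment_convex_hull \<Psi>_g[symmetric] using B by (intro hull_mono) auto
  ultimately show ?thesis by blast
qed

text \<open>Cut the circle at a point of \<open>B\<close>. A point of \<open>B\<close> between the
  first and the last index of \<open>A\<close> would alternate with the cutting point, so without a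
  crossing \<open>B\<close> stays outside this interval and a line separates the two arcs.\<close>

lemma crossing_if_hulls_meet:
  assumes sub: "A \<subseteq> X" "B \<subseteq> X" and disj: "A \<inter> B = {}"
    and meet: "convex hull (\<Psi> ` A) \<inter> convex hull (\<Psi> ` B) \<noteq> {}"
  shows "crossing A B"
proof (rule ccontr)
  assume nc: "\<not> crossing A B"
  have "A \<noteq> {}" "B \<noteq> {}" using meet by auto
  then obtain q where "q \<in> B" by blast
  then obtain \<beta> where \<beta>: "g \<beta> \<in> B" using sub X_elim[of q 0] by blast
  define I where "I = {j. \<beta> < j \<and> j < \<beta> + h \<and> g j \<in> A}"
  have AI: "\<exists>j\<in>I. p = g j" if pA: "p \<in> A" for p
  proof -
    obtain j where j: "\<beta> \<le> j" "j < \<beta> + h" "p = g j"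
      using X_elim[of p \<beta>] subsetD[OF sub(1) pA] by metis
    moreover have "j \<noteq> \<beta>" using j pA \<beta> disj by auto
    ultimately show ?thesis using pA by (intro bexI[of _ j]) (auto simp: I_def)
  qed
  have finI: "finite I" unfolding I_def by (rule finite_subset[of _ "{..\<beta> + h}"]) auto
  have neI: "I \<noteq> {}" using AI \<open>A \<noteq> {}\<close> by blast
  define lo hi where "lo = Min I" and "hi = Max I"
  have lo: "lo \<in> I" and hi: "hi \<in> I" using finI neI by (auto simp: lo_def hi_def)
  have Ib: "lo \<le> j" "j \<le> hi" if "j \<in> I" for j using that finI by (auto simp: lo_def hi_def)
  have BI: "\<exists>j. hi < j \<and> j < lo + h \<and> p = g j" if pB: "p \<in> B" for p
  proof -
    obtain j where j: "\<beta> \<le> j" "j < \<beta> + h" "p = g j"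
      using X_elim[of p \<beta>] subsetD[OF sub(2) pB] by metis
    have ne: "j \<noteq> lo" "j \<noteq> hi" using j pB lo hi disj by (auto simp: I_def)
    have "\<not> (lo < j \<and> j < hi)"
    proof
      assume *: "lo < j \<and> j < hi"
      have "g (\<beta> + h) \<in> B" using \<beta> g_periodic by simp
      then have "crossing A B" unfolding crossing_def using * lo hi j pB
        by (intro exI[of _ lo] exI[of _ j] exI[of _ hi] exI[of _ "\<beta> + h"]) (auto simp: I_def)
      then show False using nc by blast
    qed
    then consider "j < lo" | "hi < j" using ne by linarith
    then show ?thesis
    proof cases
      case 1
      then show ?thesis using j hi g_periodic[of j] by (intro exI[of _ "j + h"]) (auto simp: I_def)
    next
      case 2
      then show ?thesis using j lo by (intro exI[of _ j]) (auto simp: I_def)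
    qed
  qed
  \<comment> \<open>Half the width and the midpoint of the arc from \<open>lo\<close> to
    \<open>hi\<close>.\<close>
  define \<rho> \<theta> where "\<rho> = pi * (real hi - real lo) / real h" and "\<theta> = \<phi> + pi * (real hi + real lo) / real h"
  have lohi: "lo \<le> hi" "hi < lo + h" using Ib[OF lo] lo hi by (auto simp: I_def)
  have ends: "\<theta> - \<rho> = \<phi> + 2 * pi * real lo / real h" "\<theta> + \<rho> = \<phi> + 2 * pi * real hi / real h"
    using h_pos by (simp_all add: \<theta>_def \<rho>_def field_simps)
  have "convex hull (\<Psi> ` A) \<inter> convex hull (\<Psi> ` B) = {}"
  proof (rule arcs_separated[where \<rho> = \<rho> and \<phi> = \<theta>])
    show "0 \<le> \<rho>" using lohi by (simp add: \<rho>_def)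
    have "real hi - real lo \<le> real h" using lohi by linarith
    then show "\<rho> \<le> pi" 
      using mult_left_mono[of "real hi - real lo" "real h" pi] h_pos by (simp add: \<rho>_def divide_le_eq)
  next
    fix z assume "z \<in> \<Psi> ` A"
    then obtain j where "j \<in> I" "z = \<Psi> (g j)" using AI by blast
    then show "\<exists>t. z = cis t \<and> \<theta> - \<rho> \<le> t \<and> t \<le> \<theta> + \<rho>"
      unfolding ends using Ib[of j] h_pos
      by (intro exI[of _ "\<phi> + 2 * pi * real j / real h"]) (simp add: \<Psi>_g divide_right_mono)
  next
    fix z assume "z \<in> \<Psi> ` B"
    then obtain j where j: "hi < j" "j < lo + h" "z = \<Psi> (g j)" using BI by blast
    have "2 * pi * real j / real h < 2 * pi * real (lo + h) / real h"
      using j h_pos by (intro divide_strict_right_mono mult_strict_left_mono) auto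
    also have "\<dots> = 2 * pi * real lo / real h + 2 * pi" using h_pos by (simp add: field_simps)
    finally have "2 * pi * real j / real h < 2 * pi * real lo / real h + 2 * pi" .
    moreover have "2 * pi * real hi / real h < 2 * pi * real j / real h"
      using j h_pos by (intro divide_strict_right_mono mult_strict_left_mono) auto
    ultimately show "\<exists>t. z = cis t \<and> \<theta> + \<rho> < t \<and> t < \<theta> - \<rho> + 2 * pi"
      unfolding ends using j
      by (intro exI[of _ "\<phi> + 2 * pi * real j / real h"]) (simp add: \<Psi>_g)
  qed
  then show False using meet by blast
qed

section \<open>Arcs and their sums\<close>

definition arc :: "nat \<Rightarrow> nat \<Rightarrow> 'a" where
  "arc a b = (\<Sum>j=a..<b. g j)"

lemma c_arc: "a \<le> b \<Longrightarrow> c (arc a b) - arc a b = g b - g a"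
proof (induction b rule: dec_induct)
  case base
  then show ?case using linear_0[OF W_linear[OF c_in_W]] by (simp add: arc_def)
next
  case (step b)
  have "arc a (Suc b) = arc a b + g b" using step(1) by (simp add: arc_def)
  then have "c (arc a (Suc b)) - arc a (Suc b) = (c (arc a b) - arc a b) + (g (Suc b) - g b)"
    using linear_add[OF W_linear[OF c_in_W]] by simp
  then show ?case using step by simp
qed

lemma arc_sum: "b \<le> a + h \<Longrightarrow> arc a b = (\<Sum>p\<in>g ` {a..<b}. p)"
  unfolding arc_def by (simp add: sum.reindex[OF inj_on_g])

text \<open>Antipodes are \<open>h / 2\<close> indices apart, while two indices in the arc differ by
  less.\<close>

lemma no_antipodes_in_half_arc:
  assumes "2 * (b - a) \<le> h" "p \<in> g ` {a..<b}"
  shows "- p \<notin> g ` {a..<b}"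
proof
  assume "- p \<in> g ` {a..<b}"
  then obtain i j where ij: "p = g i" "- p = g j" "a \<le> i" "i < b" "a \<le> j" "j < b"
    using assms by auto
  obtain m where m: "h = 2 * m" "\<And>k. - g k = g (k + m)"
    using antipode_shift[of i] ij by (metis g_in_X)
  have "g j = g (i + m)" "g i = g (j + m)" using m(2)[of i] m(2)[of j] ij by (metis minus_minus)+
  moreover have "j < i + m" "i < j + m" using assms ij m by linarith+
  moreover have "i + m < j + h" using ij assms m by linarith
  ultimately show False using g_eq_imp[of j "i + m"] by simp
qed

end

subsection \<open>Prefixes of the Coxeter element have noncrossing orbits\<close>

lemma orbit_of_refl: "p \<in> orbit_of (words S) p"
  unfolding orbit_of_def by (rule image_eqI[OF _ id_in_words]) simp

lemma orbit_of_trans: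
  assumes "q \<in> orbit_of (words S) p" "r \<in> orbit_of (words S) q"
  shows "r \<in> orbit_of (words S) p"
proof -
  obtain f g where "f \<in> words S" "q = f p" "g \<in> words S" "r = g q"
    using assms by (auto simp: orbit_of_def)
  then show ?thesis
    unfolding orbit_of_def by (intro image_eqI[OF _ words_comp[of g S f]]) auto
qed

lemma orbit_of_sym:
  assumes "\<And>s. s \<in> S \<Longrightarrow> s \<circ> s = id" "q \<in> orbit_of (words S) p"
  shows "p \<in> orbit_of (words S) q"
proof -
  obtain f where f: "f \<in> words S" "q = f p" using assms(2) by (auto simp: orbit_of_def)
  obtain f' where "f' \<in> words S" "f' \<circ> f = id" using words_inverse[OF assms(1) f(1)] by blast
  moreover have "p = f' q" using calculation f by (metis comp_apply id_apply)
  ultimately show ?thesis by (auto simp: orbit_of_def)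
qed

lemma (in isometry_group) words_reflections_in_W: "S \<subseteq> reflections W \<Longrightarrow> words S \<subseteq> W"
  by (intro words_least id_in_W comp_in_W) (auto simp: reflections_def)

lemma reflections_involution: "s \<in> reflections W \<Longrightarrow> s \<circ> s = id"
  by (auto simp: reflections_def)

lemma (in isometry_group) words_conj_reflection:
  assumes "S \<subseteq> reflections W" "f \<in> words S" "reflect_along a \<in> words S"
  shows "reflect_along (f a) \<in> words S"
proof -
  obtain f' where f': "f' \<in> words S" "f \<circ> f' = id"
    using words_inverse[OF reflections_involution[OF subsetD[OF assms(1)]] assms(2)] by blast
  have "orthogonal_transformation f"
    using words_reflections_in_W[OF assms(1)] assms(2) W_orthogonal by blast
  then have "f (reflect_along a (f' v)) = reflect_along (f a) v" for v
    using reflect_along_conj[of f a "f' v"] f'(2) by (metis comp_apply id_apply)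
  then have "reflect_along (f a) = f \<circ> (reflect_along a \<circ> f')" by auto
  then show ?thesis using assms f' by (simp only: words_comp)
qed

context coxeter_orbit
begin

text \<open>\<open>M\<close> is the part of the orbit of \<open>g r\<close> lying in the arc: on
  \<open>X\<close> the inner product with \<open>w\<close> is 1 exactly there, as a half arc has no
  antipodes. Invariance of \<open>M\<close> under \<open>x\<close> puts \<open>g s\<close> into the
  arc too, against the choice of indices.\<close>

lemma reduced_prefix_half_arc:
  assumes red: "reduced_T_word W (ts @ ws) c"
    and o: "a < r" "r < b" "b < s" "s < a + h" and half: "2 * (b - a) \<le> h"
    and ab: "g b \<in> orbit_of (words (set ts)) (g a)"
    and rs: "g s \<in> orbit_of (words (set ts)) (g r)"
  shows "g r \<in> orbit_of (words (set ts)) (g a)"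
proof (rule ccontr)
  let ?H = "words (set ts)"
  assume nr: "g r \<notin> orbit_of ?H (g a)"
  define x where "x = word_prod ts"
  define p q w A where "p = g a" and "q = g b" and "w = arc a b" and "A = g ` {a..<b}"
  have refl: "set ts \<subseteq> reflections W" using red by (auto simp: reduced_T_word_def)
  note inv = reflections_involution[of _ W, OF subsetD[OF refl]]
  have HW: "?H \<subseteq> W" using words_reflections_in_W[OF refl] .
  have xH: "x \<in> ?H" unfolding x_def by (rule wordsI) auto
  then have xW: "x \<in> W" using HW by blast
  have xin: "x u \<bullet> x v = u \<bullet> v" for u v
    using W_orthogonal[OF xW] by (simp add: orthogonal_transformation_def)
  obtain f where f: "f \<in> ?H" "g b = f (g a)" using ab by (auto simp: orbit_of_def)
  have "c w - w = f p - p" using c_arc[of a b] o f by (simp add: w_def p_def)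
  then have xw: "x w - w = q - p"
    using reduced_prefix_displacement[OF red f(1)] f by (simp add: x_def q_def p_def)
  have AX: "A \<subseteq> X" by (auto simp: A_def)
  have wt: "w \<bullet> t = of_bool (t \<in> A) - of_bool (- t \<in> A)" if "t \<in> X" for t
    using inner_sum_X[OF AX that] arc_sum[of b a] o by (simp add: w_def A_def)
  have pX: "p \<in> X" "q \<in> X" by (auto simp: p_def q_def)
  have pq: "p \<noteq> q" using g_eq_imp[of a b] o by (auto simp: p_def q_def)
  have pA: "p \<in> A" using o by (auto simp: p_def A_def)
  have wp: "w \<bullet> p = 1"
    using wt[OF pX(1)] pA no_antipodes_in_half_arc[OF half, of p] by (simp add: A_def)
  define M where "M = {t \<in> orbit_of ?H (g r). w \<bullet> t = 1}"
  have orbX: "orbit_of ?H (g r) \<subseteq> X" using HW W_Y by (auto simp: orbit_of_def)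
  have MX: "M \<subseteq> X" using orbX by (auto simp: M_def)
  have xM: "x t \<in> M" if t: "t \<in> M" for t
  proof -
    have tX: "t \<in> X" "x t \<in> X" using MX t W_Y[OF xW] by auto
    have orb: "x t \<in> orbit_of ?H (g r)"
      using t xH orbit_of_trans[of t "set ts" "g r" "x t"] by (auto simp: M_def orbit_of_def)
    have sep: "u \<in> orbit_of ?H (g r) \<Longrightarrow> u \<notin> orbit_of ?H (g a)" for u
      using nr orbit_of_trans orbit_of_sym[OF inv] by metis
    have np: "x t \<noteq> p" "x t \<noteq> q"
      using sep[OF orb] nr ab orbit_of_refl[of "g a" "set ts"] by (auto simp: p_def q_def)
    have "(x w - w) \<bullet> x t = w \<bullet> t - w \<bullet> x t" by (simp add: inner_diff_left xin)
    then have e: "w \<bullet> x t = 1 - (q - p) \<bullet> x t" using t xw by (simp add: M_def)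
    \<comment> \<open>As \<open>x t\<close> is neither \<open>p\<close> nor \<open>q\<close>, only
      their antipodes could interfere. \<open>x t = - p\<close> forces \<open>q = - p\<close>, that
      is \<open>x t = q\<close>. \<open>x t = - q\<close> gives \<open>w\<close> the value
      \<open>2 - p \<bullet> q\<close> there, which exceeds its bound 1 on \<open>X\<close> because
      \<open>p \<noteq> q\<close>.\<close>
    have "(q - p) \<bullet> x t = 0"
    proof -
      have "x t \<noteq> - p"
      proof
        assume xt: "x t = - p"
        then have "q \<bullet> p = - 1"
          using e wp inner_X[of p p] pX by (simp add: inner_diff_left)
        then have "q = - p" using inner_X[OF pX(2,1)] by (auto split: if_splits)
        then show False using xt np by simp
      qed
      moreover have "x t \<noteq> - q"
      proof
        assume xt: "x t = - q"
        then have "w \<bullet> x t = 2 - p \<bullet> q"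
          using e inner_X[of q q] pX by (simp add: inner_diff_left)
        moreover have "w \<bullet> x t \<le> 1" using wt[OF tX(2)] by simp
        ultimately show False using inner_X[OF pX] pq by (auto split: if_splits)
      qed
      ultimately show ?thesis
        using np inner_X[OF pX(1) tX(2)] inner_X[OF pX(2) tX(2)]
        by (auto simp: inner_diff_left minus_equation_iff[of "x t"])
    qed
    then show ?thesis using e orb by (simp add: M_def)
  qed
  have finM: "finite M" using MX finite_X finite_subset by blast
  have injx: "inj_on x M" using inj_on_W[OF xW] inj_on_subset by blast
  have xMM: "x ` M = M" using finM injx xM by (meson endo_inj_surj image_subsetI)
  \<comment> \<open>A single vector replaces the set \<open>M\<close>: \<open>z\<close> is fixed by
    \<open>x\<close>, hence by the whole subgroup, so its inner product with \<open>g r\<close> is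
    carried over to \<open>g s\<close>.\<close>
  define z where "z = (\<Sum>t\<in>M. t)"
  have "x z = (\<Sum>t\<in>M. x t)" unfolding z_def using linear_sum[OF W_linear[OF xW]] .
  also have "\<dots> = (\<Sum>t\<in>x ` M. t)" using injx by (simp add: sum.reindex)
  finally have xz: "x z = z" by (simp add: xMM z_def)
  have zt: "z \<bullet> t = of_bool (t \<in> M) - of_bool (- t \<in> M)" if "t \<in> X" for t
    unfolding z_def using inner_sum_X[OF MX that] .
  have "g r \<in> A" using o by (auto simp: A_def)
  then have wr: "w \<bullet> g r = 1"
    using wt[of "g r"] no_antipodes_in_half_arc[OF half, of "g r"] by (simp add: A_def)
  then have "g r \<in> M" "- g r \<notin> M" using orbit_of_refl by (auto simp: M_def)
  then have zr: "z \<bullet> g r = 1" using zt[of "g r"] by simp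
  obtain f' where f': "f' \<in> ?H" "g s = f' (g r)" using rs by (auto simp: orbit_of_def)
  have "f' z = z" using reduced_prefix_fixed[OF red f'(1)] xz by (simp add: x_def)
  moreover have "f' z \<bullet> f' (g r) = z \<bullet> g r"
    using f'(1) HW W_orthogonal by (meson orthogonal_transformation_def subsetD)
  ultimately have "z \<bullet> g s = 1" using f' zr by simp
  then have "g s \<in> M" using zt[of "g s"] by (auto simp: of_bool_def split: if_splits)
  then have "g s \<in> A" using wt[of "g s"] by (auto simp: M_def of_bool_def split: if_splits)
  then obtain j where "a \<le> j" "j < b" "g j = g s" by (auto simp: A_def)
  then show False using g_eq_imp[of j s] o by auto
qed

text \<open>The chord from \<open>g a\<close> to \<open>g b\<close> bounds two arcs, and one of them
  has at most half of the points.\<close>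

lemma reduced_prefix_noncrossing:
  assumes red: "reduced_T_word W (ts @ ws) c"
    and ne: "q \<notin> orbit_of (words (set ts)) p"
  shows "\<not> crossing (orbit_of (words (set ts)) p) (orbit_of (words (set ts)) q)"
proof
  let ?O = "orbit_of (words (set ts))"
  assume "crossing (?O p) (?O q)"
  then obtain a r b s where o: "a < r" "r < b" "b < s" "s < a + h"
    and ab: "g a \<in> ?O p" "g b \<in> ?O p" and rs: "g r \<in> ?O q" "g s \<in> ?O q"
    unfolding crossing_def by blast
  have refl: "set ts \<subseteq> reflections W" using red by (auto simp: reduced_T_word_def)
  have sym: "u \<in> ?O v" if "v \<in> ?O u" for u v
    using orbit_of_sym[OF reflections_involution[of _ W, OF subsetD[OF refl]] that] .
  have rel: "v \<in> ?O u" if "u \<in> ?O t" "v \<in> ?O t" for t u v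
    using sym[OF that(1)] that(2) by (rule orbit_of_trans)
  have eq: "g b \<in> ?O (g a)" "g a \<in> ?O (g b)" "g s \<in> ?O (g r)" "g r \<in> ?O (g s)"
    using rel[OF ab] rel[OF ab(2,1)] rel[OF rs] rel[OF rs(2,1)] by simp_all
  have "g r \<in> ?O (g a) \<or> g s \<in> ?O (g b)"
  proof (cases "2 * (b - a) \<le> h")
    case True
    then show ?thesis using reduced_prefix_half_arc[OF red o _ eq(1,3)] by blast
  next
    case False
    \<comment> \<open>The other arc starts at \<open>b\<close>; the alternation is shifted to
      \<open>b < s < a + h < r + h\<close>.\<close>
    then have "2 * (a + h - b) \<le> h" using o by linarith
    then have "g s \<in> ?O (g b)"
      using reduced_prefix_half_arc[OF red, of b s "a + h" "r + h"] o eq(2,4) by (simp add: g_periodic)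
    then show ?thesis by blast
  qed
  then obtain u where u: "u \<in> ?O p" "u \<in> ?O q" using rs orbit_of_trans[OF ab(1)] orbit_of_trans[OF ab(2)] by metis
  then have "q \<in> ?O p" using orbit_of_trans[OF u(1) sym[OF u(2)]] by simp
  then show False using ne by simp
qed

end

subsection \<open>Noncrossing subgroups are prefixes\<close>

text \<open>
  \<open>full\<close> excludes subgroups of type D inside type B, which have the same orbits as a parabolic
  subgroup but are smaller.
\<close>

locale noncrossing_subgroup = coxeter_orbit W X c \<Psi> h
  for W :: "('a::euclidean_space \<Rightarrow> 'a) set" and X :: "'a set" and c \<Psi> h +
  fixes R :: "('a \<Rightarrow> 'a) set"
  assumes R_reflections: "R \<subseteq> reflections W"
    and R_diff: "t \<in> R \<Longrightarrow> \<exists>p\<in>X. \<exists>q\<in>orbit_of (words R) p. p \<noteq> q \<and> t = reflect_along (p - q)"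
    and full: "p \<in> X \<Longrightarrow> q \<in> orbit_of (words R) p \<Longrightarrow> p \<noteq> q \<Longrightarrow> reflect_along (p - q) \<in> words R"
    and noncross: "p \<in> X \<Longrightarrow> q \<in> X \<Longrightarrow> q \<notin> orbit_of (words R) p \<Longrightarrow>
      \<not> crossing (orbit_of (words R) p) (orbit_of (words R) q)"
begin

abbreviation E :: "'a \<Rightarrow> 'a \<Rightarrow> bool" where "E p q \<equiv> q \<in> orbit_of (words R) p"

lemma H_W: "words R \<subseteq> W"
  using words_reflections_in_W[OF R_reflections] .

lemma E_sym: "E p q \<Longrightarrow> E q p"
  using orbit_of_sym[OF reflections_involution[OF subsetD[OF R_reflections]]] .

lemma E_trans: "E p q \<Longrightarrow> E q r \<Longrightarrow> E p r"
  by (rule orbit_of_trans)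

lemma E_apply: "f \<in> words R \<Longrightarrow> E p q \<Longrightarrow> E p (f q)"
  by (rule E_trans) (auto simp: orbit_of_def)

lemma E_X: "E p q \<Longrightarrow> p \<in> X \<Longrightarrow> q \<in> X"
  using H_W W_Y by (auto simp: orbit_of_def)

lemma E_neg: "E p q \<Longrightarrow> E (- p) (- q)"
proof -
  assume "E p q"
  then obtain f where f: "f \<in> words R" "q = f p" by (auto simp: orbit_of_def)
  then have "- q = f (- p)" using linear_neg[OF W_linear] H_W by (metis subsetD)
  then show ?thesis using f by (auto simp: orbit_of_def)
qed

lemma no_cross:
  assumes "a < b" "b < a'" "a' < b'" "b' < a + h" "E (g a) (g a')" "E (g b) (g b')"
  shows "E (g a) (g b)"
proof (rule ccontr)
  assume "\<not> E (g a) (g b)"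
  then have "\<not> crossing (orbit_of (words R) (g a)) (orbit_of (words R) (g b))"
    by (intro noncross) auto
  moreover have "crossing (orbit_of (words R) (g a)) (orbit_of (words R) (g b))"
    unfolding crossing_def
    by (intro exI[of _ a] exI[of _ b] exI[of _ a'] exI[of _ b'] conjI assms orbit_of_refl)
  ultimately show False by blast
qed

text \<open>The number of \<open>c\<close>-steps to the next point of the same block. A singleton
  block has gap \<open>h\<close>, so its point is its own successor.\<close>

definition gap :: "'a \<Rightarrow> nat" where
  "gap p = (LEAST k. 0 < k \<and> E p ((c ^^ k) p))"

definition nxt :: "'a \<Rightarrow> 'a" where
  "nxt p = (c ^^ gap p) p"

lemma gap_le_h:
  assumes "p \<in> X"
  shows "0 < gap p" "E p (nxt p)" "gap p \<le> h"
proof -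
  obtain k where k: "p = g k" using X_elim[OF assms] by metis
  have h: "0 < h \<and> E p ((c ^^ h) p)"
    using h_pos g_periodic[of k] orbit_of_refl by (simp add: k c_pow_g add.commute)
  show "0 < gap p" "E p (nxt p)"
    using LeastI[of "\<lambda>k. 0 < k \<and> E p ((c ^^ k) p)", OF h] by (auto simp: gap_def nxt_def)
  show "gap p \<le> h" unfolding gap_def using h by (rule Least_le)
qed

lemma gap_least: "0 < k \<Longrightarrow> E p ((c ^^ k) p) \<Longrightarrow> gap p \<le> k"
  unfolding gap_def by (rule Least_le) simp

lemma nxt_X: "p \<in> X \<Longrightarrow> nxt p \<in> X"
  using E_X gap_le_h by blast

text \<open>Oddness is what allows \<open>nxt\<close> to extend to a linear map in
  \<open>W\<close>.\<close>

lemma nxt_neg: "nxt (- p) = - nxt p"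
proof -
  have lin: "(c ^^ k) (- p) = - (c ^^ k) p" for k
    using linear_neg[OF W_linear[OF c_pow_in_W]] .
  have "E (- p) (- (c ^^ k) p) \<longleftrightarrow> E p ((c ^^ k) p)" for k
    using E_neg[where p = p and q = "(c ^^ k) p"] E_neg[where p = "- p" and q = "- (c ^^ k) p"] by auto
  then show ?thesis by (simp add: nxt_def gap_def lin)
qed

text \<open>Two points with the same successor share a block, and if they were different, one would
  lie strictly between the other and that successor, against the minimality of the gap.\<close>

lemma nxt_inj_aux:
  assumes "p \<in> X" "p' \<in> X" "nxt p = nxt p'" "gap p \<le> gap p'"
  shows "p = p'"
proof -
  have "(c ^^ gap p) p = (c ^^ gap p) ((c ^^ (gap p' - gap p)) p')"
    using assms by (simp add: nxt_def flip: funpow_add[unfolded comp_def, THEN fun_cong])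
  then have p: "p = (c ^^ (gap p' - gap p)) p'"
    using inj_on_W[OF c_pow_in_W] by (meson injD)
  show ?thesis
  proof (cases "gap p = gap p'")
    case False
    have "E p' p" using gap_le_h assms E_trans E_sym by metis
    then have "gap p' \<le> gap p' - gap p" using gap_least[of "gap p' - gap p" p'] p False assms(4) by simp
    then show ?thesis using gap_le_h(1) assms by (metis diff_less leD le_less_trans not_le)
  qed (use p in simp)
qed

lemma inj_nxt: "inj_on nxt X"
  using nxt_inj_aux by (metis inj_onI nat_le_linear)

text \<open>A point strictly between \<open>g a\<close> and its successor lies in another block, and
  leaving the open arc would make that block cross the block of \<open>g a\<close>.\<close>

lemma nxt_closes_arc:
  assumes j: "a < j" "j < a + gap (g a)"
  shows "nxt (g j) \<in> g ` {a<..<a + gap (g a)}"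
proof -
  let ?k = "gap (g a)"
  have ka: "g (a + ?k) = nxt (g a)" by (simp add: nxt_def c_pow_g add.commute)
  have notE: "\<not> E (g a) (g j)"
  proof
    assume "E (g a) (g j)"
    then have "?k \<le> j - a" using gap_least[of "j - a" "g a"] j by (simp add: c_pow_g)
    then show False using j by simp
  qed
  obtain l where l: "a \<le> l" "l < a + h" "nxt (g j) = g l"
    using X_elim[OF nxt_X[OF g_in_X]] .
  have Ejl: "E (g j) (g l)" using gap_le_h(2)[of "g j"] l by simp
  have "l \<noteq> a" using Ejl notE E_sym by auto
  moreover have "l \<noteq> a + ?k"
    using Ejl notE E_sym E_trans gap_le_h(2)[of "g a"] ka by (metis g_in_X)
  moreover have "\<not> a + ?k < l"
    using no_cross[of a j "a + ?k" l] l j Ejl notE gap_le_h(2)[of "g a"] ka by auto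
  ultimately show ?thesis using l by auto
qed

text \<open>Both displacement equations have the same witness, the sum over the arc from
  \<open>p\<close> to its successor. This common witness is what the dimension count
  consumes.\<close>

lemma rotation_exists:
  obtains x where "x \<in> W" "\<And>p. p \<in> X \<Longrightarrow> x p = nxt p"
    "\<And>p. p \<in> X \<Longrightarrow> \<exists>w. c w - w = nxt p - p \<and> x w - w = nxt p - p"
proof -
  obtain x where x: "x \<in> W" "\<And>p. p \<in> X \<Longrightarrow> x p = nxt p"
    using odd_map_extends[of nxt] nxt_X inj_nxt nxt_neg by metis
  have "\<exists>w. c w - w = nxt p - p \<and> x w - w = nxt p - p" if pX: "p \<in> X" for p
  proof -
    obtain a where a: "p = g a" using X_elim[OF pX] by metis
    define b where "b = a + gap p"
    define S where "S = g ` {a<..<b}"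
    have ab: "a < b" "b \<le> a + h" using gap_le_h[OF pX] by (auto simp: b_def)
    have gb: "g b = nxt p" by (simp add: a b_def nxt_def c_pow_g add.commute)
    have inj: "inj_on g {a<..<b}" using inj_on_g[OF ab(2)] by (rule inj_on_subset) auto
    have "{a..<b} = insert a {a<..<b}" using ab by auto
    then have w: "arc a b = p + (\<Sum>q\<in>S. q)"
      by (simp add: arc_def S_def a sum.reindex[OF inj])
    have "x q \<in> S" if "q \<in> S" for q
      using that nxt_closes_arc[of a] x(2) by (auto simp: S_def b_def a)
    moreover have injS: "inj_on x S" using inj_on_W[OF x(1)] inj_on_subset by blast
    ultimately have xS: "x ` S = S" by (intro endo_inj_surj) (auto simp: S_def)
    have "x (\<Sum>q\<in>S. q) = (\<Sum>q\<in>S. x q)" using linear_sum[OF W_linear[OF x(1)]] .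
    also have "\<dots> = (\<Sum>q\<in>x ` S. q)" using injS by (simp add: sum.reindex)
    finally have "x (\<Sum>q\<in>S. q) = (\<Sum>q\<in>S. q)" unfolding xS .
    then have "x (arc a b) - arc a b = nxt p - p"
      unfolding w using linear_add[OF W_linear[OF x(1)]] x(2)[OF pX] by simp
    moreover have "c (arc a b) - arc a b = nxt p - p"
      using c_arc[of a b] ab gb a by simp
    ultimately show ?thesis by blast
  qed
  then show ?thesis using that x by blast
qed

lemma moved_eq_span:
  assumes "x \<in> W"
  shows "moved x = span ((\<lambda>p. x p - p) ` X)"
proof -
  have "linear (\<lambda>v. x v - v)" using linear_compose_sub[OF W_linear[OF assms] linear_ident] .
  then show ?thesis
    unfolding moved_def using linear_span_image[of "\<lambda>v. x v - v" X] span_X by simp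
qed

text \<open>Let \<open>M\<close> be the space where \<open>c\<close> and \<open>x\<close> agree,
  that is the fixed space of \<open>x^-1 c\<close>, and \<open>F\<close> the fixed space of
  \<open>c\<close>. By the witnesses, \<open>c - 1\<close> maps \<open>M\<close> onto a space
  containing \<open>moved x\<close>, and it kills \<open>F \<subseteq> M\<close>. So
  \<open>dim (moved x) \<le> dim M - dim F\<close>, which is the claim by rank and nullity.\<close>

lemma dim_moved_complement:
  assumes x: "x \<in> W"
    and w: "\<And>p. p \<in> X \<Longrightarrow> \<exists>w. c w - w = x p - p \<and> x w - w = x p - p"
  shows "dim (moved (inv_into UNIV x \<circ> c)) + dim (moved x) \<le> dim (moved c)"
proof -
  let ?y = "inv_into UNIV x \<circ> c"
  have yW: "?y \<in> W" using x inv_in_W c_in_W comp_in_W by blast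
  have fixy: "?y v = v \<longleftrightarrow> c v = x v" for v
    using inv_in_W(2,3)[OF x] by (metis comp_apply id_apply)
  have ldiff: "linear (\<lambda>v. f v - v)" if "f \<in> W" for f
    using linear_compose_sub[OF W_linear[OF that] linear_ident] .
  define M where "M = {v. ?y v = v}"
  have sM: "subspace M"
    unfolding M_def subspace_def using W_linear[OF yW]
    by (auto simp: linear_0 linear_add linear_scale simp del: o_apply)
  have rank: "dim {v. f v = v} + dim (moved f) = DIM('a)" if "f \<in> W" for f
  proof -
    have "{v. f v = v} = {v \<in> UNIV. \<forall>u\<in>moved f. orthogonal u v}"
      using inner_moved_fixed[OF W_orthogonal[OF that]] fixed_if_orthogonal_moved[OF W_orthogonal[OF that]]
      by (auto simp: orthogonal_def inner_commute)
    then show ?thesis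
      using dim_subspace_orthogonal_to_vectors[OF subspace_moved[OF W_linear[OF that]] subspace_UNIV]
      by simp
  qed
  \<comment> \<open>A vector fixed by \<open>c\<close> has the same inner product with all points of
    the single \<open>c\<close>-orbit \<open>X\<close>, so it is orthogonal to every
    \<open>x p - p\<close> and is fixed by \<open>x\<close>.\<close>
  have fixc: "c v = v \<Longrightarrow> v \<in> M" for v
  proof -
    assume cv: "c v = v"
    have cin: "c u \<bullet> c u' = u \<bullet> u'" for u u'
      using W_orthogonal[OF c_in_W] by (simp add: orthogonal_transformation_def)
    have "v \<bullet> g k = v \<bullet> g 0" for k
      by (induction k) (use cin[of v] cv in \<open>auto\<close>, metis c_g)
    then have vconst: "v \<bullet> p = v \<bullet> q" if "p \<in> X" "q \<in> X" for p q
      using X_elim[OF that(1)] X_elim[OF that(2)] by metis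
    have "x v = v"
    proof (rule fixed_if_orthogonal_moved[OF W_orthogonal[OF x]])
      fix u assume "u \<in> moved x"
      then show "v \<bullet> u = 0" unfolding moved_eq_span[OF x]
      proof (induction rule: span_induct)
        show "subspace {u. v \<bullet> u = 0}" by (rule subspace_hyperplane)
        fix u assume "u \<in> (\<lambda>p. x p - p) ` X"
        then obtain p where "p \<in> X" "u = x p - p" by blast
        then show "v \<bullet> u = 0" using vconst[OF W_Y[OF x]] by (simp add: inner_diff_right)
      qed
    qed
    then show "v \<in> M" using cv fixy by (simp add: M_def del: o_apply)
  qed
  define F where "F = {v. c v = v}"
  have sF: "subspace F"
    unfolding F_def subspace_def using W_linear[OF c_in_W]
    by (auto simp: linear_0 linear_add linear_scale)
  define M' where "M' = {v \<in> M. \<forall>u\<in>F. orthogonal u v}"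
  have dM': "dim M' + dim F = dim M"
    unfolding M'_def by (rule dim_subspace_orthogonal_to_vectors[OF sF sM]) (use fixc in \<open>auto simp: F_def\<close>)
  have "subspace M'"
    using sM subspace_orthogonal_to_vectors[of F]
    unfolding M'_def subspace_def orthogonal_def by (auto simp: inner_right_distrib)
  let ?D = "(\<lambda>v. c v - v) ` M'"
  have sD: "subspace ?D" using linear_subspace_image[OF ldiff[OF c_in_W] \<open>subspace M'\<close>] .
  have "dim ?D \<le> dim M'" by (rule dim_image_le[OF ldiff[OF c_in_W]])
  moreover have "moved x \<subseteq> ?D"
    unfolding moved_eq_span[OF x]
  proof (rule span_minimal[OF _ sD], clarify)
    fix p assume "p \<in> X"
    then obtain v where v: "c v - v = x p - p" "x v - v = x p - p" using w by blast
    then have "c v = x v" by (metis diff_add_cancel)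
    then have vM: "v \<in> M" using fixy by (simp add: M_def del: o_apply)
    \<comment> \<open>Dropping the component in \<open>F\<close> changes neither membership in
      \<open>M\<close> nor the displacement by \<open>c\<close>.\<close>
    obtain y z where yz: "y \<in> span F" "\<And>u. u \<in> span F \<Longrightarrow> orthogonal z u" "v = y + z"
      using orthogonal_subspace_decomp_exists[of F v] by blast
    have yF: "y \<in> F" using yz(1) sF by (metis span_eq_iff)
    then have "y \<in> M" using fixc by (simp add: F_def)
    then have "z \<in> M" using subspace_diff[OF sM vM] yz(3) by (metis add_diff_cancel_left')
    then have "z \<in> M'" using yz(2) by (auto simp: M'_def span_base orthogonal_commute)
    moreover have "c z - z = x p - p"
      using v(1) yF yz(3) linear_add[OF W_linear[OF c_in_W]] by (simp add: F_def)
    ultimately show "x p - p \<in> ?D" by (intro image_eqI[of _ _ z]) simp_all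
  qed
  then have "dim (moved x) \<le> dim ?D" by (rule dim_subset)
  ultimately show ?thesis
    using rank[OF yW] rank[OF c_in_W] dM' unfolding M_def F_def by linarith
qed


text \<open>Each block is a single cycle of \<open>x\<close>: induction on the number of
  \<open>c\<close>-steps from \<open>p\<close> to \<open>q\<close>, jumping over one gap at a
  time.\<close>

lemma E_pow:
  assumes x: "\<And>p. p \<in> X \<Longrightarrow> x p = nxt p" and "p \<in> X" "E p q"
  shows "\<exists>n. q = (x ^^ n) p"
proof -
  have "\<exists>n. q = (x ^^ n) p" if "q = (c ^^ l) p" "p \<in> X" "E p q" for l p
    using that
  proof (induction l arbitrary: p rule: less_induct)
    case (less l)
    show ?case
    proof (cases "l = 0")
      case True
      then show ?thesis using less.prems by (intro exI[of _ 0]) simp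
    next
      case False
      have le: "gap p \<le> l" using gap_least[of l p] False less.prems by simp
      have pos: "0 < gap p" and En: "E p (nxt p)" using gap_le_h[OF less.prems(2)] by auto
      have "l = (l - gap p) + gap p" using le by simp
      then have "q = (c ^^ (l - gap p)) (nxt p)"
        using less.prems(1) by (metis comp_apply funpow_add nxt_def)
      moreover have "E (nxt p) q" using En less.prems(3) E_sym E_trans by blast
      ultimately obtain n where "q = (x ^^ n) (nxt p)"
        using less.IH[of "l - gap p" "nxt p"] nxt_X[OF less.prems(2)] le pos False by auto
      then have "q = (x ^^ Suc n) p" using x[OF less.prems(2)] by (simp add: funpow_swap1)
      then show ?thesis by blast
    qed
  qed
  moreover obtain k where k: "p = g k" using X_elim[OF \<open>p \<in> X\<close>] by metis
  moreover obtain l where "k \<le> l" "q = g l" using X_elim[OF E_X[OF assms(3,2)]] by metis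
  then have "q = (c ^^ (l - k)) p" by (simp add: k c_pow_g)
  ultimately show ?thesis using assms by blast
qed

lemma E_moved:
  assumes xW: "x \<in> W" and x: "\<And>p. p \<in> X \<Longrightarrow> x p = nxt p" and p: "p \<in> X" "E p q"
  shows "q - p \<in> moved x"
proof -
  have "(x ^^ n) p - p \<in> moved x" for n
  proof (induction n)
    case 0
    then show ?case using subspace_0[OF subspace_moved[OF W_linear[OF xW]]] by simp
  next
    case (Suc n)
    have "(x ^^ Suc n) p - p = (x ((x ^^ n) p) - (x ^^ n) p) + ((x ^^ n) p - p)" by simp
    then show ?case
      using subspace_add[OF subspace_moved[OF W_linear[OF xW]] moved_in Suc.IH] by metis
  qed
  then show ?thesis using E_pow[OF x p] by auto
qed

text \<open>Enclosed from both sides: \<open>R \<subseteq> T\<close> by \<open>R_diff\<close>, and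
  \<open>T \<subseteq> words R\<close> by \<open>full\<close>.\<close>

definition T :: "('a \<Rightarrow> 'a) set" where
  "T = {reflect_along (p - q) |p q. p \<in> X \<and> E p q \<and> p \<noteq> q}"

lemma T_H: "T \<subseteq> words R"
  using full by (auto simp: T_def)

lemma T_reflections: "T \<subseteq> reflections W"
  using T_H H_W by (fastforce simp: T_def reflections_eq)

text \<open>The greedy step stays among the maps that preserve every block: \<open>p\<close> and
  \<open>y p\<close> share a block, so the letter is in \<open>T\<close>, and the remaining map
  preserves blocks again.\<close>

lemma word_in_T:
  assumes "y \<in> W" "\<And>p. p \<in> X \<Longrightarrow> E p (y p)"
  shows "\<exists>ts. set ts \<subseteq> T \<and> word_prod ts = y \<and> length ts \<le> dim (moved y)"
proof (rule reflection_word_exists[where K = "{y \<in> W. \<forall>p\<in>X. E p (y p)}"])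
  fix y assume y: "y \<in> {y \<in> W. \<forall>p\<in>X. E p (y p)}" "y \<noteq> id"
  then obtain p where p: "p \<in> X" "y p \<noteq> p"
    using eq_if_eq_on_Y[of y id] W_linear by (auto simp: linear_id)
  have E: "E p (y p)" using y p by auto
  have t: "reflect_along (p - y p) \<in> T" unfolding T_def using p E by fastforce
  have m: "reflect_along (y p - p) = reflect_along (p - y p)" by (rule reflect_along_minus_commute)
  show "\<exists>a\<in>moved y. a \<noteq> 0 \<and> reflect_along a \<in> T \<and> reflect_along a \<circ> y \<in> {y \<in> W. \<forall>p\<in>X. E p (y p)}"
  proof (intro bexI[of _ "y p - p"] conjI)
    have tH: "reflect_along (p - y p) \<in> words R" using t T_H by blast
    have "E q (reflect_along (p - y p) (y q))" if "q \<in> X" for q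
      using y that by (intro E_apply[OF tH]) auto
    then show "reflect_along (y p - p) \<circ> y \<in> {y \<in> W. \<forall>p\<in>X. E p (y p)}"
      using y tH H_W comp_in_W unfolding m by auto
  qed (use p t m in auto)
qed (use assms W_orthogonal in auto)

text \<open>
  If a block contains an antipodal pair \<open>p, - p\<close>, the word is chosen to start with the reflection along \<open>p\<close>;
  otherwise its letters might generate only a group of type D.
\<close>

lemma word_generates:
  assumes xW: "x \<in> W" and x: "\<And>p. p \<in> X \<Longrightarrow> x p = nxt p"
  obtains ts where "set ts \<subseteq> T" "word_prod ts = x" "length ts \<le> dim (moved x)"
    "\<And>p. p \<in> X \<Longrightarrow> E p (- p) \<Longrightarrow> \<exists>q. E q p \<and> q \<in> X \<and> reflect_along q \<in> words (set ts)"
proof (cases "\<exists>p\<in>X. E p (- p)")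
  case False
  obtain ts where "set ts \<subseteq> T" "word_prod ts = x" "length ts \<le> dim (moved x)"
    using word_in_T[OF xW] x gap_le_h(2) by auto
  then show ?thesis using that False by blast
next
  case True
  then obtain p where p: "p \<in> X" "E p (- p)" by blast
  have a: "- p - p \<in> moved x" "- p - p \<noteq> 0"
    using E_moved[OF xW x p] neg_neq_X[OF p(1)] by auto
  define t where "t = reflect_along (- p - p)"
  have teq: "t = reflect_along (p - (- p))" "t = reflect_along p"
    using reflect_along_minus_commute[of "- p" p] reflect_along_scaleR[of "- 2" p]
    by (auto simp: t_def scaleR_2)
  have tT: "t \<in> T" unfolding T_def teq(1) using p neg_neq_X[OF p(1)] by fastforce
  have lt: "dim (moved (t \<circ> x)) < dim (moved x)"
    unfolding t_def using moved_reflect_along_comp(2)[OF W_orthogonal[OF xW] a] .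
  have tW: "t \<in> W" using tT T_H H_W by blast
  have "E q ((t \<circ> x) q)" if "q \<in> X" for q
    using E_apply[where f = t and p = q and q = "x q"] gap_le_h(2)[OF that] x[OF that] tT T_H by auto
  then obtain ts where ts: "set ts \<subseteq> T" "word_prod ts = t \<circ> x" "length ts \<le> dim (moved (t \<circ> x))"
    using word_in_T[of "t \<circ> x"] comp_in_W[OF tW xW] by blast
  show ?thesis
  proof (rule that[of "t # ts"])
    show "set (t # ts) \<subseteq> T" using ts tT by simp
    show "word_prod (t # ts) = x" using ts(2) by (simp add: t_def o_assoc)
    show "length (t # ts) \<le> dim (moved x)" using ts(3) lt by simp
    fix q assume q: "q \<in> X" "E q (- q)"
    \<comment> \<open>Only one block can contain antipodes: the diameters through \<open>p\<close>
      and \<open>q\<close> alternate on the circle, so distinct blocks would cross.\<close>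
    have "E p q"
    proof (rule ccontr)
      assume n: "\<not> E p q"
      obtain a where a: "p = g a" using X_elim[OF p(1)] by metis
      obtain b where b: "a \<le> b" "b < a + h" "q = g b" using X_elim[OF q(1)] .
      obtain m where m: "h = 2 * m" "\<And>k. - g k = g (k + m)"
        using antipode_shift[of a] p E_X a by metis
      have "b \<noteq> a" using n b a orbit_of_refl[of p R] by auto
      consider "b < a + m" | "b = a + m" | "a + m < b" by linarith
      then show False
      proof cases
        case 1
        then show False using no_cross[of a b "a + m" "b + m"] b \<open>b \<noteq> a\<close> n p q m by (simp add: a)
      next
        case 2
        then show False using n p b m(2)[of a] by (simp add: a)
      next
        case 3
        then have "b - m + m = b" by simp
        then have "g (b - m) = - q" using m(2)[of "b - m"] b(3) by (metis minus_minus)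
        moreover have "E (- q) q" using q E_sym by blast
        ultimately have "E p (- q)"
          using no_cross[of a "b - m" "a + m" b] b 3 p m by (auto simp: a)
        then show False using n \<open>E (- q) q\<close> E_trans by blast
      qed
    qed
    then show "\<exists>q'. E q' q \<and> q' \<in> X \<and> reflect_along q' \<in> words (set (t # ts))"
      using p(1) teq(2) by (intro exI[of _ p]) (auto intro: words_base)
  qed
qed

text \<open>\<open>S\<close> relates points whose exchange is already generated. It relates
  \<open>p\<close> to \<open>t p\<close> for each letter \<open>t\<close> and is transitive, so it
  relates \<open>p\<close> to all its images under powers of \<open>x\<close>, that is to its whole
  block.\<close>

lemma T_subset_words:
  assumes T: "set ts \<subseteq> T" and x: "word_prod ts = x" "\<And>p. p \<in> X \<Longrightarrow> x p = nxt p"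
    and anti: "\<And>p. p \<in> X \<Longrightarrow> E p (- p) \<Longrightarrow> \<exists>q. E q p \<and> q \<in> X \<and> reflect_along q \<in> words (set ts)"
  shows "T \<subseteq> words (set ts)"
proof -
  let ?K = "words (set ts)"
  have refl: "set ts \<subseteq> reflections W" using T T_reflections by blast
  have KH: "?K \<subseteq> words R" using T T_H by (intro words_subset) blast
  have xK: "x \<in> ?K" using x(1) by (intro wordsI[of ts]) auto
  define S where "S p q \<longleftrightarrow> p = q \<or> reflect_along (p - q) \<in> ?K" for p q
  have S_E: "E p q" if "S p q" "p \<in> X" "q \<in> X" for p q
  proof (cases "p = q")
    case False
    then have "reflect_along (p - q) \<in> words R" using that KH by (auto simp: S_def)
    moreover have "reflect_along (p - q) p = q" using reflect_along_swap[of p q] norm_X that by simp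
    ultimately show ?thesis using E_apply[OF _ orbit_of_refl, of "reflect_along (p - q)" p] by simp
  qed (use orbit_of_refl in simp)
  have xpow: "(x ^^ n) \<in> ?K" for n
    by (induction n) (auto simp only: funpow.simps intro: id_in_words words_comp xK)
  have anti': "reflect_along p \<in> ?K" if p: "p \<in> X" "E p (- p)" for p
  proof -
    obtain q where q: "E q p" "q \<in> X" "reflect_along q \<in> ?K" using anti p by blast
    then obtain n where "p = (x ^^ n) q" using E_pow x(2) by blast
    then show ?thesis using words_conj_reflection[OF refl xpow q(3)] by simp
  qed
  have conj: "S (f p) (f q)" if "f \<in> ?K" "S p q" for f p q
    using that words_conj_reflection[OF refl, of f "p - q"]
      linear_diff[OF W_linear, of f p q] words_reflections_in_W[OF refl]
    by (auto simp: S_def)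
  have S_trans: "S p r" if "S p q" "S q r" "p \<in> X" "q \<in> X" "r \<in> X" for p q r
  proof (cases "p = q \<or> q = r \<or> p = r")
    case True
    then show ?thesis using that by (auto simp: S_def)
  next
    case False
    then have t: "reflect_along (p - q) \<in> ?K" "reflect_along (q - r) \<in> ?K" using that by (auto simp: S_def)
    \<comment> \<open>Conjugating one exchange by the other gives the third, except for
      \<open>p = - r\<close>: there the two reflections commute, and the sign change must come from
      \<open>anti'\<close>. For \<open>p = - q\<close> the first reflection is itself a sign change
      and has to be the conjugating one.\<close>
    consider "p = - r" | "p = - q" | "p \<noteq> - q" "p \<noteq> - r" by blast
    then show ?thesis
    proof cases
      case 1
      have "E p (- p)" using S_E that E_trans 1 by (metis minus_minus)
      then have "reflect_along p \<in> ?K" using anti' that by blast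
      moreover have "reflect_along (p - r) = reflect_along p"
        using reflect_along_scaleR[of 2 p] 1 by (simp add: scaleR_2)
      ultimately show ?thesis by (simp add: S_def)
    next
      case 2
      have "r \<noteq> - p" "r \<noteq> p" "r \<noteq> q" "r \<noteq> - q" using 2 False by auto
      then have "reflect_along (p - q) r = r" "reflect_along (p - q) q = p"
        using reflect_diff_X[of p q r] reflect_diff_X[of p q q] that False by auto
      then show ?thesis using conj[OF t(1) that(2)] by simp
    next
      case 3
      have "q \<noteq> - p" "r \<noteq> - p" using 3 by (metis minus_minus)+
      then have "reflect_along (q - r) p = p" "reflect_along (q - r) q = r"
        using reflect_diff_X[of q r p] reflect_diff_X[of q r q] that False 3 by auto
      then show ?thesis using conj[OF t(2) that(1)] by simp
    qed
  qed
  have S_letter: "S p (t p)" if "t \<in> set ts" "p \<in> X" for t p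
  proof -
    have "t \<in> T" using that T by blast
    then obtain u v where uv: "t = reflect_along (u - v)" "u \<in> X" "v \<in> X" "u \<noteq> v"
      using E_X unfolding T_def by blast
    have t: "reflect_along (u - v) \<in> ?K" using that uv words_base by metis
    then have "reflect_along (v - u) \<in> ?K" "reflect_along (- u - - v) \<in> ?K" "reflect_along (- v - - u) \<in> ?K"
      using reflect_along_minus_commute[of u v] by auto
    then show ?thesis
      using reflect_diff_X[OF uv(2,3,4) that(2)] t unfolding S_def uv(1) by auto
  qed
  have S_word: "S p (f p)" if "f \<in> ?K" "p \<in> X" for f p
    using that(1)
  proof (induction rule: words_induct)
    case id
    show ?case by (simp add: S_def)
  next
    case (step t f)
    have fX: "f p \<in> X" using step(2) that(2) words_reflections_in_W[OF refl] W_Y by blast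
    then have "t (f p) \<in> X" using step(1) refl W_Y by (auto simp: reflections_def)
    then show ?case using S_trans[OF step(3) S_letter[OF step(1) fX]] fX that(2) by simp
  qed
  show ?thesis
  proof
    fix t assume "t \<in> T"
    then obtain p q where pq: "t = reflect_along (p - q)" "p \<in> X" "E p q" "p \<noteq> q"
      by (auto simp: T_def)
    obtain n where "q = (x ^^ n) p" using E_pow[OF x(2) pq(2,3)] by blast
    then show "t \<in> ?K" using S_word[OF xpow pq(2)] pq by (auto simp: S_def)
  qed
qed

text \<open>A word for \<open>x\<close> is continued by one for \<open>x^-1 c\<close>; the dimension
  count makes the total length minimal.\<close>

theorem noncrossing_is_prefix: "\<exists>ts ws. reduced_T_word W (ts @ ws) c \<and> words R = words (set ts)"
proof -
  obtain x where xW: "x \<in> W" and x: "\<And>p. p \<in> X \<Longrightarrow> x p = nxt p"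
    and w: "\<And>p. p \<in> X \<Longrightarrow> \<exists>w. c w - w = nxt p - p \<and> x w - w = nxt p - p"
    using rotation_exists by blast
  obtain ts where ts: "set ts \<subseteq> T" "word_prod ts = x" "length ts \<le> dim (moved x)"
    and anti: "\<And>p. p \<in> X \<Longrightarrow> E p (- p) \<Longrightarrow> \<exists>q. E q p \<and> q \<in> X \<and> reflect_along q \<in> words (set ts)"
    using word_generates[OF xW x] by blast
  let ?y = "inv_into UNIV x \<circ> c"
  have d: "dim (moved ?y) + dim (moved x) \<le> dim (moved c)"
    using dim_moved_complement[OF xW] w x by simp
  have "?y \<in> W" using xW inv_in_W c_in_W comp_in_W by blast
  then obtain ws where ws: "set ws \<subseteq> reflections W" "word_prod ws = ?y" "length ws \<le> dim (moved ?y)"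
    using W_reflection_word by blast
  have "word_prod (ts @ ws) = c"
    using ts(2) ws(2) inv_in_W(3)[OF xW] by (metis comp_assoc id_comp word_prod_append)
  then have "reduced_T_word W (ts @ ws) c"
    using ts ws T_reflections d by (intro reduced_T_wordI) auto
  moreover have "words R = words (set ts)"
  proof
    show "words (set ts) \<subseteq> words R" using ts(1) T_H by (intro words_subset) blast
    have "R \<subseteq> T" using R_diff unfolding T_def by blast
    then show "words R \<subseteq> words (set ts)"
      using T_subset_words[OF ts(1,2) x anti] by (intro words_subset) blast
  qed
  ultimately show ?thesis by blast
qed

end

subsection \<open>Simple systems as chains\<close>

text \<open>A line meets a sphere in at most two points: the quadratic equation for \<open>t\<close>
  has only the roots 0 and 1, which give \<open>p\<close> and \<open>q\<close>.\<close>

lemma sphere_not_collinear: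
  fixes p q r :: "'a::real_inner"
  assumes "norm q = norm p" "norm r = norm p" "p \<noteq> q" "r \<noteq> p" "r \<noteq> q"
  shows "p - r \<noteq> t *\<^sub>R (p - q)"
proof
  assume e: "p - r = t *\<^sub>R (p - q)"
  have "r = p - (p - r)" by simp
  then have r: "r = p - t *\<^sub>R (p - q)" unfolding e .
  have n: "q \<bullet> q = p \<bullet> p" "r \<bullet> r = p \<bullet> p" using assms by (simp_all add: dot_square_norm)
  have d: "(p - q) \<bullet> (p - q) = 2 * (p \<bullet> (p - q))" using n(1) by (simp add: inner_diff inner_commute)
  have "r \<bullet> r = p \<bullet> p - 2 * t * (p \<bullet> (p - q)) + t * t * ((p - q) \<bullet> (p - q))"
    unfolding r by (simp add: inner_diff_left inner_diff_right inner_commute algebra_simps)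
  then have "t * (t - 1) * ((p - q) \<bullet> (p - q)) = 0" unfolding n d by (simp add: algebra_simps)
  then have "t = 0 \<or> t = 1" using assms(3) by simp
  then show False using r assms by auto
qed

text \<open>Apply both products to \<open>b\<close> and read off the coefficient of \<open>a\<close>
  with \<open>w\<close>: the two orders give it opposite signs.\<close>

lemma commuting_reflections_orthogonal:
  assumes "norm a = 1" "norm b = 1" "a \<bullet> w = 1" "b \<bullet> w = 0"
    and "reflect_along a \<circ> reflect_along b = reflect_along b \<circ> reflect_along a"
  shows "a \<bullet> b = 0"
proof -
  have "reflect_along a (reflect_along b b) = reflect_along b (reflect_along a b)"
    using fun_cong[OF assms(5), of b] by simp
  moreover have "a \<bullet> a = 1" "b \<bullet> b = 1" using assms by (simp_all add: dot_square_norm)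
  ultimately have "- b + (2 * (a \<bullet> b)) *\<^sub>R a
      = b - (2 * (a \<bullet> b)) *\<^sub>R a - (2 * ((b - (2 * (a \<bullet> b)) *\<^sub>R a) \<bullet> b)) *\<^sub>R b"
    by (simp add: reflect_along_def inner_commute)
  then have "(- b + (2 * (a \<bullet> b)) *\<^sub>R a) \<bullet> w
      = (b - (2 * (a \<bullet> b)) *\<^sub>R a - (2 * ((b - (2 * (a \<bullet> b)) *\<^sub>R a) \<bullet> b)) *\<^sub>R b) \<bullet> w"
    by (rule arg_cong)
  then show ?thesis using assms by (simp add: inner_add_left inner_diff_left)
qed

lemma decreasing_enumeration:
  fixes f :: "'a \<Rightarrow> real"
  assumes "finite X" "inj_on f X"
  obtains g where "bij_betw g {..<card X} X" "\<And>i j. i < j \<Longrightarrow> j < card X \<Longrightarrow> f (g j) < f (g i)"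
proof -
  define k where "k p = - f p" for p
  have inj: "inj_on k X" using assms(2) by (auto simp: k_def inj_on_def)
  define L where "L = sorted_list_of_set (k ` X)"
  have L: "set L = k ` X" "distinct L" "length L = card X" "sorted_wrt (<) L"
    using assms(1) inj by (auto simp: L_def card_image strict_sorted_list_of_set)
  define g where "g i = inv_into X k (L ! i)" for i
  have "bij_betw ((!) L) {..<card X} (k ` X)"
    by (rule bij_betw_nth) (use L in auto)
  moreover have "bij_betw (inv_into X k) (k ` X) X"
    using inj by (simp add: bij_betw_inv_into inj_on_imp_bij_betw)
  ultimately have "bij_betw (inv_into X k \<circ> (!) L) {..<card X} X" by (rule bij_betw_trans)
  then have 1: "bij_betw g {..<card X} X" by (simp add: g_def[abs_def] comp_def)
  have kg: "k (g i) = L ! i" if "i < card X" for i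
    unfolding g_def using that L by (metis f_inv_into_f nth_mem)
  have "f (g j) < f (g i)" if "i < j" "j < card X" for i j
    using sorted_wrt_nth_less[OF L(4) that(1)] that(2) kg[of i] kg[of j] that L(3) by (simp add: k_def)
  then show ?thesis using that 1 by blast
qed

section \<open>Heights, and generation by the simple reflections\<close>

locale simple_roots = isometry_group W Y
  for W :: "('a::euclidean_space \<Rightarrow> 'a) set" and Y :: "'a set" +
  fixes \<Delta> :: "'a set" and \<omega> :: "'a \<Rightarrow> 'a"
  assumes simple: "simple_system W \<Delta>" and dual: "dual_basis \<Delta> \<omega>"
begin


lemma finite_\<Delta>: "finite \<Delta>"
  using simple by (simp add: simple_system_def independent_imp_finite)

lemma norm_\<Delta>: "\<alpha> \<in> \<Delta> \<Longrightarrow> norm \<alpha> = 1"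
  and reflect_\<Delta>: "\<alpha> \<in> \<Delta> \<Longrightarrow> reflect_along \<alpha> \<in> W"
  using simple by (auto simp: simple_system_def unit_roots_def)

lemma \<Delta>_nonzero: "\<alpha> \<in> \<Delta> \<Longrightarrow> \<alpha> \<noteq> 0"
  using norm_\<Delta> by fastforce

lemma inner_\<omega>: "\<alpha> \<in> \<Delta> \<Longrightarrow> \<beta> \<in> \<Delta> \<Longrightarrow> \<beta> \<bullet> \<omega> \<alpha> = (if \<alpha> = \<beta> then 1 else 0)"
  using dual by (simp add: dual_basis_def inner_commute)

lemma coefficient: "\<alpha> \<in> \<Delta> \<Longrightarrow> (\<Sum>\<beta>\<in>\<Delta>. k \<beta> *\<^sub>R \<beta>) \<bullet> \<omega> \<alpha> = k \<alpha>"
  using finite_\<Delta> by (simp add: inner_sum_left inner_\<omega> if_distrib cong: if_cong)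

text \<open>On the span of \<open>\<Delta>\<close> this is the sum of the simple coefficients. It is
  defined on the whole space, so it also orders the points of the orbit, which need not lie in that
  span.\<close>

definition ht :: "'a \<Rightarrow> real" where
  "ht v = (\<Sum>\<alpha>\<in>\<Delta>. v \<bullet> \<omega> \<alpha>)"

lemma ht_diff: "ht (p - q) = ht p - ht q"
  by (simp add: ht_def inner_diff_left sum_subtractf)

lemma ht_neg: "ht (- p) = - ht p"
  by (simp add: ht_def sum_negf)

lemma ht_\<Delta>: "\<alpha> \<in> \<Delta> \<Longrightarrow> ht \<alpha> = 1"
  using finite_\<Delta> by (simp add: ht_def inner_\<omega>)

lemma root_expansion:
  assumes "\<beta> \<in> unit_roots W"
  shows "(\<Sum>\<alpha>\<in>\<Delta>. (\<beta> \<bullet> \<omega> \<alpha>) *\<^sub>R \<alpha>) = \<beta>"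
    and "(\<forall>\<alpha>\<in>\<Delta>. 0 \<le> \<beta> \<bullet> \<omega> \<alpha>) \<or> (\<forall>\<alpha>\<in>\<Delta>. \<beta> \<bullet> \<omega> \<alpha> \<le> 0)"
proof -
  obtain k where k: "\<beta> = (\<Sum>\<alpha>\<in>\<Delta>. k \<alpha> *\<^sub>R \<alpha>)" "(\<forall>\<alpha>\<in>\<Delta>. k \<alpha> \<ge> 0) \<or> (\<forall>\<alpha>\<in>\<Delta>. k \<alpha> \<le> 0)"
    using simple assms unfolding simple_system_def by blast
  have c: "\<beta> \<bullet> \<omega> \<alpha> = k \<alpha>" if "\<alpha> \<in> \<Delta>" for \<alpha> unfolding k(1) using coefficient[OF that] .
  then have "(\<Sum>\<alpha>\<in>\<Delta>. (\<beta> \<bullet> \<omega> \<alpha>) *\<^sub>R \<alpha>) = (\<Sum>\<alpha>\<in>\<Delta>. k \<alpha> *\<^sub>R \<alpha>)"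
    by (intro sum.cong) simp_all
  then show "(\<Sum>\<alpha>\<in>\<Delta>. (\<beta> \<bullet> \<omega> \<alpha>) *\<^sub>R \<alpha>) = \<beta>" using k(1) by simp
  show "(\<forall>\<alpha>\<in>\<Delta>. 0 \<le> \<beta> \<bullet> \<omega> \<alpha>) \<or> (\<forall>\<alpha>\<in>\<Delta>. \<beta> \<bullet> \<omega> \<alpha> \<le> 0)"
    using k(2) c by simp
qed

lemma reflections_\<Delta>: "J \<subseteq> \<Delta> \<Longrightarrow> reflect_along ` J \<subseteq> reflections W"
  using reflect_\<Delta> \<Delta>_nonzero unfolding reflections_eq by blast

text \<open>Among the positive images of the root or its negative take one, \<open>\<beta>\<close>,
  of least height. As \<open>\<beta> \<bullet> \<beta> > 0\<close>, some simple
  \<open>\<alpha>\<close> has positive coefficient and positive inner product with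
  \<open>\<beta>\<close>. Reflecting along \<open>\<alpha>\<close> lowers the height, so the image
  is negative; but only the coefficient of \<open>\<alpha>\<close> has changed, so
  \<open>\<beta> = \<alpha>\<close>.\<close>

lemma simple_reflections_reach_root:
  assumes \<gamma>: "\<gamma> \<in> unit_roots W"
  shows "\<exists>f\<in>words (reflect_along ` \<Delta>). f \<gamma> \<in> \<Delta> \<or> f (- \<gamma>) \<in> \<Delta>"
proof -
  let ?G = "words (reflect_along ` \<Delta>)"
  have GW: "?G \<subseteq> W"
    using words_reflections_in_W[OF reflections_\<Delta>[OF order_refl]] .
  have root: "f \<beta> \<in> unit_roots W" if "\<beta> \<in> unit_roots W" "f \<in> W" for f \<beta>
  proof -
    have "f \<circ> reflect_along \<beta> \<circ> inv_into UNIV f = reflect_along (f \<beta>)"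
      using reflect_along_conj[OF W_orthogonal[OF that(2)]] inv_in_W(3)[OF that(2)]
      by (auto simp: fun_eq_iff)
    moreover have "f \<circ> reflect_along \<beta> \<circ> inv_into UNIV f \<in> W"
      using that inv_in_W(1)[OF that(2)] by (intro comp_in_W) (auto simp: unit_roots_def)
    ultimately have "reflect_along (f \<beta>) \<in> W" by simp
    then show ?thesis
      using that W_orthogonal by (auto simp: unit_roots_def orthogonal_transformation_norm)
  qed
  have neg: "- \<beta> \<in> unit_roots W" if "\<beta> \<in> unit_roots W" for \<beta>
    using that reflect_along_scaleR[of "- 1" \<beta>] by (simp add: unit_roots_def)
  have nz: "ht \<beta> \<noteq> 0" if "\<beta> \<in> unit_roots W" for \<beta>
  proof
    assume h0: "ht \<beta> = 0"
    have s0: "(\<Sum>\<alpha>\<in>\<Delta>. \<beta> \<bullet> \<omega> \<alpha>) = 0" "(\<Sum>\<alpha>\<in>\<Delta>. - (\<beta> \<bullet> \<omega> \<alpha>)) = 0"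
      using h0 by (simp_all add: ht_def sum_negf)
    have "\<forall>\<alpha>\<in>\<Delta>. \<beta> \<bullet> \<omega> \<alpha> = 0"
      using root_expansion(2)[OF that]
    proof
      assume "\<forall>\<alpha>\<in>\<Delta>. 0 \<le> \<beta> \<bullet> \<omega> \<alpha>"
      then show ?thesis using sum_nonneg_0[OF finite_\<Delta> _ s0(1)] by blast
    next
      assume "\<forall>\<alpha>\<in>\<Delta>. \<beta> \<bullet> \<omega> \<alpha> \<le> 0"
      then show ?thesis using sum_nonneg_0[OF finite_\<Delta> _ s0(2)] by fastforce
    qed
    then have "(\<Sum>\<alpha>\<in>\<Delta>. (\<beta> \<bullet> \<omega> \<alpha>) *\<^sub>R \<alpha>) = 0" by simp
    then have "\<beta> = 0" unfolding root_expansion(1)[OF that] .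
    then show False using that by (simp add: unit_roots_def)
  qed
  define \<gamma>0 where "\<gamma>0 = (if 0 < ht \<gamma> then \<gamma> else - \<gamma>)"
  have pos0: "0 < ht \<gamma>0" using nz[OF \<gamma>] by (auto simp: \<gamma>0_def ht_neg)
  have \<gamma>0: "\<gamma>0 \<in> unit_roots W" using \<gamma> neg by (simp add: \<gamma>0_def)
  define Orb where "Orb = {f \<gamma>0 |f. f \<in> ?G \<and> 0 < ht (f \<gamma>0)}"
  have "finite ((\<lambda>f. f \<gamma>0) ` ?G)" using finite_subset[OF GW finite_W] by simp
  then have finO: "finite Orb" by (rule finite_subset[rotated]) (auto simp: Orb_def)
  have "id \<gamma>0 \<in> Orb" unfolding Orb_def using pos0
    by (intro CollectI exI[of _ id] conjI refl id_in_words) simp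
  then have neO: "Orb \<noteq> {}" by blast
  have "Min (ht ` Orb) \<in> ht ` Orb" using finO neO by (intro Min_in) auto
  then obtain \<beta> where \<beta>: "\<beta> \<in> Orb" "ht \<beta> = Min (ht ` Orb)" by auto
  have \<beta>_min: "ht \<beta> \<le> ht \<beta>'" if "\<beta>' \<in> Orb" for \<beta>'
    unfolding \<beta>(2) using finO that by (intro Min_le) auto
  obtain f where f: "f \<in> ?G" "\<beta> = f \<gamma>0" "0 < ht \<beta>" using \<beta>(1) by (auto simp: Orb_def)
  have r\<beta>: "\<beta> \<in> unit_roots W" unfolding f(2) using root[OF \<gamma>0] f(1) GW by blast
  have nonneg: "0 \<le> \<beta> \<bullet> \<omega> \<alpha>" if "\<alpha> \<in> \<Delta>" for \<alpha>
  proof (rule ccontr)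
    assume "\<not> 0 \<le> \<beta> \<bullet> \<omega> \<alpha>"
    then have "\<forall>\<alpha>\<in>\<Delta>. \<beta> \<bullet> \<omega> \<alpha> \<le> 0" using root_expansion(2)[OF r\<beta>] that by blast
    then have "ht \<beta> \<le> 0" unfolding ht_def by (intro sum_nonpos) auto
    then show False using f(3) by simp
  qed
  have "\<exists>\<alpha>\<in>\<Delta>. 0 < (\<beta> \<bullet> \<omega> \<alpha>) * (\<alpha> \<bullet> \<beta>)"
  proof (rule ccontr)
    assume "\<not> ?thesis"
    then have "(\<Sum>\<alpha>\<in>\<Delta>. (\<beta> \<bullet> \<omega> \<alpha>) * (\<alpha> \<bullet> \<beta>)) \<le> 0" by (intro sum_nonpos) (auto simp: not_less)
    moreover have "(\<Sum>\<alpha>\<in>\<Delta>. (\<beta> \<bullet> \<omega> \<alpha>) * (\<alpha> \<bullet> \<beta>)) = (\<Sum>\<alpha>\<in>\<Delta>. (\<beta> \<bullet> \<omega> \<alpha>) *\<^sub>R \<alpha>) \<bullet> \<beta>"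
      by (simp add: inner_sum_left)
    moreover have "(\<Sum>\<alpha>\<in>\<Delta>. (\<beta> \<bullet> \<omega> \<alpha>) *\<^sub>R \<alpha>) = \<beta>" by (rule root_expansion(1)[OF r\<beta>])
    moreover have "\<beta> \<bullet> \<beta> = 1" using r\<beta> by (simp add: unit_roots_def dot_square_norm)
    ultimately show False by simp
  qed
  then obtain \<alpha> where \<alpha>: "\<alpha> \<in> \<Delta>" "0 < (\<beta> \<bullet> \<omega> \<alpha>) * (\<alpha> \<bullet> \<beta>)" by blast
  have \<alpha>pos: "0 < \<alpha> \<bullet> \<beta>" "0 < \<beta> \<bullet> \<omega> \<alpha>"
    using \<alpha>(2) nonneg[OF \<alpha>(1)] by (auto simp: zero_less_mult_iff)
  define \<beta>' where "\<beta>' = reflect_along \<alpha> \<beta>"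
  have \<beta>': "\<beta>' = \<beta> - (2 * (\<alpha> \<bullet> \<beta>)) *\<^sub>R \<alpha>"
    using norm_\<Delta>[OF \<alpha>(1)] by (simp add: \<beta>'_def reflect_along_def dot_square_norm inner_commute)
  have r\<beta>': "\<beta>' \<in> unit_roots W" unfolding \<beta>'_def using root[OF r\<beta>] reflect_\<Delta>[OF \<alpha>(1)] by blast
  have "ht \<alpha> = 1" using ht_\<Delta>[OF \<alpha>(1)] .
  moreover have "ht \<beta>' = ht \<beta> - 2 * (\<alpha> \<bullet> \<beta>) * ht \<alpha>"
    by (simp add: \<beta>' ht_def inner_diff_left sum_subtractf sum_distrib_left)
  ultimately have "ht \<beta>' < ht \<beta>" using \<alpha>pos by simp
  then have "\<beta>' \<notin> Orb" using \<beta>_min[of \<beta>'] by auto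
  moreover have tf: "reflect_along \<alpha> \<circ> f \<in> ?G" using words_comp[OF words_base f(1)] \<alpha>(1) by blast
  moreover have "\<beta>' = (reflect_along \<alpha> \<circ> f) \<gamma>0" by (simp add: \<beta>'_def f(2))
  ultimately have "\<not> 0 < ht \<beta>'" unfolding Orb_def by blast
  have nonpos: "\<beta>' \<bullet> \<omega> \<delta> \<le> 0" if "\<delta> \<in> \<Delta>" for \<delta>
  proof (rule ccontr)
    assume *: "\<not> \<beta>' \<bullet> \<omega> \<delta> \<le> 0"
    then have "\<forall>\<alpha>\<in>\<Delta>. 0 \<le> \<beta>' \<bullet> \<omega> \<alpha>" using root_expansion(2)[OF r\<beta>'] that by blast
    then have "0 \<le> ht \<beta>'" unfolding ht_def by (intro sum_nonneg) auto
    then show False using \<open>\<not> 0 < ht \<beta>'\<close> nz[OF r\<beta>'] by simp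
  qed
  have "\<beta> \<bullet> \<omega> \<delta> = 0" if "\<delta> \<in> \<Delta>" "\<delta> \<noteq> \<alpha>" for \<delta>
    using nonpos[OF that(1)] nonneg[OF that(1)] inner_\<omega>[OF that(1) \<alpha>(1)] that(2)
    by (simp add: \<beta>' inner_diff_left)
  then have "(\<Sum>\<delta>\<in>\<Delta>. (\<beta> \<bullet> \<omega> \<delta>) *\<^sub>R \<delta>) = (\<Sum>\<delta>\<in>\<Delta>. if \<delta> = \<alpha> then (\<beta> \<bullet> \<omega> \<alpha>) *\<^sub>R \<alpha> else 0)"
    by (intro sum.cong) auto
  then have \<beta>\<alpha>: "\<beta> = (\<beta> \<bullet> \<omega> \<alpha>) *\<^sub>R \<alpha>" unfolding root_expansion(1)[OF r\<beta>] using finite_\<Delta> \<alpha>(1) by simp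
  have "norm \<beta> = \<bar>\<beta> \<bullet> \<omega> \<alpha>\<bar> * norm \<alpha>" by (subst \<beta>\<alpha>) (rule norm_scaleR)
  then have "\<beta> \<bullet> \<omega> \<alpha> = 1" using r\<beta> norm_\<Delta>[OF \<alpha>(1)] \<alpha>pos(2) by (simp add: unit_roots_def)
  then have "f \<gamma>0 = \<alpha>" using \<beta>\<alpha> f(2) by (metis scaleR_one)
  then show ?thesis using f(1) \<alpha>(1) by (auto simp: \<gamma>0_def split: if_splits)
qed

text \<open>Every reflection is conjugate to a simple one by simple reflections, and
  \<open>W\<close> is generated by its reflections.\<close>

lemma simple_reflections_generate: "words (reflect_along ` \<Delta>) = W"
proof
  let ?G = "words (reflect_along ` \<Delta>)"
  note refl = reflections_\<Delta>[OF order_refl]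
  show "?G \<subseteq> W" using words_reflections_in_W[OF refl] .
  have "t \<in> ?G" if t: "t \<in> reflections W" for t
  proof -
    obtain a where a: "t = reflect_along a" "a \<noteq> 0" "t \<in> W" using t by (auto simp: reflections_def)
    define \<gamma> where "\<gamma> = a /\<^sub>R norm a"
    have t\<gamma>: "reflect_along \<gamma> = t" unfolding \<gamma>_def a(1) using a(2) by (intro reflect_along_scaleR) simp
    then have "\<gamma> \<in> unit_roots W" using a by (simp add: unit_roots_def \<gamma>_def)
    then obtain f \<gamma>' where f: "f \<in> ?G" "f \<gamma>' \<in> \<Delta>" "\<gamma>' = \<gamma> \<or> \<gamma>' = - \<gamma>"
      using simple_reflections_reach_root by blast
    have t\<gamma>': "reflect_along \<gamma>' = t" using f(3) t\<gamma> reflect_along_scaleR[of "- 1" \<gamma>] by auto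
    obtain f' where f': "f' \<in> ?G" "f' \<circ> f = id"
      using words_inverse[OF reflections_involution[OF subsetD[OF refl]] f(1)] by blast
    have "reflect_along (f' (f \<gamma>')) \<in> ?G"
      using words_conj_reflection[OF refl f'(1)] f(2) words_base by blast
    then show ?thesis using f'(2) t\<gamma>' by (metis comp_apply id_apply)
  qed
  then have "words (reflections W) \<subseteq> ?G" by (intro words_subset) blast
  moreover have "W \<subseteq> words (reflections W)" 
    using W_reflection_word wordsI by blast
  ultimately show "W \<subseteq> ?G" by blast
qed

end

locale simple_frame = signed_frame W X
  for W :: "('a::euclidean_space \<Rightarrow> 'a) set" and X :: "'a set" +
  fixes \<Delta> :: "'a set" and \<omega> :: "'a \<Rightarrow> 'a"
  assumes simple: "simple_system W \<Delta>" and dual: "dual_basis \<Delta> \<omega>"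
begin

sublocale simple_roots W X \<Delta> \<omega>
  by unfold_locales (rule simple, rule dual)

lemma diff_expansion:
  assumes "p \<in> X" "q \<in> X"
  shows "p - q = (\<Sum>\<alpha>\<in>\<Delta>. ((p - q) \<bullet> \<omega> \<alpha>) *\<^sub>R \<alpha>)"
    and "(\<forall>\<alpha>\<in>\<Delta>. 0 \<le> (p - q) \<bullet> \<omega> \<alpha>) \<or> (\<forall>\<alpha>\<in>\<Delta>. (p - q) \<bullet> \<omega> \<alpha> \<le> 0)"
proof -
  have "p - q = (\<Sum>\<alpha>\<in>\<Delta>. ((p - q) \<bullet> \<omega> \<alpha>) *\<^sub>R \<alpha>) \<and>
    ((\<forall>\<alpha>\<in>\<Delta>. 0 \<le> (p - q) \<bullet> \<omega> \<alpha>) \<or> (\<forall>\<alpha>\<in>\<Delta>. (p - q) \<bullet> \<omega> \<alpha> \<le> 0))"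
  proof (cases "p = q")
    case False
    define n where "n = norm (p - q)"
    have n: "0 < n" using False by (simp add: n_def)
    define \<beta> where "\<beta> = (p - q) /\<^sub>R n"
    have \<beta>: "\<beta> \<in> unit_roots W"
      unfolding \<beta>_def n_def by (rule unit_root_diff[OF assms False])
    have pq: "p - q = n *\<^sub>R \<beta>" using n by (simp add: \<beta>_def)
    have "(\<Sum>\<alpha>\<in>\<Delta>. ((p - q) \<bullet> \<omega> \<alpha>) *\<^sub>R \<alpha>) = n *\<^sub>R (\<Sum>\<alpha>\<in>\<Delta>. (\<beta> \<bullet> \<omega> \<alpha>) *\<^sub>R \<alpha>)"
      unfolding pq by (simp add: scaleR_sum_right)
    also have "\<dots> = p - q" unfolding root_expansion(1)[OF \<beta>] pq ..
    finally have "p - q = (\<Sum>\<alpha>\<in>\<Delta>. ((p - q) \<bullet> \<omega> \<alpha>) *\<^sub>R \<alpha>)" ..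
    moreover have "(\<forall>\<alpha>\<in>\<Delta>. 0 \<le> (p - q) \<bullet> \<omega> \<alpha>) \<or> (\<forall>\<alpha>\<in>\<Delta>. (p - q) \<bullet> \<omega> \<alpha> \<le> 0)"
      unfolding pq using root_expansion(2)[OF \<beta>] n by (simp add: zero_le_mult_iff mult_le_0_iff)
    ultimately show ?thesis by blast
  qed simp
  then show "p - q = (\<Sum>\<alpha>\<in>\<Delta>. ((p - q) \<bullet> \<omega> \<alpha>) *\<^sub>R \<alpha>)"
    "(\<forall>\<alpha>\<in>\<Delta>. 0 \<le> (p - q) \<bullet> \<omega> \<alpha>) \<or> (\<forall>\<alpha>\<in>\<Delta>. (p - q) \<bullet> \<omega> \<alpha> \<le> 0)" by blast+
qed

text \<open>The coefficients of a difference all have one sign, so their sum decides it.\<close>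

lemma coefficient_nonneg:
  assumes "p \<in> X" "q \<in> X" "ht q \<le> ht p" "\<alpha> \<in> \<Delta>"
  shows "0 \<le> (p - q) \<bullet> \<omega> \<alpha>"
proof (rule ccontr)
  assume neg: "\<not> 0 \<le> (p - q) \<bullet> \<omega> \<alpha>"
  then have "\<forall>\<alpha>\<in>\<Delta>. (p - q) \<bullet> \<omega> \<alpha> \<le> 0" using diff_expansion(2)[OF assms(1,2)] assms(4) by blast
  then have "ht (p - q) < (\<Sum>\<alpha>\<in>\<Delta>. 0)" unfolding ht_def
    using neg assms(4) finite_\<Delta> by (intro sum_strict_mono_ex1 bexI[of _ \<alpha>]) auto
  then show False using assms(3) by (simp add: ht_diff)
qed

lemma inj_ht: "inj_on ht X"
proof (rule inj_onI)
  fix p q assume pq: "p \<in> X" "q \<in> X" "ht p = ht q"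
  have "(p - q) \<bullet> \<omega> \<alpha> = 0" if "\<alpha> \<in> \<Delta>" for \<alpha>
    using coefficient_nonneg[OF pq(1,2) _ that] coefficient_nonneg[OF pq(2,1) _ that] pq(3)
    by (simp add: inner_diff_left)
  then have "p - q = 0" using diff_expansion(1)[OF pq(1,2)] by simp
  then show "p = q" by simp
qed

end

text \<open>Here \<open>g\<close> enumerates the orbit by decreasing height; the enumeration along
  \<open>c\<close> in \<open>coxeter_orbit\<close> is a different one.\<close>

locale simple_chain = simple_frame W X \<Delta> \<omega>
  for W :: "('a::euclidean_space \<Rightarrow> 'a) set" and X :: "'a set" and \<Delta> \<omega> +
  fixes g :: "nat \<Rightarrow> 'a" and h :: nat
  assumes bij_g: "bij_betw g {..<h} X" and ht_g: "i < j \<Longrightarrow> j < h \<Longrightarrow> ht (g j) < ht (g i)"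
begin

definition symmetric :: bool where
  "symmetric \<longleftrightarrow> (\<forall>p\<in>X. - p \<in> X)"

lemma g_X: "i < h \<Longrightarrow> g i \<in> X"
  using bij_g by (auto simp: bij_betw_def)

lemma X_g: "p \<in> X \<Longrightarrow> \<exists>i<h. p = g i"
  using bij_g by (auto simp: bij_betw_def)

lemma card_X: "card X = h"
  using bij_betw_same_card[OF bij_g] by simp

lemma g_eq_iff: "i < h \<Longrightarrow> j < h \<Longrightarrow> g i = g j \<longleftrightarrow> i = j"
  using bij_g by (auto simp: bij_betw_def inj_on_def)

lemma ht_g_iff: "i < h \<Longrightarrow> j < h \<Longrightarrow> ht (g j) < ht (g i) \<longleftrightarrow> i < j"
  using ht_g[of i j] ht_g[of j i] by (metis less_asym' linorder_neqE_nat less_irrefl)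

text \<open>Negation reverses the order by height; counting the points above \<open>- g i\<close>
  gives its index.\<close>

lemma neg_g:
  assumes symmetric "i < h"
  shows "- g i = g (h - 1 - i)"
proof -
  obtain j where j: "j < h" "- g i = g j" using assms X_g g_X unfolding symmetric_def by blast
  have inj: "inj_on g A" if "A \<subseteq> {..<h}" for A
    using bij_g that inj_on_subset by (auto simp: bij_betw_def)
  have "{q \<in> X. ht (g j) < ht q} = g ` {..<j}"
    using X_g g_X j ht_g_iff by fastforce
  then have 1: "card {q \<in> X. ht (g j) < ht q} = j"
    using inj[of "{..<j}"] j by (simp add: card_image)
  have "{q \<in> X. ht (- g i) < ht q} = uminus ` {q \<in> X. ht q < ht (g i)}"
    using assms(1) by (force simp: ht_neg symmetric_def)
  also have "{q \<in> X. ht q < ht (g i)} = g ` {i<..<h}"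
    using X_g g_X assms(2) ht_g_iff by fastforce
  finally have "card {q \<in> X. ht (- g i) < ht q} = card (uminus ` g ` {i<..<h})" by simp
  also have "\<dots> = card (g ` {i<..<h})" by (rule card_image) (auto simp: inj_on_def)
  also have "\<dots> = card {i<..<h}" by (rule card_image, rule inj) auto
  finally have "card {q \<in> X. ht (- g i) < ht q} = card {i<..<h}" .
  then have "j = h - 1 - i" using 1 j by simp
  then show ?thesis using j by simp
qed

lemma even_h: "symmetric \<Longrightarrow> even h"
proof (rule ccontr)
  assume s: symmetric and "odd h"
  then obtain k where k: "h = Suc (2 * k)" by (metis oddE Suc_eq_plus1)
  then have "- g k = g k" using neg_g[OF s, of k] by simp
  then show False using neg_neq_X[OF g_X, of k] k by simp
qed

lemma inner_g:
  assumes "i < h" "j < h"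
  shows "g i \<bullet> g j = (if i = j then 1 else if symmetric \<and> i + j + 1 = h then - 1 else 0)"
proof -
  have "g i = - g j \<longleftrightarrow> symmetric \<and> i + j + 1 = h"
  proof
    assume e: "g i = - g j"
    then have s: symmetric using assms g_X neg_mem_X unfolding symmetric_def by metis
    then have "g i = g (h - 1 - j)" using e neg_g assms by simp
    then show "symmetric \<and> i + j + 1 = h" using s assms g_eq_iff by auto
  next
    assume "symmetric \<and> i + j + 1 = h"
    then show "g i = - g j" using neg_g[of j] assms by auto
  qed
  then show ?thesis using inner_X[OF g_X g_X] assms g_eq_iff by simp
qed

definition \<delta> :: "nat \<Rightarrow> 'a" where
  "\<delta> j = g j - g (Suc j)"

lemma \<delta>_nonzero: "Suc j < h \<Longrightarrow> \<delta> j \<noteq> 0"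
  using g_eq_iff[of j "Suc j"] by (simp add: \<delta>_def)

text \<open>In the symmetric case each link occurs at two mirrored positions, except the middle one.
  Later statements therefore compare values of \<open>\<delta>\<close> instead of indices.\<close>

lemma \<delta>_mirror:
  assumes symmetric "Suc j < h"
  shows "\<delta> (h - 2 - j) = \<delta> j"
proof -
  have "h - 2 - j = h - 1 - Suc j" "Suc (h - 2 - j) = h - 1 - j" using assms(2) by simp_all
  then have "g (h - 2 - j) = - g (Suc j)" "g (Suc (h - 2 - j)) = - g j"
    using neg_g[OF assms(1), of j] neg_g[OF assms] assms(2) by simp_all
  then show ?thesis by (simp add: \<delta>_def)
qed

lemma \<delta>_meets_g:
  assumes "Suc j < h" "i < h" "g i \<bullet> \<delta> j \<noteq> 0"
  shows "(Suc i < h \<and> \<delta> j = \<delta> i) \<or> (\<exists>k. i = Suc k \<and> \<delta> j = \<delta> k)"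
proof -
  have "g i \<bullet> g j \<noteq> 0 \<or> g i \<bullet> g (Suc j) \<noteq> 0" using assms(3) by (auto simp: \<delta>_def inner_diff_right)
  then consider "i = j" | "i = Suc j" | "symmetric" "i + j + 1 = h" | "symmetric" "i + j + 2 = h"
    using inner_g[of i j] inner_g[of i "Suc j"] assms by (auto split: if_splits)
  then show ?thesis
  proof cases
    case 3
    then obtain k where k: "i = Suc k" using assms by (cases i) auto
    then have "h - 2 - j = k" using 3 by simp
    then show ?thesis using \<delta>_mirror[OF 3(1) assms(1)] k by auto
  next
    case 4
    then have "h - 2 - j = i" "Suc i < h" using assms by auto
    then show ?thesis using \<delta>_mirror[OF 4(1) assms(1)] by auto
  qed (use assms in auto)
qed

text \<open>These partial sums act as fundamental weights: up to scaling, \<open>\<gamma> j\<close>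
  is dual to the simple root \<open>u j\<close> and orthogonal to the others, and its inner products
  with the orbit are explicit.\<close>

definition \<gamma> :: "nat \<Rightarrow> 'a" where
  "\<gamma> j = (\<Sum>l\<le>j. g l)"

lemma inner_\<gamma>_g:
  assumes "j < h" "i < h"
  shows "\<gamma> j \<bullet> g i = of_bool (i \<le> j) - of_bool (symmetric \<and> h - 1 - i \<le> j)"
proof -
  have ne: "i \<noteq> h - 1 - i" if symmetric
  proof
    assume "i = h - 1 - i"
    then have "h = Suc (2 * i)" using assms by linarith
    then show False using even_h[OF that] by simp
  qed
  have "\<gamma> j \<bullet> g i = (\<Sum>l\<le>j. of_bool (l = i) - of_bool (symmetric \<and> l = h - 1 - i))"
    unfolding \<gamma>_def inner_sum_left
  proof (rule sum.cong)
    fix l assume "l \<in> {..j}"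
    then have "l < h" using assms by simp
    moreover have "l + i + 1 = h \<longleftrightarrow> l = h - 1 - i" using assms by auto
    ultimately show "g l \<bullet> g i = of_bool (l = i) - of_bool (symmetric \<and> l = h - 1 - i)"
      using inner_g[of l i] assms ne by auto
  qed simp
  also have "\<dots> = of_bool (i \<le> j) - of_bool (symmetric \<and> h - 1 - i \<le> j)"
    by (cases symmetric) (simp_all add: sum_subtractf of_bool_def)
  finally show ?thesis .
qed

lemma inner_\<gamma>_\<delta>:
  assumes "Suc j < h" "Suc i < h"
  shows "\<gamma> j \<bullet> \<delta> i = of_bool (i = j) + of_bool (symmetric \<and> i + j + 2 = h)"
proof -
  have "i \<le> j \<longleftrightarrow> i = j \<or> Suc i \<le> j" by auto
  moreover have "h - 1 - Suc i \<le> j \<longleftrightarrow> h - 1 - i \<le> j \<or> i + j + 2 = h" using assms by auto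
  moreover have "\<not> (h - 1 - i \<le> j \<and> i + j + 2 = h)" "\<not> (i = j \<and> Suc i \<le> j)" using assms by auto
  ultimately show ?thesis
    using inner_\<gamma>_g[of j i] inner_\<gamma>_g[of j "Suc i"] assms
    by (auto simp: \<delta>_def inner_diff_right)
qed

lemma \<gamma>_orthogonal_\<delta>:
  assumes "Suc j < h" "Suc i < h" "\<delta> i \<noteq> \<delta> j"
  shows "\<gamma> j \<bullet> \<delta> i = 0"
proof -
  have "i \<noteq> j" using assms by auto
  moreover have "\<not> (symmetric \<and> i + j + 2 = h)"
  proof
    assume *: "symmetric \<and> i + j + 2 = h"
    then have "h - 2 - j = i" by auto
    then show False using \<delta>_mirror[of j] * assms by auto
  qed
  ultimately show ?thesis using inner_\<gamma>_\<delta>[OF assms(1,2)] by simp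
qed

lemma \<gamma>_\<delta>_pos: "Suc j < h \<Longrightarrow> 0 < \<gamma> j \<bullet> \<delta> j"
  using inner_\<gamma>_\<delta>[of j j] by simp

definition u :: "nat \<Rightarrow> 'a" where
  "u j = \<delta> j /\<^sub>R norm (\<delta> j)"

text \<open>A simple root is a positive multiple of some \<open>p - q\<close>. A point
  \<open>r\<close> of intermediate height would split it into two nonnegative combinations, both
  multiples of that root, making \<open>p\<close>, \<open>q\<close>, \<open>r\<close> collinear on a
  sphere. Conversely, if \<open>u j\<close> were missing, \<open>\<gamma> j\<close> would be
  orthogonal to all simple roots but not to \<open>\<delta> j\<close>.\<close>

lemma \<Delta>_eq: "\<Delta> = u ` {j. Suc j < h}"
proof
  show "\<Delta> \<subseteq> u ` {j. Suc j < h}"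
  proof
    fix \<alpha> assume \<alpha>: "\<alpha> \<in> \<Delta>"
    obtain p q k where pq: "p \<in> X" "q \<in> X" "p \<noteq> q" "k > 0" "\<alpha> = k *\<^sub>R (p - q)"
    proof -
      obtain p q k where *: "p \<in> X" "q \<in> X" "p \<noteq> q" "k \<noteq> 0" "\<alpha> = k *\<^sub>R (p - q)"
        using root_parallel_diff[OF reflect_\<Delta>[OF \<alpha>] \<Delta>_nonzero[OF \<alpha>]] .
      show ?thesis
      proof (cases "k > 0")
        case True
        then show ?thesis using that * by blast
      next
        case False
        have "\<alpha> = (- k) *\<^sub>R (q - p)" by (simp add: *(5) algebra_simps)
        then show ?thesis using that[of q p "- k"] * False by auto
      qed
    qed
    have "ht \<alpha> = k * (ht p - ht q)"
      by (simp add: pq(5) ht_def sum_distrib_left inner_diff_left sum_subtractf right_diff_distrib)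
    then have lt: "ht q < ht p" using ht_\<Delta>[OF \<alpha>] pq(4) by (smt (verit) mult_nonneg_nonpos)
    obtain a b where ab: "a < h" "p = g a" "b < h" "q = g b" using X_g pq by metis
    have "a < b" using lt ab ht_g_iff by blast
    have "b = Suc a"
    proof (rule ccontr)
      assume "b \<noteq> Suc a"
      then have sa: "Suc a < b" using \<open>a < b\<close> by simp
      define r where "r = g (Suc a)"
      have r: "r \<in> X" "r \<noteq> p" "r \<noteq> q" using sa ab g_X g_eq_iff by (auto simp: r_def)
      have pos: "0 \<le> (p - r) \<bullet> \<omega> \<beta>" "0 \<le> (r - q) \<bullet> \<omega> \<beta>" if "\<beta> \<in> \<Delta>" for \<beta>
        using coefficient_nonneg[OF pq(1) r(1) _ that] coefficient_nonneg[OF r(1) pq(2) _ that]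
          ht_g[of a "Suc a"] ht_g[of "Suc a" b] sa ab by (auto simp: r_def)
      have "(p - r) \<bullet> \<omega> \<beta> = 0" if "\<beta> \<in> \<Delta>" "\<beta> \<noteq> \<alpha>" for \<beta>
      proof -
        have "k * ((p - q) \<bullet> \<omega> \<beta>) = 0" using inner_\<omega>[OF that(1) \<alpha>] that(2) by (simp add: pq(5))
        then have "(p - q) \<bullet> \<omega> \<beta> = 0" using pq(4) by simp
        then show ?thesis using pos[OF that(1)] by (simp add: inner_diff_left)
      qed
      then have "(\<Sum>\<beta>\<in>\<Delta>. ((p - r) \<bullet> \<omega> \<beta>) *\<^sub>R \<beta>) = (\<Sum>\<beta>\<in>\<Delta>. if \<beta> = \<alpha> then ((p - r) \<bullet> \<omega> \<alpha>) *\<^sub>R \<alpha> else 0)"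
        by (intro sum.cong) auto
      then have "p - r = ((p - r) \<bullet> \<omega> \<alpha>) *\<^sub>R \<alpha>"
        using diff_expansion(1)[OF pq(1) r(1)] finite_\<Delta> \<alpha> by simp
      then have "p - r = (((p - r) \<bullet> \<omega> \<alpha>) * k) *\<^sub>R (p - q)" by (simp add: pq(5))
      then show False
        using sphere_not_collinear[of q p r] norm_X pq(1-3) r by metis
    qed
    then have \<alpha>\<delta>: "\<alpha> = k *\<^sub>R \<delta> a" using pq(5) ab by (simp add: \<delta>_def)
    then have "1 = k * norm (\<delta> a)" using norm_\<Delta>[OF \<alpha>] pq(4) by simp
    then have "\<alpha> = u a" unfolding u_def \<alpha>\<delta> by (simp add: inverse_unique mult.commute)
    then show "\<alpha> \<in> u ` {j. Suc j < h}" using ab \<open>b = Suc a\<close> by blast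
  qed
  show "u ` {j. Suc j < h} \<subseteq> \<Delta>"
  proof clarify
    fix j assume j: "Suc j < h"
    show "u j \<in> \<Delta>"
    proof (rule ccontr)
      assume n: "u j \<notin> \<Delta>"
      have "\<gamma> j \<bullet> \<beta> = 0" if \<beta>: "\<beta> \<in> \<Delta>" for \<beta>
      proof -
        obtain i where i: "Suc i < h" "\<beta> = u i" using \<beta> \<open>\<Delta> \<subseteq> u ` {j. Suc j < h}\<close> by blast
        then have "\<delta> i \<noteq> \<delta> j" using n \<beta> by (auto simp: u_def)
        then show ?thesis using \<gamma>_orthogonal_\<delta>[OF j i(1)] by (simp add: i u_def)
      qed
      then have "\<gamma> j \<bullet> (\<Sum>\<beta>\<in>\<Delta>. (\<delta> j \<bullet> \<omega> \<beta>) *\<^sub>R \<beta>) = 0" by (simp add: inner_sum_right)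
      then have "\<gamma> j \<bullet> \<delta> j = 0"
        using diff_expansion(1)[of "g j" "g (Suc j)"] g_X j by (simp add: \<delta>_def)
      then show False using \<gamma>_\<delta>_pos[OF j] by simp
    qed
  qed
qed

end

subsection \<open>Parabolic subgroups of chains\<close>

context simple_chain
begin

lemma \<Delta>_E:
  assumes "\<alpha> \<in> \<Delta>"
  obtains j where "Suc j < h" "\<alpha> = u j"
  using assms \<Delta>_eq by auto

lemma u_\<Delta>: "Suc j < h \<Longrightarrow> u j \<in> \<Delta>"
  using \<Delta>_eq by auto

lemma reflect_u:
  assumes "Suc j < h"
  shows "reflect_along (u j) = reflect_along (g j - g (Suc j))"
  using \<delta>_nonzero[OF assms] unfolding u_def \<delta>_def by (intro reflect_along_scaleR) simp

text \<open>Without \<open>u j\<close> every generator fixes \<open>\<gamma> j\<close>, whose inner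
  product distinguishes \<open>g a\<close> from \<open>g b\<close>.\<close>

lemma orbit_joined:
  assumes J: "J \<subseteq> \<Delta>" and o: "g b \<in> orbit_of (words (reflect_along ` J)) (g a)" "a \<le> j" "j < b" "b < h"
  shows "u j \<in> J"
proof (rule ccontr)
  assume n: "u j \<notin> J"
  obtain f where f: "f \<in> words (reflect_along ` J)" "g b = f (g a)"
    using o(1) by (auto simp: orbit_of_def)
  obtain ts where ts: "f = word_prod ts" "set ts \<subseteq> reflect_along ` J"
    using f(1) by (auto simp: words_def)
  have "t (\<gamma> j) = \<gamma> j" if t: "t \<in> set ts" for t
  proof -
    obtain \<alpha> where \<alpha>: "\<alpha> \<in> J" "t = reflect_along \<alpha>" using t ts(2) by blast
    obtain i where i: "Suc i < h" "\<alpha> = u i" using \<Delta>_E \<alpha>(1) J by blast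
    have "\<delta> i \<noteq> \<delta> j" using n \<alpha>(1) i(2) by (auto simp: u_def)
    then have "\<gamma> j \<bullet> \<delta> i = 0" using \<gamma>_orthogonal_\<delta>[of j i] i o by simp
    then show ?thesis unfolding \<alpha>(2) i(2) by (intro reflect_along_orthogonal) (simp add: u_def)
  qed
  then have "f (\<gamma> j) = \<gamma> j" unfolding ts(1) by (rule word_prod_fixes)
  moreover have "orthogonal_transformation f"
    using f(1) words_reflections_in_W[OF reflections_\<Delta>[OF J]] W_orthogonal by blast
  ultimately have "\<gamma> j \<bullet> g b = \<gamma> j \<bullet> g a"
    unfolding f(2) by (metis orthogonal_transformation_def)
  \<comment> \<open>The contributions of the mirrored points. \<open>A \<le> B\<close>, since the
    mirror image of the lower point \<open>g b\<close> stands higher than that of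
    \<open>g a\<close>; so \<open>1 - A\<close> cannot equal \<open>- B\<close>.\<close>
  moreover define A B :: real where "A = of_bool (symmetric \<and> h - 1 - a \<le> j)"
    and "B = of_bool (symmetric \<and> h - 1 - b \<le> j)"
  have "A \<le> B" using o by (auto simp: A_def B_def of_bool_def)
  moreover have "\<gamma> j \<bullet> g a = 1 - A" "\<gamma> j \<bullet> g b = - B"
    using inner_\<gamma>_g[of j a] inner_\<gamma>_g[of j b] o by (simp_all add: A_def B_def)
  ultimately show False by linarith
qed

lemma joined_reflection:
  assumes J: "J \<subseteq> \<Delta>" and "a < b" "b < h" "\<And>j. a \<le> j \<Longrightarrow> j < b \<Longrightarrow> u j \<in> J"
  shows "reflect_along (g a - g b) \<in> words (reflect_along ` J)"
  using assms(2-)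
proof (induction "b - a" arbitrary: a b rule: less_induct)
  case less
  let ?G = "words (reflect_along ` J)"
  note conj = words_conj_reflection[OF reflections_\<Delta>[OF J]]
  have step: "reflect_along (g j - g (Suc j)) \<in> ?G" if "a \<le> j" "j < b" for j
    using less.prems that reflect_u[of j] by (intro words_base) (auto intro!: image_eqI[of _ _ "u j"])
  have lin: "reflect_along v (x - y) = reflect_along v x - reflect_along v y" for v x y :: 'a
    by (rule linear_diff[OF linear_reflect_along])
  show ?case
  proof (cases "b = Suc a")
    case True
    then show ?thesis using step[of a] by simp
  next
    case False
    then obtain b' where b: "b = Suc b'" "a < b'" using less.prems by (metis less_imp_Suc_add not_less_eq Suc_lessI lessE)
    note t = reflect_diff_X[OF g_X g_X _ g_X, of b' b]
    \<comment> \<open>The usual step conjugates a shorter reflection by the last link, which fails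
      if that link also moves \<open>g a\<close>. If \<open>g b'\<close> is antipodal to
      \<open>g a\<close>, the first link is used instead; if \<open>g b\<close> is, the last link
      moves both ends at once and the range shrinks on both sides.\<close>
    consider "symmetric \<and> a + b' + 1 = h" | "symmetric \<and> a + b + 1 = h"
      | "\<not> (symmetric \<and> a + b' + 1 = h)" "\<not> (symmetric \<and> a + b + 1 = h)" by blast
    then show ?thesis
    proof cases
      case 1
      have IH: "reflect_along (g (Suc a) - g b) \<in> ?G"
        using less b by (intro less.hyps) auto
      have ga: "reflect_along (g a - g (Suc a)) (g (Suc a)) = g a"
        using reflect_along_swap'[of "g a" "g (Suc a)"] norm_X g_X less.prems by simp
      have "g b \<bullet> g a = 0" "g b \<bullet> g (Suc a) = 0"
        using inner_g[of b a] inner_g[of b "Suc a"] less.prems b 1 by auto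
      then have "reflect_along (g a - g (Suc a)) (g b) = g b"
        by (intro reflect_along_orthogonal) (simp add: inner_diff_right)
      then show ?thesis using conj[OF step[of a] IH] ga less.prems by (simp add: lin)
    next
      case 2
      then have m: "g a = - g b" "g (Suc a) = - g b'"
        using neg_g[of b] neg_g[of b'] less.prems b by auto
      have "Suc a < b'"
      proof (rule ccontr)
        assume "\<not> Suc a < b'"
        then have "b' = Suc a" using b by simp
        then have "h = 2 * a + 3" using 2 b by simp
        then show False using even_h 2 by (metis even_add even_mult_iff even_numeral odd_numeral)
      qed
      then have IH: "reflect_along (g (Suc a) - g b') \<in> ?G"
        using less b by (intro less.hyps) auto
      have "reflect_along (g b' - g b) (g b') = g b"
        using reflect_along_swap[of "g b'" "g b"] norm_X g_X less.prems b by simp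
      moreover have "reflect_along (g b' - g b) (- v) = - reflect_along (g b' - g b) v" for v
        by (rule linear_neg[OF linear_reflect_along])
      ultimately have "reflect_along (g b' - g b) (g (Suc a) - g b') = g a - g b"
        unfolding m by (simp add: lin)
      then show ?thesis using conj[OF step[of b'] IH] b by simp
    next
      case 3
      have IH: "reflect_along (g a - g b') \<in> ?G"
        using less b by (intro less.hyps) auto
      have gb: "reflect_along (g b' - g b) (g b') = g b"
        using reflect_along_swap[of "g b'" "g b"] norm_X g_X less.prems b by simp
      have "g a \<bullet> g b' = 0" "g a \<bullet> g b = 0"
        using inner_g[of a b'] inner_g[of a b] less.prems b 3 by auto
      then have "reflect_along (g b' - g b) (g a) = g a"
        by (intro reflect_along_orthogonal) (simp add: inner_diff_right)
      then show ?thesis using conj[OF step[of b'] IH] gb b by (simp add: lin)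
    qed
  qed
qed

text \<open>Sharing an orbit forces all links between the two points into \<open>J\<close>, and
  these links generate the exchange.\<close>

lemma standard_parabolic_full:
  assumes J: "J \<subseteq> \<Delta>" and pq: "p \<in> X" "q \<in> orbit_of (words (reflect_along ` J)) p" "p \<noteq> q"
  shows "reflect_along (p - q) \<in> words (reflect_along ` J)"
proof -
  have "q \<in> X" using pq(1,2) words_reflections_in_W[OF reflections_\<Delta>[OF J]] W_Y by (auto simp: orbit_of_def)
  then obtain a b where ab: "a < h" "p = g a" "b < h" "q = g b" using X_g pq(1) by metis
  have sym: "p \<in> orbit_of (words (reflect_along ` J)) q"
    using orbit_of_sym[OF _ pq(2)] reflections_involution reflections_\<Delta>[OF J] by blast
  show ?thesis
  proof (cases "a < b")
    case True
    then show ?thesis using joined_reflection[OF J True ab(3)] orbit_joined[OF J, of b a] pq(2) ab by blast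
  next
    case False
    then have "b < a" using pq(3) ab by (metis linorder_neqE_nat)
    then have "reflect_along (q - p) \<in> words (reflect_along ` J)"
      using joined_reflection[OF J _ ab(1)] orbit_joined[OF J, of a b] sym ab by blast
    then show ?thesis by (simp add: reflect_along_minus_commute)
  qed
qed

text \<open>Transport along \<open>w\<close> supplies the hypotheses of
  \<open>noncrossing_subgroup\<close> on \<open>R\<close>, apart from noncrossing itself.\<close>

lemma parabolic_full:
  assumes "parabolic W \<Delta> H"
  obtains R where "H = words R" "R \<subseteq> reflections W"
    "\<And>t. t \<in> R \<Longrightarrow> \<exists>p\<in>X. \<exists>q\<in>orbit_of (words R) p. p \<noteq> q \<and> t = reflect_along (p - q)"
    "\<And>p q. p \<in> X \<Longrightarrow> q \<in> orbit_of (words R) p \<Longrightarrow> p \<noteq> q \<Longrightarrow> reflect_along (p - q) \<in> words R"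
proof -
  obtain J w where J: "J \<subseteq> \<Delta>" and w: "w \<in> W"
    and H: "H = (\<lambda>f. w \<circ> f \<circ> inv_into UNIV w) ` words (reflect_along ` J)"
    using parabolicE[OF simple assms] .
  define R where "R = reflect_along ` w ` J"
  have R: "words R = (\<lambda>f. w \<circ> f \<circ> inv_into UNIV w) ` words (reflect_along ` J)"
    unfolding R_def conj_words[OF w] ..
  have wlin: "w (x - y) = w x - w y" for x y using linear_diff[OF W_linear[OF w]] .
  have iw: "w (inv_into UNIV w x) = x" "inv_into UNIV w (w x) = x" for x
    using inv_in_W(2,3)[OF w] by (metis comp_apply id_apply)+
  have conj: "w \<circ> reflect_along v \<circ> inv_into UNIV w = reflect_along (w v)" for v
    using reflect_along_conj[OF W_orthogonal[OF w]] iw(1) by (auto simp: fun_eq_iff)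
  have inR: "reflect_along (w v) \<in> words R" if "reflect_along v \<in> words (reflect_along ` J)" for v
    unfolding R conj[symmetric] using that by (rule imageI)
  have RW: "R \<subseteq> reflections W"
  proof
    fix t assume "t \<in> R"
    then obtain \<alpha> where \<alpha>: "\<alpha> \<in> J" "t = reflect_along (w \<alpha>)" by (auto simp: R_def)
    then have "w \<alpha> \<noteq> 0" using \<Delta>_nonzero J iw(2) linear_0[OF W_linear[OF w]] by (metis subsetD)
    moreover have "t \<in> W"
      unfolding \<alpha>(2) conj[symmetric] using reflect_\<Delta> \<alpha>(1) J w inv_in_W(1)[OF w] comp_in_W by blast
    ultimately show "t \<in> reflections W" using \<alpha>(2) unfolding reflections_eq by blast
  qed
  have "\<exists>p\<in>X. \<exists>q\<in>orbit_of (words R) p. p \<noteq> q \<and> t = reflect_along (p - q)" if t: "t \<in> R" for t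
  proof -
    obtain \<alpha> where \<alpha>: "\<alpha> \<in> J" "t = reflect_along (w \<alpha>)" using t by (auto simp: R_def)
    then obtain j where j: "Suc j < h" "\<alpha> = u j" using \<Delta>_E J by blast
    define p q where "p = w (g j)" and "q = w (g (Suc j))"
    have "t = w \<circ> reflect_along (u j) \<circ> inv_into UNIV w" unfolding \<alpha>(2) j(2) by (rule conj[symmetric])
    also have "\<dots> = reflect_along (w (g j - g (Suc j)))" unfolding reflect_u[OF j(1)] by (rule conj)
    finally have tpq: "t = reflect_along (p - q)" by (simp only: wlin p_def q_def)
    have pX: "p \<in> X" "q \<in> X" using W_Y[OF w] g_X j by (auto simp: p_def q_def)
    have "p \<noteq> q" using g_eq_iff[of j "Suc j"] iw(2) j by (metis p_def q_def n_not_Suc_n Suc_lessD)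
    moreover have "t p = q" unfolding tpq using reflect_along_swap norm_X pX by metis
    then have "q \<in> orbit_of (words R) p" using words_base[OF t] by (auto simp: orbit_of_def)
    ultimately show ?thesis using pX tpq by blast
  qed
  moreover have "reflect_along (p - q) \<in> words R"
    if pX: "p \<in> X" and q: "q \<in> orbit_of (words R) p" and ne: "p \<noteq> q" for p q
  proof -
    let ?p = "inv_into UNIV w p" and ?q = "inv_into UNIV w q"
    obtain f where f: "f \<in> words (reflect_along ` J)" "q = w (f ?p)"
      using q unfolding orbit_of_def R by auto
    then have "?q \<in> orbit_of (words (reflect_along ` J)) ?p" by (auto simp: orbit_of_def iw)
    moreover have "?p \<in> X" using W_Y[OF inv_in_W(1)[OF w] pX] .
    moreover have "?p \<noteq> ?q" using ne iw(1) by metis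
    ultimately have "reflect_along (?p - ?q) \<in> words (reflect_along ` J)"
      using standard_parabolic_full[OF J] by blast
    then show ?thesis using inR[of "?p - ?q"] by (simp add: wlin iw)
  qed
  ultimately show ?thesis using that[of R] H R RW by simp
qed

end

subsection \<open>The bipartition\<close>

lemma orthogonal_word:
  assumes "pairwise (\<lambda>\<alpha> \<beta>. \<alpha> \<bullet> \<beta> = 0) (set as)"
  shows "(\<And>\<beta>. \<beta> \<in> set as \<Longrightarrow> v \<bullet> \<beta> = 0) \<Longrightarrow> word_prod (map reflect_along as) v = v"
    and "distinct as \<Longrightarrow> \<alpha> \<in> set as \<Longrightarrow> (\<And>\<beta>. \<beta> \<in> set as \<Longrightarrow> \<beta> \<noteq> \<alpha> \<Longrightarrow> v \<bullet> \<beta> = 0) \<Longrightarrow>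
      word_prod (map reflect_along as) v = reflect_along \<alpha> v"
proof -
  have fixed: "word_prod (map reflect_along bs) x = x" if "\<And>\<beta>. \<beta> \<in> set bs \<Longrightarrow> x \<bullet> \<beta> = 0" for bs and x :: 'a
    by (rule word_prod_fixes) (use that reflect_along_orthogonal in auto)
  then show "(\<And>\<beta>. \<beta> \<in> set as \<Longrightarrow> v \<bullet> \<beta> = 0) \<Longrightarrow> word_prod (map reflect_along as) v = v" .
  assume d: "distinct as" "\<alpha> \<in> set as" and v: "\<And>\<beta>. \<beta> \<in> set as \<Longrightarrow> \<beta> \<noteq> \<alpha> \<Longrightarrow> v \<bullet> \<beta> = 0"
  obtain bs cs where as: "as = bs @ \<alpha> # cs" using split_list[OF d(2)] by blast
  have "word_prod (map reflect_along cs) v = v" using v d as by (intro fixed) auto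
  moreover have "word_prod (map reflect_along bs) (reflect_along \<alpha> v) = reflect_along \<alpha> v"
  proof (rule fixed)
    fix \<beta> assume "\<beta> \<in> set bs"
    then have "\<beta> \<in> set as" "\<beta> \<noteq> \<alpha>" using d as by auto
    then have "v \<bullet> \<beta> = 0" "\<alpha> \<bullet> \<beta> = 0" using v assms d(2) by (auto simp: pairwise_def)
    then show "reflect_along \<alpha> v \<bullet> \<beta> = 0" by (simp add: reflect_along_def inner_diff_left)
  qed
  ultimately show "word_prod (map reflect_along as) v = reflect_along \<alpha> v" by (simp add: as)
qed

locale bipartite_chain = simple_chain W X \<Delta> \<omega> g h
  for W :: "('a::euclidean_space \<Rightarrow> 'a) set" and X :: "'a set" and \<Delta> \<omega> g h +
  fixes \<Delta>p \<Delta>m :: "'a set"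
  assumes bipart: "bipartition \<Delta> \<Delta>p \<Delta>m" and h_ge: "3 \<le> h"
begin

lemma parts: "\<Delta> = \<Delta>p \<union> \<Delta>m" "\<Delta>p \<inter> \<Delta>m = {}"
  using bipart by (auto simp: bipartition_def)

lemma parts_orthogonal:
  assumes "D \<in> {\<Delta>p, \<Delta>m}"
  shows "pairwise (\<lambda>\<alpha> \<beta>. \<alpha> \<bullet> \<beta> = 0) D"
proof (rule pairwiseI)
  fix \<alpha> \<beta> assume ab: "\<alpha> \<in> D" "\<beta> \<in> D" "\<alpha> \<noteq> \<beta>"
  have "pairwise (\<lambda>\<alpha> \<beta>. reflect_along \<alpha> \<circ> reflect_along \<beta> = reflect_along \<beta> \<circ> reflect_along \<alpha>) D"
    using bipart assms unfolding bipartition_def by blast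
  then have "reflect_along \<alpha> \<circ> reflect_along \<beta> = reflect_along \<beta> \<circ> reflect_along \<alpha>"
    using ab by (rule pairwiseD)
  moreover have "\<alpha> \<in> \<Delta>" "\<beta> \<in> \<Delta>" using ab assms parts by auto
  ultimately show "\<alpha> \<bullet> \<beta> = 0"
    using commuting_reflections_orthogonal[of \<alpha> \<beta> "\<omega> \<alpha>"] norm_\<Delta> inner_\<omega> ab(3) by simp
qed

lemma adjacent_not_orthogonal:
  assumes "Suc (Suc j) < h"
  shows "u j \<bullet> u (Suc j) < 0"
proof -
  have "\<delta> j \<bullet> \<delta> (Suc j) < 0"
  proof -
    \<comment> \<open>Points two places apart in the chain are never antipodal, because
      \<open>h\<close> is even.\<close>
    have "\<not> (symmetric \<and> j + Suc (Suc j) + 1 = h)"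
      using even_h by (metis add_Suc_right even_Suc even_add add_Suc Suc_eq_plus1)
    then show ?thesis
      using inner_g[of j "Suc j"] inner_g[of j "Suc (Suc j)"] inner_g[of "Suc j" "Suc j"]
        inner_g[of "Suc j" "Suc (Suc j)"] assms
      by (auto simp: \<delta>_def inner_diff)
  qed
  then show ?thesis
    using \<delta>_nonzero[of j] \<delta>_nonzero[of "Suc j"] assms
    by (simp add: u_def mult_pos_neg zero_less_mult_iff mult_less_0_iff)
qed

text \<open>The part containing link \<open>j\<close>. It is defined by parity, so it also makes
  sense for the missing link \<open>h - 1\<close>.\<close>

definition par :: "nat \<Rightarrow> bool" where
  "par j \<longleftrightarrow> (even j \<longleftrightarrow> u 0 \<in> \<Delta>p)"

lemma par_Suc [simp]: "par (Suc j) \<longleftrightarrow> \<not> par j"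
  by (auto simp: par_def)

text \<open>Neighbouring links are not orthogonal, so they lie in different parts.\<close>

lemma u_parts:
  assumes "Suc j < h"
  shows "u j \<in> \<Delta>p \<longleftrightarrow> par j" "u j \<in> \<Delta>m \<longleftrightarrow> \<not> par j"
proof -
  have alt: "u j \<in> \<Delta>p \<longleftrightarrow> u j \<notin> \<Delta>m" if "Suc j < h" for j using parts u_\<Delta>[OF that] by blast
  show p: "u j \<in> \<Delta>p \<longleftrightarrow> par j"
    using assms
  proof (induction j)
    case 0
    then show ?case by (simp add: par_def)
  next
    case (Suc j)
    have "u j \<bullet> u (Suc j) < 0" using adjacent_not_orthogonal Suc.prems .
    moreover have "u j \<noteq> u (Suc j)" using calculation by (metis inner_ge_zero not_less)
    ultimately have "\<not> (u j \<in> D \<and> u (Suc j) \<in> D)" if "D \<in> {\<Delta>p, \<Delta>m}" for D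
      using pairwiseD[OF parts_orthogonal[OF that], of "u j" "u (Suc j)"] by auto
    then show ?case using Suc alt[of j] alt[of "Suc j"] by auto
  qed
  then show "u j \<in> \<Delta>m \<longleftrightarrow> \<not> par j" using alt[OF assms] by blast
qed

text \<open>At most one of the two links at \<open>g i\<close> belongs to \<open>D\<close>, so a
  single letter acts and exchanges the ends of that link. Where the link is missing at an end of the
  chain nothing moves; for \<open>i = 0\<close> this is hidden in
  \<open>g (i - 1) = g 0\<close>.\<close>

lemma part_product:
  assumes D: "D \<in> {\<Delta>p, \<Delta>m}" and f: "simple_product D f"
    and Q: "\<And>j. Suc j < h \<Longrightarrow> u j \<in> D \<longleftrightarrow> Q j" "\<And>j. Q (Suc j) \<longleftrightarrow> \<not> Q j" and "i < h"
  shows "f (g i) = (if Q i then if Suc i < h then g (Suc i) else g i else g (i - 1))"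
proof -
  obtain as where as: "distinct as" "set as = D" "f = word_prod (map reflect_along as)"
    using f unfolding simple_product_def by blast
  note ortho = orthogonal_word[where as = as and v = "g i", unfolded as(2), OF parts_orthogonal[OF D]]
  have D\<Delta>: "D \<subseteq> \<Delta>" using D parts by blast
  have meets: "(Suc i < h \<and> Q i \<and> \<beta> = u i) \<or> (\<exists>k. i = Suc k \<and> Q k \<and> \<beta> = u k)"
    if \<beta>: "\<beta> \<in> D" "g i \<bullet> \<beta> \<noteq> 0" for \<beta>
  proof -
    obtain j where j: "Suc j < h" "\<beta> = u j" using \<Delta>_E \<beta> D\<Delta> by blast
    then have "g i \<bullet> \<delta> j \<noteq> 0" using \<beta>(2) by (auto simp: u_def)
    then consider "Suc i < h" "\<delta> j = \<delta> i" | k where "i = Suc k" "\<delta> j = \<delta> k"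
      using \<delta>_meets_g[OF j(1) \<open>i < h\<close>] by blast
    then show ?thesis
    proof cases
      case 1
      then have "\<beta> = u i" using j by (simp add: u_def)
      then show ?thesis using 1 Q(1)[of i] \<beta>(1) by blast
    next
      case 2
      then have "\<beta> = u k" using j by (simp add: u_def)
      then show ?thesis using 2 Q(1)[of k] \<beta>(1) \<open>i < h\<close> by blast
    qed
  qed
  have n: "norm (g i) = norm (g j)" if "j < h" for j using norm_X g_X that \<open>i < h\<close> by simp
  show ?thesis
  proof (cases "Q i")
    case True
    show ?thesis
    proof (cases "Suc i < h")
      case Si: True
      have "f (g i) = reflect_along (u i) (g i)" unfolding as(3)
      proof (rule ortho(2)[OF as(1)])
        show "u i \<in> D" using Q(1)[OF Si] True by simp
        show "g i \<bullet> \<beta> = 0" if "\<beta> \<in> D" "\<beta> \<noteq> u i" for \<beta>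
          using meets[OF that(1)] that(2) True Q(2) by blast
      qed
      then show ?thesis using True Si reflect_u[OF Si] reflect_along_swap[OF n[OF Si]] by simp
    next
      case False
      have "f (g i) = g i" unfolding as(3)
      proof (rule ortho(1))
        show "g i \<bullet> \<beta> = 0" if "\<beta> \<in> D" for \<beta>
          using meets[OF that] True False Q(2) by blast
      qed
      then show ?thesis using True False by simp
    qed
  next
    case nQ: False
    show ?thesis
    proof (cases i)
      case 0
      have "f (g i) = g i" unfolding as(3)
      proof (rule ortho(1))
        show "g i \<bullet> \<beta> = 0" if "\<beta> \<in> D" for \<beta>
          using meets[OF that] nQ 0 by blast
      qed
      then show ?thesis using nQ 0 by simp
    next
      case (Suc k)
      then have Sk: "Suc k < h" and Qk: "Q k" using \<open>i < h\<close> nQ Q(2)[of k] by auto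
      have "f (g i) = reflect_along (u k) (g i)" unfolding as(3)
      proof (rule ortho(2)[OF as(1)])
        show "u k \<in> D" using Q(1)[OF Sk] Qk by simp
        show "g i \<bullet> \<beta> = 0" if "\<beta> \<in> D" "\<beta> \<noteq> u k" for \<beta>
          using meets[OF that(1)] that(2) nQ Suc by blast
      qed
      then show ?thesis
        using Suc nQ reflect_u[OF Sk] reflect_along_swap'[of "g k" "g i"] n[of k] Sk by simp
    qed
  qed
qed

end

subsection \<open>The Coxeter plane\<close>

text \<open>A positive solution is orthogonal to no other positive solution, so it is the sine solution.\<close>

lemma positive_recurrence_sine:
  fixes A :: "nat \<Rightarrow> real"
  assumes "2 \<le> h" and ends: "A 0 = 0" "A h = 0" and pos: "\<And>j. 0 < j \<Longrightarrow> j < h \<Longrightarrow> 0 < A j"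
    and rec: "\<And>j. Suc j < h \<Longrightarrow> A j + A (Suc (Suc j)) = 2 * t * A (Suc j)"
  obtains C where "0 < C" "\<And>j. j \<le> h \<Longrightarrow> A j = C * sin (pi * real j / real h)"
proof -
  define s where "s j = sin (pi * real j / real h)" for j
  define e where "e = cos (pi / real h)"
  have h: "0 < real h" using assms(1) by simp
  have s_pos: "0 < s j" if "0 < j" "j < h" for j
    unfolding s_def using that h by (intro sin_gt_zero) (auto simp: field_simps)
  have s_rec: "s j + s (Suc (Suc j)) = 2 * e * s (Suc j)" for j
  proof -
    have "pi * real j / real h = pi * real (Suc j) / real h - pi / real h"
      "pi * real (Suc (Suc j)) / real h = pi * real (Suc j) / real h + pi / real h"
      using h by (simp_all add: field_simps)
    then show ?thesis unfolding s_def e_def by (simp only: sin_add sin_diff) simp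
  qed
  \<comment> \<open>The discrete Wronskian of \<open>A\<close> and the sine. Both vanish at 0 and at
    \<open>h\<close>, so its telescoping sum is 0, which forces the two recurrence constants to
    agree.\<close>
  define D where "D j = s (Suc j) * A j - A (Suc j) * s j" for j
  have "(\<Sum>j<h - 1. 2 * (t - e) * (s (Suc j) * A (Suc j))) = (\<Sum>j<h - 1. D j - D (Suc j))"
  proof (rule sum.cong)
    fix j assume "j \<in> {..<h - 1}"
    then have "s (Suc j) * (A j + A (Suc (Suc j))) - A (Suc j) * (s j + s (Suc (Suc j)))
        = 2 * (t - e) * (s (Suc j) * A (Suc j))"
      using rec[of j] s_rec[of j] by (simp add: algebra_simps)
    then show "2 * (t - e) * (s (Suc j) * A (Suc j)) = D j - D (Suc j)"
      by (simp add: D_def algebra_simps)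
  qed simp
  also have "\<dots> = D 0 - D (h - 1)" by (rule sum_lessThan_telescope')
  also have "\<dots> = 0" using assms(1) ends by (simp add: D_def s_def)
  finally have "2 * (t - e) * (\<Sum>j<h - 1. s (Suc j) * A (Suc j)) = 0" by (simp only: sum_distrib_left)
  moreover have "0 < (\<Sum>j<h - 1. s (Suc j) * A (Suc j))"
    using assms(1) s_pos pos by (intro sum_pos mult_pos_pos) (auto simp: lessThan_empty_iff)
  ultimately have t: "t = e" by simp
  define C where "C = A 1 / s 1"
  have s1: "0 < s 1" using s_pos[of 1] assms(1) by simp
  have "A j = C * s j \<and> (j < h \<longrightarrow> A (Suc j) = C * s (Suc j))" if "j \<le> h" for j
    using that
  proof (induction j)
    case 0
    then show ?case using ends(1) s1 by (simp add: C_def s_def)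
  next
    case (Suc j)
    have "A (Suc (Suc j)) = C * s (Suc (Suc j))" if "Suc j < h"
    proof -
      have "A (Suc (Suc j)) = 2 * e * A (Suc j) - A j" using rec[OF that] t by simp
      also have "\<dots> = C * (2 * e * s (Suc j) - s j)" using Suc by (simp add: algebra_simps)
      also have "2 * e * s (Suc j) - s j = s (Suc (Suc j))" using s_rec[of j] by linarith
      finally show ?thesis .
    qed
    then show ?case using Suc by simp
  qed
  moreover have "0 < C" using pos[of 1] s1 assms(1) by (simp add: C_def)
  ultimately show ?thesis using that[of C] by (simp add: s_def)
qed

lemma orth_proj_in:
  fixes P :: "'a::euclidean_space set"
  assumes "subspace P"
  shows "orth_proj P x \<in> P" and "z \<in> P \<Longrightarrow> orthogonal (x - orth_proj P x) z"
proof -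
  obtain y r where yz: "y \<in> span P" "\<And>w. w \<in> span P \<Longrightarrow> orthogonal r w" "x = y + r"
    using orthogonal_subspace_decomp_exists[of P x] by blast
  have y: "y \<in> P \<and> (\<forall>w\<in>P. orthogonal (x - y) w)" using yz assms by (auto simp: span_base span_eq_iff[THEN iffD2])
  have "orth_proj P x \<in> P \<and> (\<forall>z\<in>P. orthogonal (x - orth_proj P x) z)"
    unfolding orth_proj_def
  proof (rule theI, rule y)
    fix y' assume y': "y' \<in> P \<and> (\<forall>z\<in>P. orthogonal (x - y') z)"
    have "y' - y \<in> P" using y y' assms by (simp add: subspace_diff)
    then have "orthogonal (x - y) (y' - y)" "orthogonal (x - y') (y' - y)" using y y' by auto
    then have "(y' - y) \<bullet> (y' - y) = 0" by (simp add: orthogonal_def inner_diff inner_commute)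
    then show "y' = y" by simp
  qed
  then show "orth_proj P x \<in> P" "z \<in> P \<Longrightarrow> orthogonal (x - orth_proj P x) z" by auto
qed

section \<open>Coordinates of the projected orbit on the unit circle\<close>

context bipartite_chain
begin

text \<open>The chain zigzags between the upper and the lower half circle: a link in
  \<open>\<Delta>p\<close> joins mirror images in the real axis, a link in \<open>\<Delta>m\<close>
  mirror images in the line at angle \<open>pi / h\<close>.\<close>

definition \<Psi>i :: "nat \<Rightarrow> complex" where
  "\<Psi>i i = (if par i then cis (pi * real (Suc i) / real h) else cis (- (pi * real i / real h)))"

definition \<Psi> :: "'a \<Rightarrow> complex" where
  "\<Psi> p = \<Psi>i (inv_into {..<h} g p)"

lemma \<Psi>_g [simp]: "i < h \<Longrightarrow> \<Psi> (g i) = \<Psi>i i"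
  using bij_g by (simp add: \<Psi>_def bij_betw_def)

lemma norm_\<Psi>: "norm (\<Psi> p) = 1"
  by (simp add: \<Psi>_def \<Psi>i_def)

lemma h_real: "0 < real h"
  using h_ge by simp

text \<open>An end point of the chain touched by no link of \<open>\<Delta>p\<close> lies on the
  real axis, at angle 0 or \<open>pi\<close>.\<close>

lemma \<Psi>_plus:
  assumes f: "simple_product \<Delta>p f" and i: "i < h"
  shows "f (g i) \<in> X" "\<Psi> (f (g i)) = cnj (\<Psi> (g i))"
proof -
  have fg: "f (g i) = (if par i then if Suc i < h then g (Suc i) else g i else g (i - 1))"
    by (rule part_product[OF _ f _ _ i]) (use u_parts in auto)
  show "f (g i) \<in> X" using fg g_X i by simp
  show "\<Psi> (f (g i)) = cnj (\<Psi> (g i))"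
  proof (cases "par i")
    case True
    show ?thesis
    proof (cases "Suc i < h")
      case False
      then have "real (Suc i) = real h" using i by simp
      then have "pi * real (Suc i) / real h = pi" using h_real by simp
      then show ?thesis using True False i fg by (simp add: \<Psi>i_def del: of_nat_Suc)
    qed (use True i fg in \<open>simp add: \<Psi>i_def cis_cnj\<close>)
  next
    case False
    then show ?thesis
      using i fg by (cases i) (simp_all add: \<Psi>i_def cis_cnj)
  qed
qed

text \<open>The formula is the reflection in the line at angle \<open>pi / h\<close>. An end point
  of the chain touched by no link of \<open>\<Delta>m\<close> lies on that line.\<close>

lemma \<Psi>_minus:
  assumes f: "simple_product \<Delta>m f" and i: "i < h"
  shows "f (g i) \<in> X" "\<Psi> (f (g i)) = cis (2 * pi / real h) * cnj (\<Psi> (g i))"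
proof -
  have fg: "f (g i) = (if \<not> par i then if Suc i < h then g (Suc i) else g i else g (i - 1))"
    by (rule part_product[OF _ f, where Q = "\<lambda>i. \<not> par i", OF _ _ _ i]) (use u_parts in auto)
  show "f (g i) \<in> X" using fg g_X i by simp
  show "\<Psi> (f (g i)) = cis (2 * pi / real h) * cnj (\<Psi> (g i))"
  proof (cases "par i")
    case False
    show ?thesis
    proof (cases "Suc i < h")
      case True
      have "pi * real (Suc (Suc i)) / real h = 2 * pi / real h + pi * real i / real h"
        using h_real by (simp add: field_simps)
      then show ?thesis using True False i fg by (simp add: \<Psi>i_def cis_cnj cis_mult del: of_nat_Suc)
    next
      case last: False
      then have "real h = real i + 1" using i by linarith
      then have "real i = real h - 1" by simp
      then have "pi * real i / real h = pi - pi / real h"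
        using h_real by (simp add: right_diff_distrib diff_divide_distrib)
      moreover have "2 * pi / real h = 2 * (pi / real h)" by simp
      ultimately have angle: "2 * pi / real h + pi * real i / real h = - (pi * real i / real h) + 2 * pi"
        by linarith
      have "cis (2 * pi / real h + pi * real i / real h) = cis (- (pi * real i / real h))"
        unfolding angle by (simp only: cis_mult [symmetric] cis_2pi mult_1_right)
      then show ?thesis using False last i fg by (simp add: \<Psi>i_def cis_cnj cis_mult)
    qed
  next
    case True
    show ?thesis
    proof (cases i)
      case 0
      have "2 * pi / real h + - (pi / real h) = pi / real h" by (simp add: field_simps)
      then show ?thesis using True i fg 0 by (simp add: \<Psi>i_def cis_cnj cis_mult)
    next
      case (Suc k)
      have "2 * pi / real h + - (pi * real (Suc (Suc k)) / real h) = - (pi * real k / real h)"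
        using h_real by (simp add: field_simps)
      then show ?thesis using True i fg Suc by (simp add: \<Psi>i_def cis_cnj cis_mult del: of_nat_Suc)
    qed
  qed
qed

lemma simple_product_in_W:
  assumes "simple_product D f" "D \<subseteq> \<Delta>"
  shows "f \<in> W"
proof -
  obtain as where "set as = D" "f = word_prod (map reflect_along as)"
    using assms(1) unfolding simple_product_def by blast
  then show ?thesis using word_in_W[of "map reflect_along as"] reflections_\<Delta>[OF assms(2)] by simp
qed

text \<open>The two factors of \<open>c\<close> act as reflections in lines meeting at angle
  \<open>pi / h\<close>, so \<open>c\<close> acts as a rotation by twice that angle.\<close>

lemma coxeter_orbit:
  assumes "bipartite_coxeter_element \<Delta>p \<Delta>m c"
  shows "coxeter_orbit W X c \<Psi> h"
proof
  obtain cp cm where cp: "simple_product \<Delta>p cp" and cm: "simple_product \<Delta>m cm" and c: "c = cm \<circ> cp"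
    using assms unfolding bipartite_coxeter_element_def by blast
  show "c \<in> W" unfolding c
    using parts simple_product_in_W[OF cp] simple_product_in_W[OF cm] by (intro comp_in_W) auto
  show "h = card X" by (simp add: card_X)
  show "X \<noteq> {}" using card_X h_ge by auto
  show "cmod (\<Psi> p) = 1" for p by (rule norm_\<Psi>)
  show "\<Psi> (c p) = cis (2 * pi / real h) * \<Psi> p" if "p \<in> X" for p
  proof -
    obtain i where i: "i < h" "p = g i" using X_g \<open>p \<in> X\<close> by blast
    obtain j where j: "j < h" "cp p = g j" using X_g \<Psi>_plus(1)[OF cp i(1)] i by blast
    have "\<Psi> (c p) = cis (2 * pi / real h) * cnj (\<Psi> (cp p))"
      using \<Psi>_minus(2)[OF cm j(1)] j by (simp add: c)
    then show ?thesis using \<Psi>_plus(2)[OF cp i(1)] i by simp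
  qed
qed

section \<open>The eigenvector and the projection to the plane\<close>

lemma norm_\<delta>: "Suc j < h \<Longrightarrow> norm (\<delta> j) \<noteq> 0"
  using \<delta>_nonzero by simp

lemma scale_u: "Suc j < h \<Longrightarrow> norm (\<delta> j) *\<^sub>R u j = \<delta> j"
  using norm_\<delta> by (simp add: u_def)

lemma \<delta>_inner: "Suc j < h \<Longrightarrow> \<delta> j \<bullet> v = norm (\<delta> j) * (u j \<bullet> v)"
  using scale_u by (metis inner_scaleR_left)

lemma u_inner_ends:
  assumes "Suc j < h"
  shows "u j \<bullet> g j = norm (\<delta> j) / 2" "u j \<bullet> g (Suc j) = - norm (\<delta> j) / 2"
proof -
  have "\<delta> j \<bullet> g j = norm (\<delta> j) * norm (\<delta> j) / 2" "\<delta> j \<bullet> g (Suc j) = - (norm (\<delta> j) * norm (\<delta> j) / 2)"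
    using inner_g[of j j] inner_g[of "Suc j" "Suc j"] assms
    unfolding power2_eq_square[symmetric] power2_norm_eq_inner
    by (auto simp: \<delta>_def inner_diff inner_commute field_simps)
  then have "norm (\<delta> j) * (u j \<bullet> g j) = norm (\<delta> j) * (norm (\<delta> j) / 2)"
    "norm (\<delta> j) * (u j \<bullet> g (Suc j)) = norm (\<delta> j) * (- norm (\<delta> j) / 2)"
    using \<delta>_inner[OF assms, of "g j"] \<delta>_inner[OF assms, of "g (Suc j)"] by simp_all
  then show "u j \<bullet> g j = norm (\<delta> j) / 2" "u j \<bullet> g (Suc j) = - norm (\<delta> j) / 2"
    using norm_\<delta>[OF assms] mult_left_cancel by blast+
qed

text \<open>The eigenvector rescaled by the lengths of the links, shifted by one and extended by 0
  at both ends. In this scaling the Gram equation becomes a recurrence with constant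
  coefficients.\<close>

definition A :: "('a \<Rightarrow> real) \<Rightarrow> nat \<Rightarrow> real" where
  "A k j = (if 0 < j \<and> j < h then norm (\<delta> (j - 1)) * k (u (j - 1)) else 0)"

lemma A_Suc: "Suc j < h \<Longrightarrow> A k (Suc j) = norm (\<delta> j) * k (u j)"
  by (simp add: A_def)

text \<open>Only the two links at \<open>g i\<close> contribute, each with half its length and with
  opposite signs. The sum runs over roots, so a link and its mirror image count once.\<close>

lemma combination_inner_g:
  assumes "i < h"
  shows "(\<Sum>\<beta>\<in>\<Delta>. k \<beta> *\<^sub>R \<beta>) \<bullet> g i = (A k (Suc i) - A k i) / 2"
proof -
  have "(\<Sum>\<beta>\<in>\<Delta>. k \<beta> *\<^sub>R \<beta>) \<bullet> g i = (\<Sum>\<beta>\<in>\<Delta>. k \<beta> * (\<beta> \<bullet> g i))"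
    by (simp add: inner_sum_left)
  also have "\<dots> = (\<Sum>\<beta>\<in>\<Delta>. (if \<beta> = u i then of_bool (Suc i < h) * A k (Suc i) / 2 else 0)
      - (if \<beta> = u (i - 1) then of_bool (0 < i) * A k i / 2 else 0))"
  proof (rule sum.cong)
    fix \<beta> assume \<beta>: "\<beta> \<in> \<Delta>"
    have ne: "u i \<noteq> u (i - 1)" if "Suc i < h" "0 < i"
      using adjacent_not_orthogonal[of "i - 1"] that by (metis Suc_pred' inner_ge_zero not_less)
    obtain j where j: "Suc j < h" "\<beta> = u j" using \<Delta>_E \<beta> by blast
    consider "Suc i < h" "\<beta> = u i" | l where "i = Suc l" "\<beta> = u l" | "\<beta> \<bullet> g i = 0"
      using \<delta>_meets_g[OF j(1) assms] by (fastforce simp: j u_def inner_commute)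
    then show "k \<beta> * (\<beta> \<bullet> g i) = (if \<beta> = u i then of_bool (Suc i < h) * A k (Suc i) / 2 else 0)
      - (if \<beta> = u (i - 1) then of_bool (0 < i) * A k i / 2 else 0)"
    proof cases
      case 1
      then show ?thesis using ne u_inner_ends(1)[of i] by (cases "i = 0") (auto simp: A_Suc)
    next
      case 2
      then show ?thesis using ne u_inner_ends(2)[of l] assms by (cases "Suc i < h") (auto simp: A_Suc)
    next
      case 3
      have "\<not> (Suc i < h \<and> \<beta> = u i)" using 3 u_inner_ends(1)[of i] norm_\<delta>[of i] by auto
      moreover have "\<not> (0 < i \<and> \<beta> = u (i - 1))"
        using 3 u_inner_ends(2)[of "i - 1"] norm_\<delta>[of "i - 1"] assms by auto
      ultimately show ?thesis using 3 by auto
    qed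
  qed simp
  also have "\<dots> = (A k (Suc i) - A k i) / 2"
  proof -
    have "(\<Sum>\<beta>\<in>\<Delta>. if \<beta> = u i then of_bool (Suc i < h) * A k (Suc i) / 2 else 0) = A k (Suc i) / 2"
      using finite_\<Delta> u_\<Delta>[of i] by (auto simp: A_def)
    moreover have "(\<Sum>\<beta>\<in>\<Delta>. if \<beta> = u (i - 1) then of_bool (0 < i) * A k i / 2 else 0) = A k i / 2"
      using finite_\<Delta> u_\<Delta>[of "i - 1"] assms by (auto simp: A_def)
    ultimately show ?thesis by (simp add: sum_subtractf diff_divide_distrib)
  qed
  finally show ?thesis .
qed

text \<open>Since \<open>\<delta> j = g j - g (Suc j)\<close>, two instances of
  \<open>combination_inner_g\<close> turn the eigenvector equation into the recurrence with
  \<open>t = 1 - l\<close>.\<close>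

lemma eigenvector_sine:
  assumes ev: "gram_eigenvector \<Delta> l k" and pos: "\<And>\<alpha>. \<alpha> \<in> \<Delta> \<Longrightarrow> 0 < k \<alpha>"
  obtains C where "0 < C"
    "\<And>j. Suc j < h \<Longrightarrow> norm (\<delta> j) * k (u j) = C * sin (pi * real (Suc j) / real h)"
proof -
  let ?z = "\<Sum>\<beta>\<in>\<Delta>. k \<beta> *\<^sub>R \<beta>"
  have rec: "A k j + A k (Suc (Suc j)) = 2 * (1 - l) * A k (Suc j)" if j: "Suc j < h" for j
  proof -
    have "u j \<bullet> ?z = l * k (u j)"
      using ev u_\<Delta>[OF j] unfolding gram_eigenvector_def by (simp add: inner_sum_right mult.commute)
    then have "\<delta> j \<bullet> ?z = l * A k (Suc j)"
      using \<delta>_inner[OF j, of ?z] by (simp add: A_Suc[OF j])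
    moreover have "\<delta> j \<bullet> ?z = ?z \<bullet> g j - ?z \<bullet> g (Suc j)" by (simp add: \<delta>_def inner_diff inner_commute)
    ultimately have "l * A k (Suc j) = (A k (Suc j) - A k j) / 2 - (A k (Suc (Suc j)) - A k (Suc j)) / 2"
      using combination_inner_g[of j k] combination_inner_g[of "Suc j" k] j by simp
    then have "A k j + A k (Suc (Suc j)) = 2 * A k (Suc j) - 2 * (l * A k (Suc j))" by argo
    then show ?thesis by (simp add: algebra_simps)
  qed
  obtain C where "0 < C" "\<And>j. j \<le> h \<Longrightarrow> A k j = C * sin (pi * real j / real h)"
  proof (rule positive_recurrence_sine[of h "A k" "1 - l"])
    show "0 < A k j" if "0 < j" "j < h" for j
      using that pos u_\<Delta>[of "j - 1"] norm_\<delta>[of "j - 1"] by (simp add: A_def)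
  qed (use h_ge rec in \<open>auto simp: A_def\<close>)
  then show ?thesis using that by (metis A_Suc less_imp_le_nat)
qed

lemma \<delta>_inner_part:
  assumes "Suc j < h" "D \<subseteq> \<Delta>"
  shows "\<delta> j \<bullet> (\<Sum>\<alpha>\<in>D. k \<alpha> *\<^sub>R \<omega> \<alpha>) = (if u j \<in> D then norm (\<delta> j) * k (u j) else 0)"
proof -
  have fin: "finite D" using assms(2) finite_\<Delta> finite_subset by blast
  have "u j \<bullet> (\<Sum>\<alpha>\<in>D. k \<alpha> *\<^sub>R \<omega> \<alpha>) = (\<Sum>\<alpha>\<in>D. if \<alpha> = u j then k \<alpha> else 0)"
    unfolding inner_sum_right using assms inner_\<omega> u_\<Delta> by (intro sum.cong) auto
  also have "\<dots> = (if u j \<in> D then k (u j) else 0)" using fin by simp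
  finally show ?thesis using \<delta>_inner[OF assms(1)] by simp
qed

text \<open>\<open>F\<close> sees only the inner products with the two spanning vectors, so it
  factors through the projection and is injective on \<open>P\<close>. On the orbit it equals
  \<open>\<Psi>\<close> up to the translation \<open>d\<close>, so it carries hulls to translated
  hulls and keeps disjointness.\<close>

lemma hulls_in_plane:
  assumes ev: "gram_eigenvector \<Delta> l k" and pos: "\<And>\<alpha>. \<alpha> \<in> \<Delta> \<Longrightarrow> 0 < k \<alpha>"
    and P: "P = span {\<Sum>\<alpha>\<in>\<Delta>p. k \<alpha> *\<^sub>R \<omega> \<alpha>, \<Sum>\<alpha>\<in>\<Delta>m. k \<alpha> *\<^sub>R \<omega> \<alpha>}"
    and B: "B \<subseteq> X" "B' \<subseteq> X"
  shows "convex hull (orth_proj P ` B) \<inter> convex hull (orth_proj P ` B') = {} \<longleftrightarrow>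
    convex hull (\<Psi> ` B) \<inter> convex hull (\<Psi> ` B') = {}"
proof -
  obtain C where C: "0 < C" "\<And>j. Suc j < h \<Longrightarrow> norm (\<delta> j) * k (u j) = C * sin (pi * real (Suc j) / real h)"
    using eigenvector_sine[OF ev pos] by blast
  define lam mu where "lam = (\<Sum>\<alpha>\<in>\<Delta>p. k \<alpha> *\<^sub>R \<omega> \<alpha>)" and "mu = (\<Sum>\<alpha>\<in>\<Delta>m. k \<alpha> *\<^sub>R \<omega> \<alpha>)"
  have P': "P = span {lam, mu}" by (simp add: P lam_def mu_def)
  \<comment> \<open>The coefficients are forced by the differences of \<open>\<Psi>i\<close> along a
    link: with \<open>x = pi * (j + 1) / h\<close> they are \<open>2 * \<i> * sin x\<close> on
    \<open>\<Delta>p\<close>, and this times \<open>- cis (pi / h)\<close> on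
    \<open>\<Delta>m\<close>.\<close>
  define F :: "'a \<Rightarrow> complex" where
    "F v = (2 * \<i> / of_real C) * (of_real (v \<bullet> lam) - cis (pi / real h) * of_real (v \<bullet> mu))" for v
  have linF: "linear F"
    by (rule linearI) (simp_all add: F_def inner_add_left scaleR_conv_of_real algebra_simps)
  have step: "F (g j) - F (g (Suc j)) = \<Psi>i j - \<Psi>i (Suc j)" if j: "Suc j < h" for j
  proof -
    define x where "x = pi * real (Suc j) / real h"
    have lm: "\<delta> j \<bullet> lam = (if par j then C * sin x else 0)" "\<delta> j \<bullet> mu = (if par j then 0 else C * sin x)"
      using \<delta>_inner_part[OF j, of \<Delta>p k] \<delta>_inner_part[OF j, of \<Delta>m k] u_parts[OF j] C(2)[OF j] parts
      by (auto simp: lam_def mu_def x_def)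
    have "F (g j) - F (g (Suc j)) = F (\<delta> j)" by (simp add: \<delta>_def linear_diff[OF linF])
    also have "\<dots> = \<Psi>i j - \<Psi>i (Suc j)"
    proof (cases "par j")
      case True
      have "\<Psi>i j - \<Psi>i (Suc j) = cis x - cis (- x)" using True by (simp add: \<Psi>i_def x_def)
      also have "\<dots> = 2 * \<i> * of_real (sin x)" by (simp add: complex_eq_iff)
      finally show ?thesis using True lm C(1) by (simp add: F_def)
    next
      case False
      have "- (pi * real j / real h) = pi / real h + (- x)" "pi * real (Suc (Suc j)) / real h = pi / real h + x"
        using h_real by (simp_all add: x_def field_simps)
      then have "\<Psi>i j - \<Psi>i (Suc j) = cis (pi / real h + (- x)) - cis (pi / real h + x)"
        using False by (simp add: \<Psi>i_def del: of_nat_Suc)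
      also have "\<dots> = cis (pi / real h) * (cis (- x) - cis x)"
        by (simp only: right_diff_distrib cis_mult)
      also have "cis (- x) - cis x = - 2 * \<i> * of_real (sin x)" by (simp add: complex_eq_iff)
      finally show ?thesis using False lm C(1) by (simp add: F_def)
    qed
    finally show ?thesis .
  qed
  define d where "d = F (g 0) - \<Psi>i 0"
  have Fg: "F (g i) = d + \<Psi>i i" if "i < h" for i
    using that
  proof (induction i)
    case (Suc i)
    then show ?case using step[of i] by (simp add: algebra_simps)
  qed (simp add: d_def)
  have F\<Psi>: "F p = d + \<Psi> p" if "p \<in> X" for p using X_g[OF that] Fg by auto
  have sP: "subspace P" by (simp add: P)
  have Fproj: "F (orth_proj P v) = F v" for v
  proof -
    have "lam \<in> P" "mu \<in> P" by (simp_all add: P' span_base)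
    then have "(v - orth_proj P v) \<bullet> lam = 0" "(v - orth_proj P v) \<bullet> mu = 0"
      using orth_proj_in(2)[OF sP] by (auto simp: orthogonal_def)
    then show ?thesis by (simp add: F_def inner_diff_left)
  qed
  have inj: "inj_on F P"
  proof (rule inj_onI)
    fix x y assume xy: "x \<in> P" "y \<in> P" "F x = F y"
    then have "F (x - y) = 0" by (simp add: linear_diff[OF linF])
    then have *: "of_real ((x - y) \<bullet> lam) = cis (pi / real h) * of_real ((x - y) \<bullet> mu)"
      using C(1) by (simp add: F_def)
    \<comment> \<open>1 and \<open>cis (pi / h)\<close> are independent over the reals, so both
      inner products vanish.\<close>
    have "sin (pi / real h) > 0" using h_ge by (intro sin_gt_zero) (auto simp: field_simps)
    then have m: "orthogonal (x - y) mu" using arg_cong[OF *, of Im] by (simp add: orthogonal_def)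
    then have l: "orthogonal (x - y) lam" using * by (simp add: orthogonal_def)
    have "orthogonal (x - y) z" if "z \<in> P" for z
      using that unfolding P' by (rule orthogonal_to_span) (use l m in blast)
    then have "orthogonal (x - y) (x - y)" using subspace_diff[OF sP xy(1,2)] by blast
    then show "x = y" by (simp add: orthogonal_self)
  qed
  have hull: "F ` (convex hull (orth_proj P ` B)) = (+) d ` (convex hull (\<Psi> ` B))" if "B \<subseteq> X" for B
  proof -
    have "F ` orth_proj P ` B = (+) d ` \<Psi> ` B"
      unfolding image_image using that F\<Psi> by (intro image_cong) (auto simp: Fproj)
    then show ?thesis
      by (simp add: convex_hull_linear_image[OF linF] convex_hull_translation)
  qed
  have sub: "convex hull (orth_proj P ` B) \<subseteq> P" for B
    using orth_proj_in(1)[OF sP] subspace_imp_convex[OF sP] by (intro hull_minimal) auto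
  have "convex hull (orth_proj P ` B) \<inter> convex hull (orth_proj P ` B') = {} \<longleftrightarrow>
      F ` (convex hull (orth_proj P ` B) \<inter> convex hull (orth_proj P ` B')) = {}" by simp
  also have "F ` (convex hull (orth_proj P ` B) \<inter> convex hull (orth_proj P ` B'))
      = F ` (convex hull (orth_proj P ` B)) \<inter> F ` (convex hull (orth_proj P ` B'))"
    using inj sub by (intro inj_on_image_Int) auto
  also have "\<dots> = (+) d ` (convex hull (\<Psi> ` B) \<inter> convex hull (\<Psi> ` B'))"
    unfolding hull[OF B(1)] hull[OF B(2)] by (intro image_Int[symmetric]) simp
  finally show ?thesis by simp
qed

end

section \<open>The equivalence for frames of types A and B\<close>

theorem signed_frame_noncrossing_iff:
  assumes frame: "signed_frame W X" and card: "3 \<le> card X"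
    and sys: "simple_system W \<Delta>" and bip: "bipartition \<Delta> \<Delta>p \<Delta>m"
    and cox: "bipartite_coxeter_element \<Delta>p \<Delta>m c" and plane: "coxeter_plane \<Delta> \<Delta>p \<Delta>m P"
    and par: "parabolic W \<Delta> H"
  shows "noncrossing W \<Delta> c H \<longleftrightarrow> block_hulls_disjoint P H X"
proof -
  obtain l k \<omega> where ev: "gram_eigenvector \<Delta> l k" and pos: "\<And>\<alpha>. \<alpha> \<in> \<Delta> \<Longrightarrow> 0 < k \<alpha>"
    and dual: "dual_basis \<Delta> \<omega>"
    and P: "P = span {\<Sum>\<alpha>\<in>\<Delta>p. k \<alpha> *\<^sub>R \<omega> \<alpha>, \<Sum>\<alpha>\<in>\<Delta>m. k \<alpha> *\<^sub>R \<omega> \<alpha>}"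
    using plane unfolding coxeter_plane_def by blast
  interpret simple_frame W X \<Delta> \<omega>
    using frame sys dual by (intro simple_frame.intro simple_frame_axioms.intro)
  obtain g where g: "bij_betw g {..<card X} X" "\<And>i j. i < j \<Longrightarrow> j < card X \<Longrightarrow> ht (g j) < ht (g i)"
    using decreasing_enumeration[OF finite_X inj_ht] by blast
  interpret chain: bipartite_chain W X \<Delta> \<omega> g "card X" \<Delta>p \<Delta>m
    by unfold_locales (use g bip card in auto)
  interpret orbit: coxeter_orbit W X c chain.\<Psi> "card X"
    by (rule chain.coxeter_orbit[OF cox])
  obtain R where R: "H = words R" "R \<subseteq> reflections W"
    "\<And>t. t \<in> R \<Longrightarrow> \<exists>p\<in>X. \<exists>q\<in>orbit_of (words R) p. p \<noteq> q \<and> t = reflect_along (p - q)"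
    "\<And>p q. p \<in> X \<Longrightarrow> q \<in> orbit_of (words R) p \<Longrightarrow> p \<noteq> q \<Longrightarrow> reflect_along (p - q) \<in> words R"
    using chain.parabolic_full[OF par] by metis
  have HW: "H \<subseteq> W" unfolding R(1) using words_reflections_in_W[OF R(2)] .
  have OX: "orbit_of H p \<subseteq> X" if "p \<in> X" for p
    using that HW W_Y by (auto simp: orbit_of_def)
  have sym: "p \<in> orbit_of H q" if "q \<in> orbit_of H p" for p q
    using orbit_of_sym[OF reflections_involution[OF subsetD[OF R(2)]]] that unfolding R(1) by blast
  have trans: "r \<in> orbit_of H p" if "q \<in> orbit_of H p" "r \<in> orbit_of H q" for p q r
    using orbit_of_trans that unfolding R(1) by metis
  have eq: "orbit_of H p = orbit_of H q" if "q \<in> orbit_of H p" for p q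
    using trans[OF that] trans[OF sym[OF that]] by blast
  have disj: "orbit_of H p \<inter> orbit_of H q = {}" if "q \<notin> orbit_of H p" for p q
    using that sym trans by blast
  have hulls: "convex hull (orth_proj P ` orbit_of H p) \<inter> convex hull (orth_proj P ` orbit_of H q) = {}
      \<longleftrightarrow> \<not> orbit.crossing (orbit_of H p) (orbit_of H q)"
    if "p \<in> X" "q \<in> X" "q \<notin> orbit_of H p" for p q
    using chain.hulls_in_plane[OF ev pos P OX[OF that(1)] OX[OF that(2)]]
      orbit.crossing_if_hulls_meet[OF OX[OF that(1)] OX[OF that(2)] disj[OF that(3)]]
      orbit.hulls_meet_if_crossing by blast
  have blk: "block_hulls_disjoint P H X \<longleftrightarrow>
      (\<forall>p\<in>X. \<forall>q\<in>X. q \<notin> orbit_of H p \<longrightarrow> \<not> orbit.crossing (orbit_of H p) (orbit_of H q))"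
  proof -
    have self: "p \<in> orbit_of H p" for p unfolding R(1) by (rule orbit_of_refl)
    have "block_hulls_disjoint P H X \<longleftrightarrow> (\<forall>p\<in>X. \<forall>q\<in>X. orbit_of H p \<noteq> orbit_of H q \<longrightarrow>
        convex hull (orth_proj P ` orbit_of H p) \<inter> convex hull (orth_proj P ` orbit_of H q) = {})"
      unfolding block_hulls_disjoint_def disjoint_family_on_def blocks_def by blast
    moreover have "orbit_of H p \<noteq> orbit_of H q \<longleftrightarrow> q \<notin> orbit_of H p" for p q
      using eq[of q p] self[of q] by blast
    ultimately show ?thesis using hulls by simp
  qed
  show ?thesis
  proof
    assume "noncrossing W \<Delta> c H"
    then obtain ts ws where "reduced_T_word W (ts @ ws) c" "H = words (set ts)"
      using noncrossing_iff by blast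
    then show "block_hulls_disjoint P H X"
      unfolding blk using orbit.reduced_prefix_noncrossing by blast
  next
    assume "block_hulls_disjoint P H X"
    then have nc: "\<And>p q. p \<in> X \<Longrightarrow> q \<in> X \<Longrightarrow> q \<notin> orbit_of (words R) p \<Longrightarrow>
        \<not> orbit.crossing (orbit_of (words R) p) (orbit_of (words R) q)"
      unfolding blk unfolding R(1) by blast
    interpret noncrossing_subgroup W X c chain.\<Psi> "card X" R
      by (intro noncrossing_subgroup.intro orbit.coxeter_orbit_axioms noncrossing_subgroup_axioms.intro R(2-) nc)
    show "noncrossing W \<Delta> c H"
      using noncrossing_is_prefix par R(1) noncrossing_iff by blast
  qed
qed

subsection \<open>Types A and B\<close>

lemma linear_monomial:
  fixes e :: "'n::finite \<Rightarrow> real"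
  shows "linear (\<lambda>x. \<chi> i. e i * (x $ \<pi> i) :: real^'n)"
  by (rule linearI) (simp_all add: vec_eq_iff algebra_simps)

lemma range_axis_eq_Basis: "range (\<lambda>i. axis i 1) = (Basis :: (real^'n) set)"
  by (auto simp: Basis_vec_def)

text \<open>Axis vectors move by \<open>\<rho>\<close>, so coordinates are read through the inverse
  permutation.\<close>

lemma linear_monomial_eq:
  fixes f :: "real^'n \<Rightarrow> real^'n"
  assumes "linear f" "bij \<rho>" "\<And>i. f (axis i 1) = e i *\<^sub>R axis (\<rho> i) 1"
  shows "f = (\<lambda>x. \<chi> j. e (inv_into UNIV \<rho> j) * x $ inv_into UNIV \<rho> j)"
proof
  fix x
  show "f x = (\<chi> j. e (inv_into UNIV \<rho> j) * x $ inv_into UNIV \<rho> j)"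
  proof (rule linear_eq_on_span[OF assms(1) linear_monomial, where B = Basis])
    fix b :: "real^'n" assume "b \<in> Basis"
    then obtain i where b: "b = axis i 1" by (metis range_axis_eq_Basis imageE)
    have "inv_into UNIV \<rho> j = i \<longleftrightarrow> j = \<rho> i" for j
      using assms(2) by (metis bij_inv_eq_iff)
    then show "f b = (\<chi> j. e (inv_into UNIV \<rho> j) * b $ inv_into UNIV \<rho> j)"
      unfolding b assms(3) using assms(2) by (auto simp: vec_eq_iff axis_def bij_is_inj)
  qed simp
qed

lemma monomial_image:
  fixes X :: "(real^'n) set"
  assumes "finite X" "bij \<pi>" "\<And>i. \<epsilon> i \<noteq> 0" "\<And>x. x \<in> X \<Longrightarrow> (\<chi> i. \<epsilon> i * x $ \<pi> i) \<in> X"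
  shows "(\<lambda>x. \<chi> i. \<epsilon> i * x $ \<pi> i) ` X = X"
proof (rule endo_inj_surj[OF assms(1)])
  show "inj_on (\<lambda>x. \<chi> i. \<epsilon> i * x $ \<pi> i) X"
  proof (rule inj_onI)
    fix x y assume "(\<chi> i. \<epsilon> i * x $ \<pi> i) = (\<chi> i. \<epsilon> i * y $ \<pi> i)"
    then have "x $ \<pi> i = y $ \<pi> i" for i using assms(3)[of i] by (auto simp: vec_eq_iff)
    then have "x $ j = y $ j" for j using assms(2) by (metis bij_pointE)
    then show "x = y" by (simp add: vec_eq_iff)
  qed
qed (use assms(4) in auto)

lemma monomial_axis:
  fixes \<epsilon> :: "'n::finite \<Rightarrow> real"
  assumes "bij \<pi>"
  shows "(\<chi> i. \<epsilon> i * (axis k 1 :: real^'n) $ \<pi> i) = \<epsilon> (inv_into UNIV \<pi> k) *\<^sub>R axis (inv_into UNIV \<pi> k) 1"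
proof -
  have "\<pi> i = k \<longleftrightarrow> i = inv_into UNIV \<pi> k" for i using assms by (metis bij_inv_eq_iff)
  then show ?thesis by (auto simp: vec_eq_iff axis_def)
qed

lemma axis_eq_neg_axis: "axis i 1 \<noteq> (- axis j 1 :: real^'n)"
proof
  assume "axis i 1 = (- axis j 1 :: real^'n)"
  then have "(axis i 1 :: real^'n) $ i = - (axis j 1 $ i)" by (metis vector_uminus_component)
  then show False by (simp add: axis_def split: if_splits)
qed

lemma signed_frame_type_A:
  fixes W :: "(real^'n \<Rightarrow> real^'n) set"
  assumes "type_A n W X"
  shows "signed_frame W X" "card X = n + 1"
proof -
  have W: "W = coordinate_permutations" and X: "X = range (\<lambda>i. axis i 1)"
    using assms by (auto simp: type_A_def)
  have XB: "X = Basis" by (simp add: X range_axis_eq_Basis)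
  show "card X = n + 1" using assms by (simp add: XB type_A_def)
  have "f \<in> coordinate_permutations \<longleftrightarrow> linear f \<and> f ` X = X" for f :: "real^'n \<Rightarrow> real^'n"
  proof
    assume "f \<in> coordinate_permutations"
    then obtain \<pi> where \<pi>: "bij \<pi>" "f = (\<lambda>x. \<chi> i. 1 * x $ \<pi> i)"
      by (auto simp: coordinate_permutations_def)
    show "linear f \<and> f ` X = X"
      unfolding \<pi>(2)
    proof (intro conjI linear_monomial monomial_image[OF _ \<pi>(1)])
      fix x assume "x \<in> X"
      then show "(\<chi> i. 1 * x $ \<pi> i) \<in> X" unfolding X using monomial_axis[OF \<pi>(1), of "\<lambda>_. 1"] by auto
    qed (auto simp: XB)
  next
    assume f: "linear f \<and> f ` X = X"
    then have "\<forall>i. \<exists>j. f (axis i 1) = axis j 1" unfolding X by blast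
    then obtain \<rho> where \<rho>: "\<And>i. f (axis i 1) = axis (\<rho> i) 1" by metis
    have "inj_on f X" using f XB by (metis finite_Basis finite_surj_inj order_refl)
    then have "inj \<rho>" using \<rho> unfolding X inj_on_def by (metis axis_eq_axis rangeI zero_neq_one)
    then have "bij \<rho>" by (simp add: bij_def finite_UNIV_inj_surj)
    then have "f = (\<lambda>x. \<chi> j. 1 * x $ inv_into UNIV \<rho> j)"
      using linear_monomial_eq[of f \<rho> "\<lambda>_. 1"] f \<rho> by simp
    then show "f \<in> coordinate_permutations"
      unfolding coordinate_permutations_def using \<open>bij \<rho>\<close> bij_imp_bij_inv by auto
  qed
  then have WX: "W = {f. linear f \<and> f ` X = X}" unfolding W by blast
  show "signed_frame W X"
  proof
    show "p \<bullet> q = (if p = q then 1 else if p = - q then - 1 else 0)" if "p \<in> X" "q \<in> X" for p q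
      using that axis_eq_neg_axis unfolding X by (auto simp: inner_axis_axis axis_eq_axis)
    show "(\<forall>p\<in>X. - p \<in> X) \<or> (\<forall>p\<in>X. - p \<notin> X)"
      unfolding X using axis_eq_neg_axis by (metis imageE)
  qed (simp_all add: XB, simp add: WX XB)
qed

lemma signed_frame_type_B:
  fixes W :: "(real^'n \<Rightarrow> real^'n) set"
  assumes "type_B n W X"
  shows "signed_frame W X" "card X = 2 * n"
proof -
  have W: "W = signed_coordinate_permutations"
    and X: "X = range (\<lambda>i. axis i 1) \<union> range (\<lambda>i. - axis i 1)"
    using assms by (auto simp: type_B_def)
  have XB: "X = Basis \<union> uminus ` Basis" unfolding X range_axis_eq_Basis[symmetric] by auto
  have disj: "Basis \<inter> uminus ` (Basis :: (real^'n) set) = {}"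
    unfolding range_axis_eq_Basis[symmetric] using axis_eq_neg_axis by auto
  have cu: "card (uminus ` (Basis :: (real^'n) set)) = card (Basis :: (real^'n) set)"
    by (rule card_image) (auto simp: inj_on_def)
  have "card X = card (Basis :: (real^'n) set) + card (uminus ` (Basis :: (real^'n) set))"
    unfolding XB by (rule card_Un_disjoint[OF _ _ disj]) auto
  then show "card X = 2 * n" unfolding cu using assms by (simp add: type_B_def)
  have finX: "finite X" by (simp add: XB)
  have XE: "\<exists>i s. x = s *\<^sub>R axis i 1 \<and> (s = 1 \<or> s = - 1)" if "x \<in> X" for x
  proof -
    have "\<exists>i. x = axis i 1 \<or> x = - axis i 1" using that unfolding X by blast
    then obtain i where "x = axis i 1 \<or> x = - axis i 1" by blast
    then have "x = 1 *\<^sub>R axis i 1 \<or> x = (- 1) *\<^sub>R axis i 1" by simp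
    then show ?thesis by blast
  qed
  have XI: "s *\<^sub>R axis i 1 \<in> X" if "s = 1 \<or> s = - 1" for s i
    using that unfolding X by auto
  have "f \<in> signed_coordinate_permutations \<longleftrightarrow> linear f \<and> f ` X = X" for f :: "real^'n \<Rightarrow> real^'n"
  proof
    assume "f \<in> signed_coordinate_permutations"
    then obtain \<epsilon> \<pi> where \<pi>: "bij \<pi>" "f = (\<lambda>x. \<chi> i. \<epsilon> i * x $ \<pi> i)" "range \<epsilon> \<subseteq> {- 1, 1}"
      by (auto simp: signed_coordinate_permutations_def)
    have \<epsilon>: "\<epsilon> i = 1 \<or> \<epsilon> i = - 1" for i using \<pi>(3) by blast
    show "linear f \<and> f ` X = X"
      unfolding \<pi>(2)
    proof (intro conjI linear_monomial monomial_image[OF finX \<pi>(1)])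
      show "\<epsilon> i \<noteq> 0" for i using \<epsilon>[of i] by auto
      fix x assume "x \<in> X"
      then obtain k s where k: "x = s *\<^sub>R axis k 1" "s = 1 \<or> s = - 1" using XE by blast
      have "(\<chi> i. \<epsilon> i * x $ \<pi> i) = s *\<^sub>R (\<chi> i. \<epsilon> i * (axis k 1 :: real^'n) $ \<pi> i)"
        by (simp add: k vec_eq_iff)
      also have "\<dots> = (s * \<epsilon> (inv_into UNIV \<pi> k)) *\<^sub>R axis (inv_into UNIV \<pi> k) 1"
        unfolding monomial_axis[OF \<pi>(1)] by simp
      also have "\<dots> \<in> X" using k(2) \<epsilon>[of "inv_into UNIV \<pi> k"] by (intro XI) auto
      finally show "(\<chi> i. \<epsilon> i * x $ \<pi> i) \<in> X" .
    qed
  next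
    assume f: "linear f \<and> f ` X = X"
    have "f (axis i 1) \<in> X" for i using f X by blast
    then have "\<forall>i. \<exists>j s. f (axis i 1) = s *\<^sub>R axis j 1 \<and> (s = 1 \<or> s = - 1)" using XE by blast
    then obtain \<rho> e where \<rho>: "\<And>i. f (axis i 1) = e i *\<^sub>R axis (\<rho> i) 1" "\<And>i. e i = 1 \<or> e i = - 1"
      by metis
    have injX: "inj_on f X" using f finX by (metis finite_surj_inj order_refl)
    \<comment> \<open>Images on the same axis agree up to sign, and the sign is absorbed because
      \<open>X\<close> contains the negatives.\<close>
    have "inj \<rho>"
    proof (rule injI)
      fix i j assume "\<rho> i = \<rho> j"
      then have "f (axis i 1) = f (axis j 1) \<or> f (axis i 1) = f (- axis j 1)"
        using \<rho>(1)[of i] \<rho>(1)[of j] \<rho>(2)[of i] \<rho>(2)[of j] f by (auto simp: linear_neg)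
      then have "axis i (1::real) = axis j 1 \<or> axis i (1::real) = - axis j 1"
        using injX unfolding inj_on_def X by blast
      then show "i = j" using axis_eq_neg_axis by (metis axis_eq_axis zero_neq_one)
    qed
    then have "bij \<rho>" by (simp add: bij_def finite_UNIV_inj_surj)
    then have "f = (\<lambda>x. \<chi> j. e (inv_into UNIV \<rho> j) * x $ inv_into UNIV \<rho> j)"
      using linear_monomial_eq[of f \<rho> e] f \<rho>(1) by simp
    moreover have "range (\<lambda>j. e (inv_into UNIV \<rho> j)) \<subseteq> {- 1, 1}" using \<rho>(2) by auto
    ultimately show "f \<in> signed_coordinate_permutations"
      unfolding signed_coordinate_permutations_def mem_Collect_eq
      using bij_imp_bij_inv[OF \<open>bij \<rho>\<close>]
      by (intro exI[of _ "\<lambda>j. e (inv_into UNIV \<rho> j)"] exI[of _ "inv_into UNIV \<rho>"]) simp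
  qed
  then have WX: "W = {f. linear f \<and> f ` X = X}" unfolding W by blast
  show "signed_frame W X"
  proof
    show "p \<bullet> q = (if p = q then 1 else if p = - q then - 1 else 0)" if "p \<in> X" "q \<in> X" for p q
      using that axis_eq_neg_axis axis_eq_neg_axis[symmetric] unfolding X
      by (auto simp: inner_axis_axis axis_eq_axis)
    show "(\<forall>p\<in>X. - p \<in> X) \<or> (\<forall>p\<in>X. - p \<notin> X)" unfolding X by auto
    show "span X = UNIV" unfolding XB using span_mono[of Basis "Basis \<union> uminus ` Basis"] by auto
  qed (simp_all add: finX WX)
qed

subsection \<open>Dihedral groups\<close>

definition circ :: "'a::euclidean_space \<Rightarrow> 'a \<Rightarrow> real \<Rightarrow> 'a" where
  "circ u v t = cos t *\<^sub>R u + sin t *\<^sub>R v"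

context
  fixes u v :: "'a::euclidean_space"
  assumes uv: "u \<noteq> 0" "norm v = norm u" "orthogonal u v"
begin

lemma circ_inner: "circ u v s \<bullet> circ u v t = (u \<bullet> u) * cos (s - t)"
proof -
  have "v \<bullet> v = u \<bullet> u" "u \<bullet> v = 0" "v \<bullet> u = 0"
    using uv by (simp_all add: dot_square_norm orthogonal_def inner_commute)
  then show ?thesis by (simp add: circ_def inner_add_left inner_add_right cos_diff algebra_simps)
qed

text \<open>The direction at angle \<open>s\<close> is reversed, so angles are mirrored about
  \<open>s + pi / 2\<close>.\<close>

lemma reflect_circ: "reflect_along (circ u v s) (circ u v t) = circ u v (2 * s + pi - t)"
proof -
  have "2 * (circ u v t \<bullet> circ u v s) / (circ u v s \<bullet> circ u v s) = 2 * cos (t - s)"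
    using uv(1) by (simp add: circ_inner)
  moreover have "cos t - 2 * cos (t - s) * cos s = cos (2 * s + pi - t)"
    "sin t - 2 * cos (t - s) * sin s = sin (2 * s + pi - t)"
  proof -
    have e: "2 * s + pi - t = s - (t - s) + pi" "t = s + (t - s)" by simp_all
    have "cos (s + r) - 2 * cos r * cos s = cos (s - r + pi)" "sin (s + r) - 2 * cos r * sin s = sin (s - r + pi)" for r
      by (simp_all add: cos_add cos_diff sin_add sin_diff algebra_simps)
    from this[of "t - s"] show "cos t - 2 * cos (t - s) * cos s = cos (2 * s + pi - t)"
      "sin t - 2 * cos (t - s) * sin s = sin (2 * s + pi - t)"
      unfolding e(2)[symmetric] e(1)[symmetric] by simp_all
  qed
  ultimately show ?thesis
    by (simp add: reflect_along_def circ_def scaleR_right_distrib flip: scaleR_left_diff_distrib)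
      (simp add: algebra_simps)
qed

lemma circ_diff: "circ u v s - circ u v t = (2 * sin ((s - t) / 2)) *\<^sub>R circ u v ((s + t) / 2 + pi / 2)"
proof -
  have "sin ((t - s) / 2) = - sin ((s - t) / 2)" by (metis minus_diff_eq minus_divide_left sin_minus)
  then have "cos s - cos t = - (2 * sin ((s - t) / 2) * sin ((s + t) / 2))"
    "sin s - sin t = 2 * sin ((s - t) / 2) * cos ((s + t) / 2)"
    by (simp_all add: cos_diff_cos sin_diff_sin)
  moreover have "circ u v s - circ u v t = (cos s - cos t) *\<^sub>R u + (sin s - sin t) *\<^sub>R v"
    by (simp add: circ_def algebra_simps)
  ultimately show ?thesis by (simp add: circ_def sin_add cos_add scaleR_right_distrib scaleR_right_diff_distrib)
qed

lemma reflect_circ_diff: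
  assumes "circ u v s \<noteq> circ u v t"
  shows "reflect_along (circ u v s - circ u v t) (circ u v r) = circ u v (s + t - r)"
proof -
  have "2 * sin ((s - t) / 2) \<noteq> 0" using assms circ_diff[of s t] by auto
  then have "reflect_along (circ u v s - circ u v t) (circ u v r) = circ u v (2 * ((s + t) / 2 + pi / 2) + pi - r)"
    unfolding circ_diff reflect_along_scaleR reflect_circ[symmetric] by (simp add: reflect_along_scaleR)
  also have "2 * ((s + t) / 2 + pi / 2) + pi - r = s + t - r + 2 * pi" by (simp add: field_simps)
  finally show ?thesis by (simp add: circ_def)
qed

text \<open>Integer indices keep sums and differences of vertex angles inside the family without
  reduction modulo \<open>m\<close>.\<close>

lemma polygon_eq_range:
  assumes "0 < m"
  shows "(\<lambda>k. cos (2 * pi * real k / real m) *\<^sub>R u + sin (2 * pi * real k / real m) *\<^sub>R v) ` {..<m}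
    = range (\<lambda>j::int. circ u v (2 * pi * of_int j / real m))"
proof -
  have "circ u v (2 * pi * of_int j / real m) \<in> (\<lambda>k. circ u v (2 * pi * real k / real m)) ` {..<m}" for j :: int
  proof
    have "real_of_int j = real_of_int (j div int m * int m + j mod int m)" by simp
    also have "\<dots> = of_int (j div int m) * real m + real_of_int (j mod int m)"
      by (simp only: of_int_add of_int_mult of_int_of_nat_eq)
    also have "real_of_int (j mod int m) = real (nat (j mod int m))" using assms by simp
    finally have "real_of_int j = of_int (j div int m) * real m + real (nat (j mod int m))" .
    then have "2 * pi * of_int j / real m = 2 * pi * real (nat (j mod int m)) / real m + 2 * pi * of_int (j div int m)"
      using assms by (simp add: field_simps)
    then show "circ u v (2 * pi * of_int j / real m) = circ u v (2 * pi * real (nat (j mod int m)) / real m)"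
      by (simp only: circ_def sin_add cos_add cos_int_2pin sin_int_2pin) simp
    show "nat (j mod int m) \<in> {..<m}" using assms by (simp add: nat_less_iff)
  qed
  moreover have "circ u v (2 * pi * real k / real m) \<in> range (\<lambda>j::int. circ u v (2 * pi * of_int j / real m))" for k
    by (rule range_eqI[of _ _ "int k"]) simp
  ultimately show ?thesis unfolding circ_def by blast
qed

end

lemma norm_polygon:
  assumes "regular_polygon m X" "p \<in> X" "q \<in> X"
  shows "norm p = norm q"
proof -
  obtain u v where uv: "u \<noteq> 0" "norm v = norm u" "orthogonal u v"
    and X: "X = (\<lambda>k. cos (2 * pi * real k / real m) *\<^sub>R u + sin (2 * pi * real k / real m) *\<^sub>R v) ` {..<m}"
    using assms(1) unfolding regular_polygon_def by blast
  obtain s t where "p = circ u v s" "q = circ u v t"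
    using assms(2,3) unfolding X circ_def by blast
  then show ?thesis using circ_inner[OF uv] by (simp add: norm_eq_sqrt_inner)
qed

text \<open>The vertex \<open>u\<close> and its neighbours at angles \<open>t\<close> and
  \<open>- t\<close> already show the two additional facts. The first will make the simple roots
  span the plane, the second will show that they are not orthogonal.\<close>

lemma dihedral_isometry_group:
  fixes W :: "('a::euclidean_space \<Rightarrow> 'a) set"
  assumes dim: "DIM('a) = 2" and m: "3 \<le> m" and W: "dihedral_group m W"
  shows "\<exists>D. isometry_group W D \<and> (\<forall>z. (\<forall>p\<in>D. \<forall>q\<in>D. z \<bullet> p = z \<bullet> q) \<longrightarrow> z = 0) \<and>
    (\<exists>p\<in>D. \<exists>q\<in>D. \<exists>r\<in>D. p \<noteq> q \<and> r \<noteq> p \<and> r \<noteq> q)"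
proof -
  obtain D where rD: "regular_polygon m D" and WD: "W = {f. orthogonal_transformation f \<and> f ` D = D}"
    using W unfolding dihedral_group_def by blast
  obtain u v where uv: "u \<noteq> 0" "norm v = norm u" "orthogonal u v"
    and D0: "D = (\<lambda>k. cos (2 * pi * real k / real m) *\<^sub>R u + sin (2 * pi * real k / real m) *\<^sub>R v) ` {..<m}"
    using rD unfolding regular_polygon_def by blast
  have D: "D = range (\<lambda>j::int. circ u v (2 * pi * of_int j / real m))"
    unfolding D0 using m by (intro polygon_eq_range[OF uv]) simp
  define t where "t = 2 * pi / real m"
  have t: "0 < t" "t < pi" using m by (simp_all add: t_def field_simps)
  have st: "0 < sin t" using t by (rule sin_gt_zero)
  have ct: "cos t \<noteq> 1" using st cos_one_sin_zero[of t] by auto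
  have c0: "circ u v 0 = u" by (simp add: circ_def)
  have p0: "u \<in> D" unfolding D by (rule range_eqI[of _ _ 0]) (simp add: c0)
  have p1: "circ u v t \<in> D" unfolding D by (rule range_eqI[of _ _ 1]) (simp add: t_def)
  have p2: "circ u v (- t) \<in> D" unfolding D by (rule range_eqI[of _ _ "- 1"]) (simp add: t_def)
  have vs: "v = inverse (sin t) *\<^sub>R (circ u v t - cos t *\<^sub>R u)" using st by (simp add: circ_def)
  have v0: "v \<noteq> 0" using uv by auto
  have neuv: "u \<noteq> v" using uv by (auto simp: orthogonal_self)
  have "independent {u, v}"
    using uv v0 by (intro pairwise_orthogonal_independent) (auto simp: pairwise_insert orthogonal_commute)
  then have "dim {u, v} = DIM('a)" using neuv dim by (simp add: dim_eq_card_independent)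
  then have sp: "span {u, v} = UNIV" using dim_eq_full by blast
  have dist: "circ u v t \<noteq> u" "circ u v (- t) \<noteq> u" "circ u v t \<noteq> circ u v (- t)"
  proof -
    have "u \<bullet> circ u v t = (u \<bullet> u) * cos t" "u \<bullet> circ u v (- t) = (u \<bullet> u) * cos t"
      using circ_inner[OF uv, of 0 t] circ_inner[OF uv, of 0 "- t"] by (simp_all add: c0)
    then show "circ u v t \<noteq> u" "circ u v (- t) \<noteq> u" using ct uv(1) by (metis inner_eq_zero_iff mult_cancel_left2)+
    show "circ u v t \<noteq> circ u v (- t)"
    proof
      assume "circ u v t = circ u v (- t)"
      then have "sin t *\<^sub>R v = - (sin t *\<^sub>R v)" by (simp add: circ_def)
      then have "sin t *\<^sub>R v + sin t *\<^sub>R v = 0" by (metis add.right_inverse)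
      then have "2 *\<^sub>R (sin t *\<^sub>R v) = 0" by (simp only: scaleR_2)
      then show False using st v0 by simp
    qed
  qed
  have iso: "isometry_group W D"
  proof
    show "finite D" by (simp add: D0)
    have "v \<in> span D"
      by (subst vs) (intro span_scale span_diff span_base p0 p1)
    then have "{u, v} \<subseteq> span D" using p0 span_base by blast
    then show "span D = UNIV" using sp by (metis span_mono span_span top.extremum_uniqueI)
    show "W = {f. orthogonal_transformation f \<and> f ` D = D}" by (rule WD)
    show "norm p = norm q" if "p \<in> D" "q \<in> D" for p q using norm_polygon[OF rD that] .
    show "reflect_along (p - q) \<in> W" if pq: "p \<in> D" "q \<in> D" "p \<noteq> q" for p q
    proof -
      obtain i j :: int where ij: "p = circ u v (2 * pi * of_int i / real m)" "q = circ u v (2 * pi * of_int j / real m)"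
        using pq unfolding D by blast
      have "reflect_along (p - q) r \<in> D" if "r \<in> D" for r
      proof -
        obtain k :: int where k: "r = circ u v (2 * pi * of_int k / real m)" using \<open>r \<in> D\<close> unfolding D by blast
        have "reflect_along (p - q) r = circ u v (2 * pi * of_int i / real m + 2 * pi * of_int j / real m - 2 * pi * of_int k / real m)"
          unfolding ij k using pq(3) ij by (intro reflect_circ_diff[OF uv]) simp
        also have "2 * pi * of_int i / real m + 2 * pi * of_int j / real m - 2 * pi * of_int k / real m
            = 2 * pi * of_int (i + j - k) / real m"
          by (simp add: add_divide_distrib diff_divide_distrib algebra_simps)
        finally show ?thesis unfolding D by blast
      qed
      moreover have "D \<subseteq> reflect_along (p - q) ` D" using calculation by (metis image_eqI reflect_along_involution subsetI)
      ultimately have "reflect_along (p - q) ` D = D" by blast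
      then show ?thesis by (simp add: WD orthogonal_reflect_along)
    qed
  qed
  moreover have "z = 0" if z: "\<And>p q. p \<in> D \<Longrightarrow> q \<in> D \<Longrightarrow> z \<bullet> p = z \<bullet> q" for z
  proof -
    have e: "z \<bullet> circ u v t = z \<bullet> u" "z \<bullet> circ u v (- t) = z \<bullet> u" using z p0 p1 p2 by blast+
    then have "cos t * (z \<bullet> u) + sin t * (z \<bullet> v) = z \<bullet> u" "cos t * (z \<bullet> u) - sin t * (z \<bullet> v) = z \<bullet> u"
      by (simp_all add: circ_def inner_add_right inner_diff_right)
    then have "(cos t - 1) * (z \<bullet> u) = 0" "sin t * (z \<bullet> v) = 0" by (simp_all add: algebra_simps)
    then have "orthogonal z u" "orthogonal z v" using ct st by (simp_all add: orthogonal_def)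
    then have "orthogonal z z" using orthogonal_to_span[of z "{u, v}" z] sp by auto
    then show "z = 0" by (simp add: orthogonal_self)
  qed
  ultimately show ?thesis using p0 p1 p2 dist by (intro exI[of _ D] conjI) blast+
qed


text \<open>\<open>D\<close> defines the group while \<open>X\<close> is an orbit; the two may be
  different \<open>m\<close>-gons.\<close>

theorem dihedral_noncrossing_and_disjoint:
  fixes W :: "('a::euclidean_space \<Rightarrow> 'a) set"
  assumes dim: "DIM('a) = 2" and m: "3 \<le> m" and W: "dihedral_group m W"
    and X: "regular_polygon m X" "X = orbit_of W x"
    and sys: "simple_system W \<Delta>" and bip: "bipartition \<Delta> \<Delta>p \<Delta>m"
    and cox: "bipartite_coxeter_element \<Delta>p \<Delta>m c" and plane: "coxeter_plane \<Delta> \<Delta>p \<Delta>m P"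
    and par: "parabolic W \<Delta> H"
  shows "noncrossing W \<Delta> c H" and "block_hulls_disjoint P H X"
proof -
  obtain D where iso: "isometry_group W D"
    and nofix': "\<forall>z. (\<forall>p\<in>D. \<forall>q\<in>D. z \<bullet> p = z \<bullet> q) \<longrightarrow> z = 0"
    and three: "\<exists>p\<in>D. \<exists>q\<in>D. \<exists>r\<in>D. p \<noteq> q \<and> r \<noteq> p \<and> r \<noteq> q"
    using dihedral_isometry_group[OF dim m W] by blast
  have nofix: "z = 0" if "\<And>p q. p \<in> D \<Longrightarrow> q \<in> D \<Longrightarrow> z \<bullet> p = z \<bullet> q" for z
    using nofix' that by blast
  interpret isometry_group W D by (rule iso)
  obtain l k \<omega> where pos: "\<And>\<alpha>. \<alpha> \<in> \<Delta> \<Longrightarrow> 0 < k \<alpha>" and dual: "dual_basis \<Delta> \<omega>"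
    and P: "P = span {\<Sum>\<alpha>\<in>\<Delta>p. k \<alpha> *\<^sub>R \<omega> \<alpha>, \<Sum>\<alpha>\<in>\<Delta>m. k \<alpha> *\<^sub>R \<omega> \<alpha>}"
    using plane unfolding coxeter_plane_def by blast
  interpret simple_roots W D \<Delta> \<omega> by unfold_locales (rule sys, rule dual)
  note refl = reflections_\<Delta>[OF order_refl]
  note gen = simple_reflections_generate
  \<comment> \<open>A vector orthogonal to the simple roots is fixed by their reflections, hence by
    all of \<open>W\<close>, so it is orthogonal to every \<open>p - q\<close>.\<close>
  have perp: "z = 0" if z: "\<And>\<alpha>. \<alpha> \<in> \<Delta> \<Longrightarrow> z \<bullet> \<alpha> = 0" for z
  proof (rule nofix)
    fix p q assume pq: "p \<in> D" "q \<in> D"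
    show "z \<bullet> p = z \<bullet> q"
    proof (cases "p = q")
      case False
      then have "reflect_along (p - q) \<in> words (reflect_along ` \<Delta>)" using reflect_diff_in_W pq gen by simp
      then obtain ts where ts: "reflect_along (p - q) = word_prod ts" "set ts \<subseteq> reflect_along ` \<Delta>"
        by (auto simp: words_def)
      have "reflect_along (p - q) z = z" unfolding ts(1)
        using ts(2) z reflect_along_orthogonal by (intro word_prod_fixes) blast
      then have "(2 * (z \<bullet> (p - q)) / ((p - q) \<bullet> (p - q))) *\<^sub>R (p - q) = 0"
        by (simp add: reflect_along_def)
      moreover have "p - q \<noteq> 0" "(p - q) \<bullet> (p - q) \<noteq> 0" using False by simp_all
      ultimately have "z \<bullet> (p - q) = 0"
        unfolding scaleR_eq_0_iff divide_eq_0_iff mult_eq_0_iff by simp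
      then show ?thesis by (simp only: inner_diff_right right_minus_eq)
    qed simp
  qed
  have span\<Delta>: "span \<Delta> = UNIV"
  proof -
    have "v \<in> span \<Delta>" for v
    proof -
      obtain y z where yz: "y \<in> span \<Delta>" "\<And>w. w \<in> span \<Delta> \<Longrightarrow> orthogonal z w" "v = y + z"
        using orthogonal_subspace_decomp_exists[of \<Delta> v] by blast
      have "z = 0" using yz(2) by (intro perp) (simp add: orthogonal_def span_base)
      then show ?thesis using yz by simp
    qed
    then show ?thesis by blast
  qed
  have ind: "independent \<Delta>" using sys by (simp add: simple_system_def)
  have "card \<Delta> = 2" using dim_eq_card_independent[OF ind] span\<Delta> dim by (metis dim_UNIV dim_span)
  then obtain \<alpha> \<beta> where ab: "\<Delta> = {\<alpha>, \<beta>}" "\<alpha> \<noteq> \<beta>" by (meson card_2_iff)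

  \<comment> \<open>With orthogonal simple roots the only roots would be these two and their
    negatives. The sides of a triangle of vertices would then have only two directions, so two sides
    would be parallel and the vertices collinear.\<close>
  have nonorth: "\<alpha> \<bullet> \<beta> \<noteq> 0"
  proof
    assume orth: "\<alpha> \<bullet> \<beta> = 0"
    define S where "S = {\<alpha>, - \<alpha>, \<beta>, - \<beta>}"
    have ra: "reflect_along \<alpha> \<beta> = \<beta>" "reflect_along \<beta> \<alpha> = \<alpha>"
      using orth by (simp_all add: reflect_along_orthogonal inner_commute)
    have neg: "reflect_along a (- v) = - reflect_along a v" for a v :: 'a
      by (rule linear_neg[OF linear_reflect_along])
    have inv: "\<forall>s\<in>S. f s \<in> S" if "f \<in> words (reflect_along ` \<Delta>)" for f
      using that
    proof (induction rule: words_induct)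
      case id
      show ?case by simp
    next
      case (step t f)
      have "t s \<in> S" if "s \<in> S" for s
        using that step(1) ra by (auto simp: ab(1) S_def neg)
      then show ?case using step(3) by simp
    qed
    have roots: "\<gamma> \<in> S" if \<gamma>: "\<gamma> \<in> unit_roots W" for \<gamma>
    proof -
      obtain f \<gamma>' where f: "f \<in> words (reflect_along ` \<Delta>)" "f \<gamma>' \<in> \<Delta>" "\<gamma>' = \<gamma> \<or> \<gamma>' = - \<gamma>"
        using simple_reflections_reach_root[OF \<gamma>] by blast
      obtain f' where f': "f' \<in> words (reflect_along ` \<Delta>)" "f' \<circ> f = id"
        using words_inverse[OF reflections_involution[OF subsetD[OF refl]] f(1)] by blast
      have "f' (f \<gamma>') \<in> S" using inv[OF f'(1)] f(2) by (auto simp: ab(1) S_def)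
      then have "\<gamma>' \<in> S" using f'(2) by (metis comp_apply id_apply)
      then show ?thesis using f(3) by (auto simp: S_def)
    qed
    have par: "\<exists>s. s \<noteq> 0 \<and> (p - q = s *\<^sub>R \<alpha> \<or> p - q = s *\<^sub>R \<beta>)" if pq: "p \<in> D" "q \<in> D" "p \<noteq> q" for p q
    proof -
      let ?n = "norm (p - q)"
      have n: "?n \<noteq> 0" using pq by simp
      have "(p - q) /\<^sub>R ?n \<in> unit_roots W" by (rule unit_root_diff[OF pq])
      moreover define e where "e = (p - q) /\<^sub>R ?n"
      ultimately have "e \<in> S" using roots by simp
      then consider "e = \<alpha>" | "e = - \<alpha>" | "e = \<beta>" | "e = - \<beta>" unfolding S_def by blast
      moreover have "p - q = ?n *\<^sub>R e" using n by (simp add: e_def)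
      ultimately show ?thesis
        using n by cases (metis scaleR_minus_left scaleR_minus_right neg_equal_0_iff_equal)+
    qed
    have ratio: "\<exists>t. v = t *\<^sub>R w" if "v = s *\<^sub>R a" "w = s' *\<^sub>R a" "s' \<noteq> 0" for v w a :: 'a and s s'
      using that by (intro exI[of _ "s / s'"]) simp
    have np: "p - r \<noteq> t *\<^sub>R (p - q)" if "p \<in> D" "q \<in> D" "r \<in> D" "p \<noteq> q" "r \<noteq> p" "r \<noteq> q" for p q r t
      by (rule sphere_not_collinear[OF norm_Y[OF that(2,1)] norm_Y[OF that(3,1)] that(4-6)])
    obtain p q r where pqr: "p \<in> D" "q \<in> D" "r \<in> D" "p \<noteq> q" "r \<noteq> p" "r \<noteq> q" using three by blast
    obtain s1 where s1: "s1 \<noteq> 0" "p - q = s1 *\<^sub>R \<alpha> \<or> p - q = s1 *\<^sub>R \<beta>" using par pqr by metis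
    obtain s2 where s2: "s2 \<noteq> 0" "p - r = s2 *\<^sub>R \<alpha> \<or> p - r = s2 *\<^sub>R \<beta>" using par pqr by metis
    obtain s3 where s3: "s3 \<noteq> 0" "q - r = s3 *\<^sub>R \<alpha> \<or> q - r = s3 *\<^sub>R \<beta>" using par pqr by metis
    have 12: "\<not> (\<exists>t. p - r = t *\<^sub>R (p - q))" using np pqr by blast
    have 13: "\<not> (\<exists>t. q - r = t *\<^sub>R (p - q))"
    proof
      assume "\<exists>t. q - r = t *\<^sub>R (p - q)"
      then obtain t where "q - r = t *\<^sub>R (p - q)" by blast
      then have "q - r = (- t) *\<^sub>R (q - p)" by (simp add: algebra_simps)
      then show False using np[of q p r "- t"] pqr by auto
    qed
    have 23: "\<not> (\<exists>t. q - r = t *\<^sub>R (p - r))"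
    proof
      assume "\<exists>t. q - r = t *\<^sub>R (p - r)"
      then obtain t where t: "q - r = t *\<^sub>R (p - r)" by blast
      have "r - q = - (q - r)" by simp
      also have "\<dots> = t *\<^sub>R (r - p)" unfolding t by (simp flip: scaleR_minus_right)
      finally have "r - q = t *\<^sub>R (r - p)" .
      then show False using np[of r p q t] pqr by auto
    qed
    show False
      using s1(2)
    proof
      assume 1: "p - q = s1 *\<^sub>R \<alpha>"
      have 2: "p - r = s2 *\<^sub>R \<beta>" using s2(2) ratio[OF _ 1 s1(1), of "p - r" s2] 12 by metis
      have "q - r = s3 *\<^sub>R \<beta>" using s3(2) ratio[OF _ 1 s1(1), of "q - r" s3] 13 by metis
      then show False using ratio[OF _ 2 s2(1), of "q - r" s3] 23 by metis
    next
      assume 1: "p - q = s1 *\<^sub>R \<beta>"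
      have 2: "p - r = s2 *\<^sub>R \<alpha>" using s2(2) ratio[OF _ 1 s1(1), of "p - r" s2] 12 by metis
      have "q - r = s3 *\<^sub>R \<alpha>" using s3(2) ratio[OF _ 1 s1(1), of "q - r" s3] 13 by metis
      then show False using ratio[OF _ 2 s2(1), of "q - r" s3] 23 by metis
    qed
  qed

  have notin: "\<not> (\<alpha> \<in> E \<and> \<beta> \<in> E)" if E: "E \<in> {\<Delta>p, \<Delta>m}" for E
  proof
    assume e: "\<alpha> \<in> E \<and> \<beta> \<in> E"
    have "pairwise (\<lambda>\<alpha> \<beta>. reflect_along \<alpha> \<circ> reflect_along \<beta> = reflect_along \<beta> \<circ> reflect_along \<alpha>) E"
      using bip E unfolding bipartition_def by blast
    then have "reflect_along \<alpha> \<circ> reflect_along \<beta> = reflect_along \<beta> \<circ> reflect_along \<alpha>"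
      using e ab(2) unfolding pairwise_def by blast
    moreover have "norm \<alpha> = 1" "norm \<beta> = 1" "\<alpha> \<bullet> \<omega> \<alpha> = 1" "\<beta> \<bullet> \<omega> \<alpha> = 0"
      using norm_\<Delta> inner_\<omega> ab by simp_all
    ultimately have "\<alpha> \<bullet> \<beta> = 0" using commuting_reflections_orthogonal[of \<alpha> \<beta> "\<omega> \<alpha>"] by simp
    then show False using nonorth by simp
  qed
  have parts: "\<Delta> = \<Delta>p \<union> \<Delta>m" "\<Delta>p \<inter> \<Delta>m = {}" using bip by (auto simp: bipartition_def)
  have cases: "\<Delta>p = {\<alpha>} \<and> \<Delta>m = {\<beta>} \<or> \<Delta>p = {\<beta>} \<and> \<Delta>m = {\<alpha>}"
  proof -
    have sub: "\<Delta>p \<subseteq> \<Delta>" "\<Delta>m \<subseteq> \<Delta>" using parts(1) by simp_all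
    have mem: "\<alpha> \<in> \<Delta>p \<or> \<alpha> \<in> \<Delta>m" "\<beta> \<in> \<Delta>p \<or> \<beta> \<in> \<Delta>m"
      using parts(1) ab(1) by (metis Un_iff insertCI)+
    have no: "\<not> (\<alpha> \<in> \<Delta>p \<and> \<beta> \<in> \<Delta>p)" "\<not> (\<alpha> \<in> \<Delta>m \<and> \<beta> \<in> \<Delta>m)"
      using notin by simp_all
    show ?thesis using mem no parts(2) sub[unfolded ab(1)] by blast
  qed

  have PU: "P = UNIV"
  proof -
    have "P = span {k \<alpha> *\<^sub>R \<omega> \<alpha>, k \<beta> *\<^sub>R \<omega> \<beta>}" 
      using cases unfolding P by (elim disjE conjE) (simp_all add: insert_commute)
    then have kP: "k \<alpha> *\<^sub>R \<omega> \<alpha> \<in> P" "k \<beta> *\<^sub>R \<omega> \<beta> \<in> P"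
      by (simp_all add: span_base)
    have sP: "subspace P" by (simp add: P)
    have "k \<alpha> \<noteq> 0" "k \<beta> \<noteq> 0" using pos[of \<alpha>] pos[of \<beta>] ab by auto
    then have \<omega>P: "\<omega> \<alpha> \<in> P" "\<omega> \<beta> \<in> P"
      using subspace_scale[OF sP kP(1), of "inverse (k \<alpha>)"] subspace_scale[OF sP kP(2), of "inverse (k \<beta>)"]
      by simp_all
    have "v \<in> P" for v
    proof -
      have "v - ((v \<bullet> \<alpha>) *\<^sub>R \<omega> \<alpha> + (v \<bullet> \<beta>) *\<^sub>R \<omega> \<beta>) = 0"
      proof (rule perp)
        have "\<omega> \<alpha> \<bullet> \<alpha> = 1" "\<omega> \<alpha> \<bullet> \<beta> = 0" "\<omega> \<beta> \<bullet> \<alpha> = 0" "\<omega> \<beta> \<bullet> \<beta> = 1"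
          using inner_\<omega> ab by (simp_all add: inner_commute)
        then show "(v - ((v \<bullet> \<alpha>) *\<^sub>R \<omega> \<alpha> + (v \<bullet> \<beta>) *\<^sub>R \<omega> \<beta>)) \<bullet> \<delta> = 0" if "\<delta> \<in> \<Delta>" for \<delta>
          using that by (auto simp: ab(1) inner_diff_left inner_add_left)
      qed
      then have eq: "(v \<bullet> \<alpha>) *\<^sub>R \<omega> \<alpha> + (v \<bullet> \<beta>) *\<^sub>R \<omega> \<beta> = v" by simp
      have "(v \<bullet> \<alpha>) *\<^sub>R \<omega> \<alpha> + (v \<bullet> \<beta>) *\<^sub>R \<omega> \<beta> \<in> P"
        using \<omega>P by (intro subspace_add[OF sP] subspace_scale[OF sP])
      then show ?thesis unfolding eq .
    qed
    then show ?thesis by blast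
  qed
  have proj: "orth_proj P y = y" for y
  proof -
    have "orthogonal (y - orth_proj P y) (y - orth_proj P y)"
      by (rule orth_proj_in(2)) (simp_all add: PU)
    then show ?thesis by (simp add: orthogonal_self)
  qed

  obtain ds where ds: "word_prod (map reflect_along ds) = c" "set ds = \<Delta>" "length ds = 2"
  proof -
    obtain cp cm as bs where "c = cm \<circ> cp" "distinct as" "set as = \<Delta>p" "cp = word_prod (map reflect_along as)"
      "distinct bs" "set bs = \<Delta>m" "cm = word_prod (map reflect_along bs)"
      using cox unfolding bipartite_coxeter_element_def simple_product_def by blast
    moreover from this have "length as = 1" "length bs = 1" using cases by (auto simp flip: distinct_card)
    ultimately show ?thesis using that[of "bs @ as"] parts by (simp add: Un_commute)
  qed
  have cW: "c \<in> W" unfolding ds(1)[symmetric] using refl ds(2) by (intro word_in_W) auto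
  \<comment> \<open>If \<open>c z = z\<close>, both simple reflections displace \<open>z\<close>
    equally. The displacements are multiples of independent roots, so both vanish and
    \<open>z = 0\<close>. Hence \<open>c - 1\<close> is injective and therefore surjective.\<close>
  have "moved c = UNIV"
  proof -
    obtain a b where d: "ds = [a, b]" using ds(3) by (auto simp: length_Suc_conv numeral_2_eq_2)
    have abD: "a \<in> \<Delta>" "b \<in> \<Delta>" "a \<noteq> b" "\<Delta> = {a, b}" using ds(2) ab unfolding d by auto
    have fix0: "z = 0" if "c z = z" for z
    proof -
      have "reflect_along a (reflect_along b z) = z"
        using that fun_cong[OF ds(1), of z] by (simp add: d)
      then have "reflect_along b z = reflect_along a z" by (metis reflect_along_involution)
      then have e: "(2 * (z \<bullet> b) / (b \<bullet> b)) *\<^sub>R b = (2 * (z \<bullet> a) / (a \<bullet> a)) *\<^sub>R a"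
        by (simp add: reflect_along_def)
      have "z \<bullet> b = 0" using arg_cong[OF e, of "\<lambda>v. v \<bullet> \<omega> b"] inner_\<omega> abD \<Delta>_nonzero[of b] by simp
      moreover have "z \<bullet> a = 0" using arg_cong[OF e, of "\<lambda>v. v \<bullet> \<omega> a"] inner_\<omega> abD \<Delta>_nonzero[of a] by simp
      ultimately show "z = 0" using abD(4) by (intro perp) auto
    qed
    have lin: "linear (\<lambda>v. c v - v)" using linear_compose_sub[OF W_linear[OF cW] linear_ident] .
    have "inj (\<lambda>v. c v - v)"
      using fix0 by (subst linear_injective_0[OF lin]) simp
    then have "surj (\<lambda>v. c v - v)" using lin linear_injective_imp_surjective by blast
    then show ?thesis by (simp add: moved_def)
  qed
  then have dc: "dim (moved c) = 2" using dim by simp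

  have dsr: "reduced_T_word W (map reflect_along ds) c"
    using ds refl dc by (intro reduced_T_wordI) auto
  obtain J w where J: "J \<subseteq> \<Delta>" and w: "w \<in> W"
    and H0: "H = (\<lambda>u. w \<circ> u \<circ> inv_into UNIV w) ` words (reflect_along ` J)"
    using parabolicE[OF sys par] .
  have H: "H = words (reflect_along ` w ` J)" unfolding H0 by (rule conj_words[OF w])
  have wW: "(\<lambda>u. w \<circ> u \<circ> inv_into UNIV w) ` W = W"
  proof
    show "(\<lambda>u. w \<circ> u \<circ> inv_into UNIV w) ` W \<subseteq> W"
    proof (rule image_subsetI)
      show "w \<circ> u \<circ> inv_into UNIV w \<in> W" if "u \<in> W" for u
        using that w inv_in_W(1)[OF w] by (intro comp_in_W)
    qed
    show "W \<subseteq> (\<lambda>u. w \<circ> u \<circ> inv_into UNIV w) ` W"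
    proof
      fix f assume f: "f \<in> W"
      have iw: "w (inv_into UNIV w y) = y" for y
        using fun_cong[OF inv_in_W(3)[OF w], of y] by simp
      have "f = w \<circ> (inv_into UNIV w \<circ> f \<circ> w) \<circ> inv_into UNIV w"
        by (simp add: fun_eq_iff iw)
      moreover have "inv_into UNIV w \<circ> f \<circ> w \<in> W" using f w inv_in_W(1)[OF w] by (intro comp_in_W)
      ultimately show "f \<in> (\<lambda>u. w \<circ> u \<circ> inv_into UNIV w) ` W" by (rule image_eqI)
    qed
  qed
  consider "J = {}" | a where "a \<in> \<Delta>" "J = {a}" | "J = \<Delta>" using J ab by blast
  then have kinds: "H = words {} \<or> (\<exists>a. a \<noteq> 0 \<and> reflect_along a \<in> W \<and> H = words {reflect_along a}) \<or> H = W"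
  proof cases
    case 1
    then show ?thesis using H by simp
  next
    case 2
    have "w a \<noteq> 0"
      using \<Delta>_nonzero[OF 2(1)] injD[OF inj_on_W[OF w], of a 0] linear_0[OF W_linear[OF w]] by auto
    moreover have "reflect_along (w a) \<in> W"
      using words_conj_reflection[OF refl, of w a, unfolded gen] w reflect_\<Delta>[OF 2(1)] by simp
    ultimately show ?thesis using H 2 by auto
  next
    case 3
    then show ?thesis using H0 gen wW by simp
  qed

  show "noncrossing W \<Delta> c H"
    unfolding noncrossing_iff
  proof (intro conjI par)
    from kinds consider "H = words {}" | a where "a \<noteq> 0" "reflect_along a \<in> W" "H = words {reflect_along a}" | "H = W"
      by blast
    then show "\<exists>ts ws. reduced_T_word W (ts @ ws) c \<and> H = words (set ts)"
    proof cases
      case 1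
      then show ?thesis using dsr by (intro exI[of _ "[]"] exI[of _ "map reflect_along ds"]) simp
    next
      case 2
      \<comment> \<open>Every root lies in \<open>moved c\<close>, so each reflection can be the
        first letter of a reduced word of \<open>c\<close>.\<close>
      have "a \<in> moved c" using \<open>moved c = UNIV\<close> by simp
      then have lt: "dim (moved (reflect_along a \<circ> c)) < 2"
        using moved_reflect_along_comp(2)[OF W_orthogonal[OF cW] _ 2(1)] dc by simp
      obtain ws where ws: "set ws \<subseteq> reflections W" "word_prod ws = reflect_along a \<circ> c"
        "length ws \<le> dim (moved (reflect_along a \<circ> c))"
        using W_reflection_word comp_in_W[OF 2(2) cW] by blast
      have "word_prod ([reflect_along a] @ ws) = c"
        unfolding word_prod_append word_prod_Cons word_prod_Nil comp_id ws(2) comp_assoc[symmetric] by simp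
      moreover have "reflect_along a \<in> reflections W" using 2 unfolding reflections_eq by blast
      ultimately have "reduced_T_word W ([reflect_along a] @ ws) c"
        using ws lt dc by (intro reduced_T_wordI) auto
      then show ?thesis using 2(3) by (intro exI[of _ "[reflect_along a]"] exI[of _ ws]) simp
    next
      case 3
      then show ?thesis using dsr gen ds(2)
        by (intro exI[of _ "map reflect_along ds"] exI[of _ "[]"]) simp
    qed
  qed

  have "convex hull B \<inter> convex hull B' = {}" if blk: "B \<in> blocks H X" "B' \<in> blocks H X" "B \<noteq> B'" for B B'
  proof -
    obtain p q where pq: "p \<in> X" "B = orbit_of H p" "q \<in> X" "B' = orbit_of H q"
      using blk(1,2) by (auto simp: blocks_def)
    from kinds consider "H = words {}" | a where "a \<noteq> 0" "reflect_along a \<in> W" "H = words {reflect_along a}" | "H = W"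
      by blast
    then show ?thesis
    proof cases
      case 1
      have "words {} = {id :: 'a \<Rightarrow> 'a}" by (auto simp: words_def simp del: id_apply)
      then have "B = {p}" "B' = {q}" using 1 pq by (auto simp: orbit_of_def)
      then show ?thesis using blk(3) by simp
    next
      case 2
      let ?t = "reflect_along a"
      have "f = id \<or> f = ?t" if "f \<in> words {?t}" for f
        using that by (induction rule: words_induct) auto
      then have "words {?t} = {id, ?t}" using id_in_words words_base by blast
      then have orb: "orbit_of H y = {y, ?t y}" for y by (simp add: 2(3) orbit_of_def)
      \<comment> \<open>Each block hull lies on a line parallel to \<open>a\<close>. Such a line
        meets the circle in at most a point and its mirror image, so meeting hulls belong to equal
        blocks.\<close>
      have line: "\<exists>s. z = y + s *\<^sub>R a" if z: "z \<in> convex hull {y, ?t y}" for y z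
      proof -
        obtain \<theta> where "z = (1 - \<theta>) *\<^sub>R y + \<theta> *\<^sub>R ?t y"
          using z unfolding segment_convex_hull[symmetric] in_segment by blast
        then have "z = y + (- (\<theta> * (2 * (y \<bullet> a) / (a \<bullet> a)))) *\<^sub>R a"
          by (simp add: reflect_along_def algebra_simps)
        then show ?thesis by blast
      qed
      show ?thesis
      proof (rule ccontr)
        assume "convex hull B \<inter> convex hull B' \<noteq> {}"
        then obtain z where "z \<in> convex hull {p, ?t p}" "z \<in> convex hull {q, ?t q}"
          using pq orb by auto
        then obtain s s' where "z = p + s *\<^sub>R a" "z = q + s' *\<^sub>R a" using line by blast
        then have "q = p + s *\<^sub>R a - s' *\<^sub>R a" by (metis add_diff_cancel_right')
        then have q: "q = p + (s - s') *\<^sub>R a" by (simp add: scaleR_left_diff_distrib add_diff_eq)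
        define r where "r = s - s'"
        have "norm q = norm p" using norm_polygon[OF X(1)] pq by blast
        then have "q \<bullet> q = p \<bullet> p" by (simp add: dot_square_norm)
        then have "r * (2 * (p \<bullet> a) + r * (a \<bullet> a)) = 0"
          unfolding q r_def[symmetric] by (simp add: inner_add_left inner_add_right inner_commute algebra_simps)
        then have "r = 0 \<or> r * (a \<bullet> a) = - (2 * (p \<bullet> a))"
          by (metis add_eq_0_iff mult_eq_0_iff)
        then have "r = 0 \<or> r = - (2 * (p \<bullet> a) / (a \<bullet> a))"
          using 2(1) by (metis inner_eq_zero_iff minus_divide_left nonzero_eq_divide_eq)
        then have "q = p \<or> q = ?t p" unfolding q r_def[symmetric] by (auto simp: reflect_along_def)
        then have "B = B'" using pq orb by auto
        then show False using blk(3) by simp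
      qed
    next
      case 3
      have "orbit_of W y = X" if "y \<in> X" for y
      proof -
        obtain f where f: "f \<in> W" "y = f x" using \<open>y \<in> X\<close> X(2) by (auto simp: orbit_of_def)
        show ?thesis
        proof
          show "orbit_of W y \<subseteq> X"
          proof
            fix z assume "z \<in> orbit_of W y"
            then obtain w' where w': "w' \<in> W" "z = (w' \<circ> f) x" by (auto simp: orbit_of_def f(2))
            then show "z \<in> X" unfolding X(2) orbit_of_def using comp_in_W[OF w'(1) f(1)] by blast
          qed
          show "X \<subseteq> orbit_of W y"
          proof
            fix y' assume "y' \<in> X"
            then obtain f' where f': "f' \<in> W" "y' = f' x" using X(2) by (auto simp: orbit_of_def)
            have "y' = (f' \<circ> inv_into UNIV f) y"
              using inv_in_W(2)[OF f(1)] f(2) f'(2) by (metis comp_apply id_apply)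
            moreover have "f' \<circ> inv_into UNIV f \<in> W" using f' inv_in_W(1)[OF f(1)] by (intro comp_in_W)
            ultimately show "y' \<in> orbit_of W y" unfolding orbit_of_def by blast
          qed
        qed
      qed
      then show ?thesis using 3 pq blk(3) by simp
    qed
  qed
  then show "block_hulls_disjoint P H X"
    unfolding block_hulls_disjoint_def disjoint_family_on_def by (simp add: proj)
qed

theorem mainTheorem1:
  fixes W W' :: "(real^'n \<Rightarrow> real^'n) set"
    and X \<Delta> \<Delta>p \<Delta>m P :: "(real^'n) set"
    and c :: "real^'n \<Rightarrow> real^'n"
  assumes "(\<exists>n\<ge>2. type_A n W X) \<or> (\<exists>n\<ge>2. type_B n W X) \<or> (\<exists>m\<ge>3. type_I2 m W X)"
    and "simple_system W \<Delta>"
    and "bipartition \<Delta> \<Delta>p \<Delta>m"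
    and "bipartite_coxeter_element \<Delta>p \<Delta>m c"
    and "coxeter_plane \<Delta> \<Delta>p \<Delta>m P"
    and "parabolic W \<Delta> W'"
  shows "noncrossing W \<Delta> c W' \<longleftrightarrow> block_hulls_disjoint P W' X"
  using assms(1)
proof (elim disjE exE conjE)
  fix n assume n: "2 \<le> n" "type_A n W X"
  show ?thesis
    using signed_frame_type_A[OF n(2)] n(1)
    by (intro signed_frame_noncrossing_iff[OF _ _ assms(2-6)]) simp_all
next
  fix n assume n: "2 \<le> n" "type_B n W X"
  show ?thesis
    using signed_frame_type_B[OF n(2)] n(1)
    by (intro signed_frame_noncrossing_iff[OF _ _ assms(2-6)]) simp_all
next
  fix m assume m: "3 \<le> m" "type_I2 m W X"
  then obtain x where "DIM(real^'n) = 2" "dihedral_group m W" "regular_polygon m X" "X = orbit_of W x"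
    by (auto simp: type_I2_def)
  then show ?thesis
    using dihedral_noncrossing_and_disjoint[OF _ m(1) _ _ _ assms(2-6)] by blast
qed

end
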